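(* Let $q\in L^1_{\mathbb{R}}[0,\pi]$, $\alpha\in(0,\pi)$, and let $f$ be an absolutely continuous function on $[0,\pi]$. Let $\mu_n=\mu_n(q,\alpha,0)$, $n=0,1,2,\dots$, be the eigenvalues of the problem $L(q,\alpha,0)$, let $\varphi_n(x)=\varphi(x,\mu_n,\alpha)$ and $a_n=\int_0^\pi\varphi_n^2(x)\,dx$. Then for every $b\in(0,\pi)$, $$\lim_{N\to\infty}\max_{x\in[0,b]}\Big|f(x)-\sum_{n=0}^N c_n\varphi_n(x)\Big|=0,\qquad c_n=\frac{1}{a_n}\int_0^\pi f(t)\varphi_n(t)\,dt.$$
   Context: For $q\in L^1_{\mathbb{R}}[0,\pi]$ (real-valued summable), $\alpha\in(0,\pi]$, $\beta\in[0,\pi)$, $L(q,\alpha,\beta)$ denotes the Sturm–Liouville problem $-y''+q(x)y=\mu y$, $x\in(0,\pi)$, $y(0)\cos\alpha+y'(0)\sin\alpha=0$, $y(\pi)\cos\beta+y'(\pi)\sin\beta=0$ (for $\beta=0$ the right condition is $y(\pi)=0$). Its spectrum consists of simple real eigenvalues $\mu_0(q,\alpha,\beta)<\mu_1(q,\alpha,\beta)<\dots$. $\varphi(x,\mu,\alpha)$ denotes the solution of $-y''+qy=\mu y$ with $\varphi(0,\mu,\alpha)=\sin\alpha$, $\varphi'(0,\mu,\alpha)=-\cos\alpha$. *)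

theory Defs
  imports "HOL-Analysis.Analysis"
begin

text \<open>Absolute continuity of a real function on an interval (classical definition,
  with the finite families of non-overlapping subintervals listed in increasing order).\<close>
definition abs_cont_on :: "real set \<Rightarrow> (real \<Rightarrow> real) \<Rightarrow> bool" where
  "abs_cont_on S f \<longleftrightarrow>
     (\<forall>\<epsilon>>0. \<exists>\<delta>>0. \<forall>(n::nat) (a::nat \<Rightarrow> real) (b::nat \<Rightarrow> real).
        ((\<forall>k<n. a k \<in> S \<and> b k \<in> S \<and> a k \<le> b k) \<and> (\<forall>k. Suc k < n \<longrightarrow> b k \<le> a (Suc k))
          \<and> (\<Sum>k<n. b k - a k) < \<delta>)
        \<longrightarrow> (\<Sum>k<n. \<bar>f (b k) - f (a k)\<bar>) < \<epsilon>)"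

text \<open>(y, y') is a (Caratheodory) solution of  -y'' + q y = mu y  on [0,pi]:
  y is differentiable on [0,pi] with derivative y', and y' is absolutely continuous with
  y'' = (q - mu) y almost everywhere, i.e. y'(x) = y'(0) + integral from 0 to x of (q - mu) y.\<close>
definition sl_solution :: "(real \<Rightarrow> real) \<Rightarrow> real \<Rightarrow> (real \<Rightarrow> real) \<Rightarrow> (real \<Rightarrow> real) \<Rightarrow> bool" where
  "sl_solution q \<mu> y y' \<longleftrightarrow>
     (\<forall>x\<in>{0..pi}. (y has_real_derivative y' x) (at x within {0..pi})
        \<and> ((\<lambda>t. (q t - \<mu>) * y t) has_integral (y' x - y' 0)) {0..x})"

definition sl_phi :: "(real \<Rightarrow> real) \<Rightarrow> real \<Rightarrow> real \<Rightarrow> real \<Rightarrow> real" where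
  "sl_phi q \<alpha> \<mu> x = (THE v. \<exists>y y'. sl_solution q \<mu> y y' \<and> y 0 = sin \<alpha> \<and> y' 0 = - cos \<alpha> \<and> y x = v)"

definition sl_is_eigenvalue :: "(real \<Rightarrow> real) \<Rightarrow> real \<Rightarrow> real \<Rightarrow> real \<Rightarrow> bool" where
  "sl_is_eigenvalue q \<alpha> \<beta> \<mu> \<longleftrightarrow>
     (\<exists>y y'. sl_solution q \<mu> y y' \<and> (\<exists>x\<in>{0..pi}. y x \<noteq> 0)
        \<and> y 0 * cos \<alpha> + y' 0 * sin \<alpha> = 0 \<and> y pi * cos \<beta> + y' pi * sin \<beta> = 0)"

definition sl_eigenvalue :: "(real \<Rightarrow> real) \<Rightarrow> real \<Rightarrow> real \<Rightarrow> nat \<Rightarrow> real" where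
  "sl_eigenvalue q \<alpha> \<beta> n =
     (THE m. sl_is_eigenvalue q \<alpha> \<beta> m \<and> card {m'. sl_is_eigenvalue q \<alpha> \<beta> m' \<and> m' < m} = n)"

end

theory Submission
  imports Defs "HOL-Complex_Analysis.Great_Picard"
begin

text \<open>With phi_n = phi(., mu_n, alpha), let E_N(x,s) be the sum over n up to N of
  phi_n(x) / a_n times the integral of phi_n over [0,s], that is, the partial sum at x of the expansion of the
  indicator function of [0,s]. Summation by parts bounds the N-th partial sum of f by the variation of f
  times the size of E_N. Solution asymptotics give mu_n = (m + 1/2)^2 + O(1), where m - n is eventually constant
  (existence of an eigenvalue near each large half-integer is the intermediate value theorem, uniqueness is
  orthogonality of eigenfunctions), so up to an absolutely convergent error E_N is the trigonometric sum of
  (2/pi) cos((m+1/2) x) sin((m+1/2) s) / (m+1/2). Hence E_N is uniformly bounded, and uniformly Cauchy for x in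
  [0,b] and s away from x. As f has small variation on short intervals, its expansion converges uniformly on
  [0,b]. The limit g is bounded with the same coefficients as f, so f = g once the eigenfunctions are known to be
  complete. For completeness, the resolvent is compact and symmetric on the orthogonal complement of the
  eigenfunctions, and would have an eigenfunction there if the complement were non-trivial.\<close>

section \<open>Integrals of products and integration by parts\<close>

text \<open>The restriction b < pi is intrinsic: every \<phi>_n vanishes at pi while f pi is
  arbitrary, so the limit g jumps there unless f pi = 0. This is why f - g is treated as a summable
  function and identified through its primitive. The kernel of the partial sums has terms that do
  not decay. Integrating it in s gains one power of 1/n, so that errors of relative order 1/n become
  summable. The gain has to be taken from the differential equation itself: integrating pointwise
  asymptotics of \<phi>_n would lose it. At s = x the indicator function jumps, hence E_N cannot
  converge uniformly in s. A bounded contribution remains there, and only the small variation of f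
  near x suppresses it. As q is merely summable, second derivatives exist only almost everywhere;
  Green's identity is therefore derived from integration by parts for primitives of summable
  functions.\<close>

lemmas abs_integral_le = Henstock_Kurzweil_Integration.integral_norm_bound_integral[where 'a=real, unfolded real_norm_def]

lemma absolutely_integrable_mult_continuous:
  fixes g y :: "real \<Rightarrow> real"
  assumes "g absolutely_integrable_on {a..b}" "continuous_on {a..b} y"
  shows "(\<lambda>t. g t * y t) absolutely_integrable_on {a..b}"
proof -
  have "(\<lambda>t. y t * g t) absolutely_integrable_on {a..b}"
    using assms
    by (intro absolutely_integrable_bounded_measurable_product_real
        continuous_imp_measurable_on_sets_lebesgue compact_imp_bounded compact_continuous_image) auto
  then show ?thesis by (simp add: mult.commute)
qed

lemma absolutely_integrable_on_subset_Icc: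
  fixes g :: "real \<Rightarrow> real"
  assumes "g absolutely_integrable_on {a..b}" "a \<le> c" "d \<le> b"
  shows "g absolutely_integrable_on {c..d}"
  using assms by (intro absolutely_integrable_on_subinterval[OF assms(1)]) auto

text \<open>A Stieltjes form of "zero derivative implies constant": on a fine subdivision the
  increments of R are at most e by uniform continuity, while those of Q telescope. No
  differentiability is involved.\<close>

lemma eq_of_small_increments:
  fixes H Q R :: "real \<Rightarrow> real"
  assumes "a \<le> b" and cont: "continuous_on {a..b} R"
    and Q: "\<And>s t. a \<le> s \<Longrightarrow> s \<le> t \<Longrightarrow> t \<le> b \<Longrightarrow> Q s \<le> Q t"
    and H: "\<And>s t. a \<le> s \<Longrightarrow> s \<le> t \<Longrightarrow> t \<le> b \<Longrightarrow> \<bar>H t - H s\<bar> \<le> \<bar>R t - R s\<bar> * (Q t - Q s)"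
  shows "H b = H a"
proof -
  have *: "\<bar>H b - H a\<bar> \<le> e * (Q b - Q a)" if "e > 0" for e
  proof -
    have "uniformly_continuous_on {a..b} R"
      using cont compact_uniformly_continuous by blast
    then obtain d where d: "d > 0" "\<And>s t. s \<in> {a..b} \<Longrightarrow> t \<in> {a..b} \<Longrightarrow> dist t s < d \<Longrightarrow> dist (R t) (R s) < e"
      using \<open>e > 0\<close> unfolding uniformly_continuous_on_def by metis
    obtain m :: nat where m: "(b - a) / d < real m" using reals_Archimedean2 by blast
    with \<open>a \<le> b\<close> \<open>d > 0\<close> have m0: "m > 0" by (cases m) (auto simp: divide_less_0_iff)
    define t where "t j = a + real j * ((b - a) / m)" for j
    have t0: "t 0 = a" and tm: "t m = b" using m0 by (auto simp: t_def)
    have tS: "t (Suc j) - t j = (b - a) / m" for j by (simp add: t_def add_divide_distrib diff_divide_distrib distrib_right)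
    have mesh: "(b - a) / m < d" using m m0 d by (simp add: field_simps)
    have tle: "t j \<le> t (Suc j)" for j using tS[of j] \<open>a \<le> b\<close> by (smt (verit) divide_nonneg_nonneg of_nat_0_le_iff)
    have tmono: "mono t" using tle by (simp add: mono_iff_le_Suc)
    have tin: "a \<le> t j \<and> t j \<le> b" if "j \<le> m" for j
      using monoD[OF tmono, of 0 j] monoD[OF tmono that] t0 tm by auto
    have "H b - H a = (\<Sum>j<m. H (t (Suc j)) - H (t j))"
      by (simp add: sum_lessThan_telescope[of "\<lambda>j. H (t j)"] t0 tm)
    then have "\<bar>H b - H a\<bar> \<le> (\<Sum>j<m. \<bar>H (t (Suc j)) - H (t j)\<bar>)" by (simp add: sum_abs)
    also have "\<dots> \<le> (\<Sum>j<m. e * (Q (t (Suc j)) - Q (t j)))"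
    proof (rule sum_mono)
      fix j assume "j \<in> {..<m}"
      then have ab: "a \<le> t j" "t (Suc j) \<le> b" "t j \<le> b" "a \<le> t (Suc j)" using tin[of j] tin[of "Suc j"] by auto
      have "\<bar>R (t (Suc j)) - R (t j)\<bar> \<le> e"
        using d(2)[of "t j" "t (Suc j)"] ab tS[of j] mesh tle[of j] by (auto simp: dist_real_def)
      moreover have "Q (t (Suc j)) - Q (t j) \<ge> 0" using Q[OF ab(1) tle ab(2)] by simp
      ultimately show "\<bar>H (t (Suc j)) - H (t j)\<bar> \<le> e * (Q (t (Suc j)) - Q (t j))"
        using H[OF ab(1) tle ab(2)] by (meson mult_right_mono order_trans)
    qed
    also have "\<dots> = e * (Q b - Q a)"
      by (simp add: sum_distrib_left[symmetric] sum_lessThan_telescope[of "\<lambda>j. Q (t j)"] t0 tm)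
    finally show ?thesis .
  qed
  have "\<bar>H b - H a\<bar> \<le> 0"
  proof (rule field_le_epsilon)
    fix e :: real assume "e > 0"
    have Qn: "Q b - Q a \<ge> 0" using Q[of a b] \<open>a \<le> b\<close> by simp
    \<comment> \<open>The added 1 covers a constant Q, for which Q b - Q a is no admissible
      divisor.\<close>
    have "\<bar>H b - H a\<bar> \<le> e / (Q b - Q a + 1) * (Q b - Q a)" using *[of "e / (Q b - Q a + 1)"] \<open>e > 0\<close> Qn by simp
    also have "\<dots> \<le> 0 + e" using Qn \<open>e > 0\<close> by (simp add: field_simps)
    finally show "\<bar>H b - H a\<bar> \<le> 0 + e" .
  qed
  then show ?thesis by simp
qed

lemma integral_Icc_diff:
  fixes f :: "real \<Rightarrow> real"
  assumes "f integrable_on {a..b}" "a \<le> s" "s \<le> t" "t \<le> b"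
  shows "integral {a..t} f - integral {a..s} f = integral {s..t} f"
  using Henstock_Kurzweil_Integration.integral_combine[of a s t f] assms integrable_on_subinterval[of f "{a..b}" a t]
  by (force simp: algebra_simps)

lemma integral_primitive_continuous:
  fixes f F :: "real \<Rightarrow> real"
  assumes "\<And>x. x \<in> {a..b} \<Longrightarrow> (f has_integral (F x - F a)) {a..x}"
  shows "continuous_on {a..b} F"
proof (cases "a \<le> b")
  case True
  have "f integrable_on {a..b}" using assms[of b] True by auto
  then have "continuous_on {a..b} (\<lambda>x. F a + integral {a..x} f)"
    by (intro continuous_intros indefinite_integral_continuous_1)
  moreover have "F a + integral {a..x} f = F x" if "x \<in> {a..b}" for x
    using assms[OF that] by (simp add: integral_unique)
  ultimately show ?thesis using continuous_on_eq by blast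
qed auto

text \<open>F and G are only primitives of summable functions, so F G need not be differentiable at
  a given point. Instead, F G minus the primitive of k has increments of second order with respect
  to R, the primitive of |f| + |g|, and is constant by
  \<open>eq_of_small_increments\<close>.\<close>

lemma integration_by_parts_absolutely_integrable:
  fixes f g F G :: "real \<Rightarrow> real"
  assumes ab: "a \<le> b" and f: "f absolutely_integrable_on {a..b}" and g: "g absolutely_integrable_on {a..b}"
    and F: "\<And>x. x \<in> {a..b} \<Longrightarrow> (f has_integral (F x - F a)) {a..x}"
    and G: "\<And>x. x \<in> {a..b} \<Longrightarrow> (g has_integral (G x - G a)) {a..x}"
  shows "((\<lambda>t. f t * G t + F t * g t) has_integral (F b * G b - F a * G a)) {a..b}"
proof -
  have cF: "continuous_on {a..b} F" and cG: "continuous_on {a..b} G"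
    using integral_primitive_continuous[of a b] F G by blast+
  define r where "r = (\<lambda>t. \<bar>f t\<bar> + \<bar>g t\<bar>)"
  have rA: "r absolutely_integrable_on {a..b}"
    unfolding r_def using f g by (intro set_integral_add set_integrable_abs)
  then have ri: "r integrable_on {a..b}" by (simp add: absolutely_integrable_on_def)
  define R where "R = (\<lambda>x. integral {a..x} r)"
  define k where "k = (\<lambda>t. f t * G t + F t * g t)"
  have kA: "k absolutely_integrable_on {a..b}"
    unfolding k_def using absolutely_integrable_mult_continuous[OF f cG] absolutely_integrable_mult_continuous[OF g cF]
    by (auto intro: set_integral_add simp: mult.commute)
  then have ki: "k integrable_on {a..b}" by (simp add: absolutely_integrable_on_def)
  have fi: "f integrable_on {a..b}" and gi: "g integrable_on {a..b}"
    using f g by (simp_all add: absolutely_integrable_on_def)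
  have Fd: "F t - F s = integral {s..t} f" if "a \<le> s" "s \<le> t" "t \<le> b" for s t
    using integral_Icc_diff[OF fi that] F[of s] F[of t] that by (auto dest!: integral_unique)
  have Gd: "G t - G s = integral {s..t} g" if "a \<le> s" "s \<le> t" "t \<le> b" for s t
    using integral_Icc_diff[OF gi that] G[of s] G[of t] that by (auto dest!: integral_unique)
  have Rd: "R t - R s = integral {s..t} r" if "a \<le> s" "s \<le> t" "t \<le> b" for s t
    using integral_Icc_diff[OF ri that] by (simp add: R_def)
  have sub: "h integrable_on {s..t}" if "h integrable_on {a..b}" "a \<le> s" "s \<le> t" "t \<le> b" for h :: "real \<Rightarrow> real" and s t
    using that integrable_on_subinterval[of h "{a..b}" s t] by auto
  have Rm: "R s \<le> R t" if "a \<le> s" "s \<le> t" "t \<le> b" for s t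
    using Rd[OF that] integral_nonneg[OF sub[OF ri that]] by (auto simp: r_def)
  have FR: "\<bar>F t - F s\<bar> \<le> R t - R s" if "a \<le> s" "s \<le> t" "t \<le> b" for s t
    unfolding Fd[OF that] Rd[OF that] using sub fi ri that by (intro abs_integral_le) (auto simp: r_def)
  have GR: "\<bar>G t - G s\<bar> \<le> R t - R s" if "a \<le> s" "s \<le> t" "t \<le> b" for s t
    unfolding Gd[OF that] Rd[OF that] using sub gi ri that by (intro abs_integral_le) (auto simp: r_def)
  define H where "H = (\<lambda>x. F x * G x - integral {a..x} k)"
  have "H b = H a"
  proof (rule eq_of_small_increments[of a b R R H])
    show "a \<le> b" by fact
    show "continuous_on {a..b} R" unfolding R_def by (rule indefinite_integral_continuous_1[OF ri])
    fix s t assume st: "a \<le> s" "s \<le> t" "t \<le> b"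
    show "R s \<le> R t" using Rm st .
    \<comment> \<open>Freezing G at the right end and F at the left end integrates exactly to F t *
      G t - F s * G s; only the oscillation of F and G over [s,t] remains as error.\<close>
    have i1: "((\<lambda>u. f u * G t + F s * g u) has_integral ((F t - F s) * G t + F s * (G t - G s))) {s..t}"
      using Fd[OF st] Gd[OF st] sub[OF fi st] sub[OF gi st]
      by (intro has_integral_add has_integral_mult_left has_integral_mult_right) (auto simp: has_integral_integral)
    have i2: "(k has_integral integral {s..t} k) {s..t}" using integrable_integral[OF sub[OF ki st]] .
    have "H t - H s = F t * G t - F s * G s - integral {s..t} k"
      unfolding H_def using integral_Icc_diff[OF ki st] by simp
    also have "\<dots> = ((F t - F s) * G t + F s * (G t - G s)) - integral {s..t} k" by (simp add: algebra_simps)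
    also have "\<dots> = integral {s..t} (\<lambda>u. f u * G t + F s * g u - k u)"
      using integral_unique[OF has_integral_diff[OF i1 i2]] by simp
    finally have "H t - H s = integral {s..t} (\<lambda>u. f u * G t + F s * g u - k u)" .
    also have "\<bar>\<dots>\<bar> \<le> integral {s..t} (\<lambda>u. (R t - R s) * r u)"
    proof (rule abs_integral_le)
      show "(\<lambda>u. f u * G t + F s * g u - k u) integrable_on {s..t}" using has_integral_diff[OF i1 i2] by blast
      show "(\<lambda>u. (R t - R s) * r u) integrable_on {s..t}" using sub[OF ri st] by (simp add: integrable_on_mult_right)
      fix u assume u: "u \<in> {s..t}"
      have "\<bar>G t - G u\<bar> \<le> R t - R s" using GR[of u t] Rm[of s u] st u by auto
      moreover have "\<bar>F s - F u\<bar> \<le> R t - R s" using FR[of s u] Rm[of u t] st u by auto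
      ultimately have "\<bar>f u\<bar> * \<bar>G t - G u\<bar> + \<bar>F s - F u\<bar> * \<bar>g u\<bar> \<le> \<bar>f u\<bar> * (R t - R s) + (R t - R s) * \<bar>g u\<bar>"
        by (intro add_mono mult_left_mono mult_right_mono) auto
      moreover have "f u * G t + F s * g u - k u = f u * (G t - G u) + (F s - F u) * g u" by (simp add: k_def algebra_simps)
      moreover have "\<bar>f u * (G t - G u) + (F s - F u) * g u\<bar> \<le> \<bar>f u\<bar> * \<bar>G t - G u\<bar> + \<bar>F s - F u\<bar> * \<bar>g u\<bar>"
        unfolding abs_mult[symmetric] by (rule abs_triangle_ineq)
      ultimately have "\<bar>f u * G t + F s * g u - k u\<bar> \<le> \<bar>f u\<bar> * (R t - R s) + (R t - R s) * \<bar>g u\<bar>" by simp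
      then show "\<bar>f u * G t + F s * g u - k u\<bar> \<le> (R t - R s) * r u" by (simp add: r_def algebra_simps)
    qed
    also have "\<dots> = \<bar>R t - R s\<bar> * (R t - R s)" using Rd[OF st] Rm[OF st] by simp
    finally show "\<bar>H t - H s\<bar> \<le> \<bar>R t - R s\<bar> * (R t - R s)" .
  qed
  then have "integral {a..b} k = F b * G b - F a * G a" by (simp add: H_def)
  then show ?thesis using ki unfolding k_def by (metis has_integral_integral)
qed

section \<open>The linear second-order equation with summable coefficients\<close>

text \<open>Caratheodory solutions of y'' = p y - h; the sign of h is chosen so that
  solving with p = q - mu inverts L - mu.\<close>
definition ode_sol :: "(real \<Rightarrow> real) \<Rightarrow> (real \<Rightarrow> real) \<Rightarrow> (real \<Rightarrow> real) \<Rightarrow> (real \<Rightarrow> real) \<Rightarrow> bool" where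
  "ode_sol p h y y' \<longleftrightarrow> (\<forall>x\<in>{0..pi}. (y has_real_derivative y' x) (at x within {0..pi})
        \<and> ((\<lambda>t. p t * y t - h t) has_integral (y' x - y' 0)) {0..x})"

lemma sl_solution_iff_ode_sol: "sl_solution q \<mu> y y' \<longleftrightarrow> ode_sol (\<lambda>t. q t - \<mu>) (\<lambda>_. 0) y y'"
  by (simp add: sl_solution_def ode_sol_def)

lemma ode_sol_deriv: "ode_sol p h y y' \<Longrightarrow> x \<in> {0..pi} \<Longrightarrow> (y has_real_derivative y' x) (at x within {0..pi})"
  by (simp add: ode_sol_def)

lemma ode_sol_has_integral:
  "ode_sol p h y y' \<Longrightarrow> x \<in> {0..pi} \<Longrightarrow> ((\<lambda>t. p t * y t - h t) has_integral (y' x - y' 0)) {0..x}"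
  by (simp add: ode_sol_def)

lemma ode_sol_continuous: "ode_sol p h y y' \<Longrightarrow> continuous_on {0..pi} y"
  by (meson DERIV_continuous_on ode_sol_def)

lemma ode_sol_continuous': "ode_sol p h y y' \<Longrightarrow> continuous_on {0..pi} y'"
  by (rule integral_primitive_continuous) (auto simp: ode_sol_def)

lemma ode_sol_integral:
  assumes "ode_sol p h y y'" "x \<in> {0..pi}"
  shows "(y' has_integral (y x - y 0)) {0..x}"
proof (rule fundamental_theorem_of_calculus)
  fix t assume "t \<in> {0..x}"
  then have "(y has_real_derivative y' t) (at t within {0..pi})" using assms by (auto simp: ode_sol_def)
  then have "(y has_real_derivative y' t) (at t within {0..x})" using assms by (auto intro: DERIV_subset)
  then show "(y has_vector_derivative y' t) (at t within {0..x})"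
    by (simp add: has_real_derivative_iff_has_vector_derivative)
qed (use assms in auto)

lemma ode_sol_lincomb:
  assumes "ode_sol p h y y'" "ode_sol p k z z'"
  shows "ode_sol p (\<lambda>t. c * h t + d * k t) (\<lambda>t. c * y t + d * z t) (\<lambda>t. c * y' t + d * z' t)"
  unfolding ode_sol_def
proof (intro ballI conjI)
  fix x assume x: "x \<in> {0..pi}"
  show "((\<lambda>t. c * y t + d * z t) has_real_derivative c * y' x + d * z' x) (at x within {0..pi})"
    using assms x unfolding ode_sol_def by (auto intro!: DERIV_add DERIV_cmult)
  have "((\<lambda>t. c * (p t * y t - h t) + d * (p t * z t - k t)) has_integral c * (y' x - y' 0) + d * (z' x - z' 0)) {0..x}"
    using assms x unfolding ode_sol_def by (intro has_integral_add has_integral_mult_right) auto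
  then show "((\<lambda>t. p t * (c * y t + d * z t) - (c * h t + d * k t)) has_integral
          c * y' x + d * z' x - (c * y' 0 + d * z' 0)) {0..x}"
    by (simp add: algebra_simps)
qed

lemma ode_sol_cong:
  assumes "ode_sol p h y y'" "\<And>t. t \<in> {0..pi} \<Longrightarrow> p t * y t - h t = r t * y t - k t"
  shows "ode_sol r k y y'"
  unfolding ode_sol_def
proof (intro ballI conjI)
  fix x assume x: "x \<in> {0..pi}"
  show "(y has_real_derivative y' x) (at x within {0..pi})" by (rule ode_sol_deriv[OF assms(1) x])
  show "((\<lambda>t. r t * y t - k t) has_integral (y' x - y' 0)) {0..x}"
    using x by (intro has_integral_eq[OF _ ode_sol_has_integral[OF assms(1) x]]) (simp add: assms(2))
qed

lemma ode_sol_cong_fun: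
  assumes "ode_sol p h y y'" "\<And>t. t \<in> {0..pi} \<Longrightarrow> z t = y t"
  shows "ode_sol p h z y'"
  unfolding ode_sol_def
proof (intro ballI conjI)
  fix x assume x: "x \<in> {0..pi}"
  show "(z has_real_derivative y' x) (at x within {0..pi})"
    using assms(2) x by (intro has_field_derivative_transform_within[OF ode_sol_deriv[OF assms(1) x], of 1]) simp_all
  show "((\<lambda>t. p t * z t - h t) has_integral (y' x - y' 0)) {0..x}"
    using x by (intro has_integral_eq[OF _ ode_sol_has_integral[OF assms(1) x]]) (simp add: assms(2))
qed

definition L1 :: "(real \<Rightarrow> real) \<Rightarrow> real" where "L1 p = integral {0..pi} (\<lambda>t. \<bar>p t\<bar>)"

lemma L1_nonneg: "p absolutely_integrable_on {0..pi} \<Longrightarrow> 0 \<le> L1 p"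
  unfolding L1_def by (rule integral_nonneg) (auto dest: set_integrable_abs simp: absolutely_integrable_on_def)

lemma abs_integral_mult_le_L1:
  assumes p: "p absolutely_integrable_on {0..pi}" and y: "continuous_on {0..pi} y"
    and x: "x \<in> {0..pi}" and B: "\<And>t. t \<in> {0..x} \<Longrightarrow> \<bar>y t\<bar> \<le> B"
  shows "\<bar>integral {0..x} (\<lambda>t. p t * y t)\<bar> \<le> L1 p * B"
proof -
  have B0: "B \<ge> 0" using B[of 0] x by auto
  have pa: "(\<lambda>t. \<bar>p t\<bar>) integrable_on {0..pi}"
    using set_integrable_abs[OF p] by (simp add: absolutely_integrable_on_def)
  have pa': "(\<lambda>t. \<bar>p t\<bar>) integrable_on {0..x}" using pa x integrable_on_subinterval[OF pa, of 0 x] by auto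
  have "(\<lambda>t. p t * y t) integrable_on {0..x}"
    using absolutely_integrable_on_subset_Icc[OF absolutely_integrable_mult_continuous[OF p y], of 0 x] x
    by (auto simp: absolutely_integrable_on_def)
  then have "\<bar>integral {0..x} (\<lambda>t. p t * y t)\<bar> \<le> integral {0..x} (\<lambda>t. \<bar>p t\<bar> * B)"
    using pa' B by (intro abs_integral_le) (auto simp: abs_mult intro: mult_left_mono integrable_on_mult_left)
  also have "\<dots> = integral {0..x} (\<lambda>t. \<bar>p t\<bar>) * B" by simp
  also have "\<dots> \<le> L1 p * B"
    unfolding L1_def using pa pa' x B0 by (intro mult_right_mono integral_subset_le) auto
  finally show ?thesis .
qed

lemma abs_integral_le_L1:
  assumes "p absolutely_integrable_on {0..pi}" "x \<in> {0..pi}"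
  shows "\<bar>integral {0..x} p\<bar> \<le> L1 p"
  using abs_integral_mult_le_L1[OF assms(1) _ assms(2), of "\<lambda>_. 1" 1] by simp

lemma ode_sol_bound':
  assumes p: "p absolutely_integrable_on {0..pi}" and h: "h absolutely_integrable_on {0..pi}"
    and y: "ode_sol p h y y'" and x: "x \<in> {0..pi}" and B: "\<And>t. t \<in> {0..x} \<Longrightarrow> \<bar>y t\<bar> \<le> B"
  shows "\<bar>y' x\<bar> \<le> \<bar>y' 0\<bar> + L1 h + L1 p * B"
proof -
  have cy: "continuous_on {0..pi} y" using y by (rule ode_sol_continuous)
  have i1: "(\<lambda>t. p t * y t) integrable_on {0..x}"
    using absolutely_integrable_on_subset_Icc[OF absolutely_integrable_mult_continuous[OF p cy], of 0 x] x
    by (auto simp: absolutely_integrable_on_def)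
  have i2: "h integrable_on {0..x}"
    using absolutely_integrable_on_subset_Icc[OF h, of 0 x] x by (auto simp: absolutely_integrable_on_def)
  have "y' x - y' 0 = integral {0..x} (\<lambda>t. p t * y t) - integral {0..x} h"
    using integral_unique[OF ode_sol_has_integral[OF y x]] by (simp add: integral_diff[OF i1 i2])
  then show ?thesis using abs_integral_mult_le_L1[OF p cy x B] abs_integral_le_L1[OF h x] by linarith
qed

text \<open>A substitute for Gronwall's inequality: at a maximum point of exp (- k t) * |y t| the
  integrated equation returns at most half of the maximum M, which is absorbed on the left.
  Linearity of the bound in the data and in L1 h is what yields uniqueness, Lipschitz dependence on
  \<mu> and the resolvent bounds.\<close>

lemma ode_sol_bound:
  assumes p: "p absolutely_integrable_on {0..pi}" and h: "h absolutely_integrable_on {0..pi}"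
    and y: "ode_sol p h y y'" and x: "x \<in> {0..pi}"
  shows "\<bar>y x\<bar> \<le> exp ((2 * L1 p + 1) * pi) * (2 * (\<bar>y 0\<bar> + pi * (\<bar>y' 0\<bar> + L1 h)))"
proof -
  \<comment> \<open>Twice L1 p gives the absorption factor 1/2; the 1 keeps k positive when L1 p =
    0.\<close>
  define k where "k = 2 * L1 p + 1"
  have k: "k > 0" "L1 p \<le> k / 2" "L1 p \<ge> 0" "L1 h \<ge> 0" using L1_nonneg[OF p] L1_nonneg[OF h] by (auto simp: k_def)
  have cy: "continuous_on {0..pi} y" using y by (rule ode_sol_continuous)
  define A where "A = \<bar>y' 0\<bar> + L1 h"
  have A0: "A \<ge> 0" using k by (simp add: A_def)
  have "continuous_on {0..pi} (\<lambda>x. exp (- k * x) * \<bar>y x\<bar>)" using cy by (intro continuous_intros)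
  then obtain xm where xm: "xm \<in> {0..pi}" "\<And>t. t \<in> {0..pi} \<Longrightarrow> exp (- k * t) * \<bar>y t\<bar> \<le> exp (- k * xm) * \<bar>y xm\<bar>"
    using continuous_attains_sup[of "{0..pi}"] by (metis (no_types, lifting) atLeastAtMost_iff compact_Icc empty_iff order_refl pi_ge_zero)
  define M where "M = exp (- k * xm) * \<bar>y xm\<bar>"
  have M: "\<bar>y t\<bar> \<le> M * exp (k * t)" if "t \<in> {0..pi}" for t
    using xm(2)[OF that] by (simp add: M_def exp_minus field_simps)
  have M0: "M \<ge> 0" by (simp add: M_def)
  have y': "\<bar>y' t\<bar> \<le> A + L1 p * M * exp (k * t)" if t: "t \<in> {0..pi}" for t
  proof -
    have "\<bar>y s\<bar> \<le> M * exp (k * t)" if "s \<in> {0..t}" for s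
      using M[of s] that t M0 k by (smt (verit, best) atLeastAtMost_iff exp_le_cancel_iff mult_left_mono)
    then show ?thesis using ode_sol_bound'[OF p h y t, of "M * exp (k * t)"] by (simp add: A_def algebra_simps)
  qed
  have expi: "((\<lambda>t. A + L1 p * M * exp (k * t)) has_integral (A * xm + L1 p * M * (exp (k * xm) / k)) - (A * 0 + L1 p * M * (exp (k * 0) / k))) {0..xm}"
    using xm(1) k by (intro fundamental_theorem_of_calculus)
      (auto intro!: derivative_eq_intros simp: has_real_derivative_iff_has_vector_derivative[symmetric])
  have "\<bar>y xm - y 0\<bar> \<le> integral {0..xm} (\<lambda>t. A + L1 p * M * exp (k * t))"
    unfolding integral_unique[OF ode_sol_integral[OF y xm(1)], symmetric]
    using y' xm expi ode_sol_integral[OF y xm(1)] by (intro abs_integral_le) auto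
  also have "\<dots> = A * xm + L1 p * M / k * (exp (k * xm) - 1)"
    unfolding integral_unique[OF expi] by (simp add: diff_divide_distrib right_diff_distrib)
  also have "\<dots> \<le> A * pi + M / 2 * exp (k * xm)"
  proof (rule add_mono)
    show "A * xm \<le> A * pi" using xm A0 by (auto intro: mult_left_mono)
    have "L1 p * M / k \<le> M / 2" using mult_right_mono[OF k(2) M0] k by (simp add: field_simps)
    then show "L1 p * M / k * (exp (k * xm) - 1) \<le> M / 2 * exp (k * xm)"
      using M0 k xm by (intro mult_mono) auto
  qed
  finally have "\<bar>y xm\<bar> \<le> \<bar>y 0\<bar> + A * pi + M / 2 * exp (k * xm)" by linarith
  then have "M \<le> exp (- k * xm) * (\<bar>y 0\<bar> + A * pi) + M / 2"
    by (simp add: M_def exp_minus field_simps)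
  also have "exp (- k * xm) * (\<bar>y 0\<bar> + A * pi) \<le> 1 * (\<bar>y 0\<bar> + A * pi)"
    using k xm A0 by (intro mult_right_mono) auto
  finally have M2: "M \<le> 2 * (\<bar>y 0\<bar> + A * pi)" by simp
  have "\<bar>y x\<bar> \<le> exp (k * x) * M" using M[OF x] by (simp add: mult.commute)
  also have "\<dots> \<le> exp (k * pi) * (2 * (\<bar>y 0\<bar> + A * pi))" using M2 x k A0 M0 by (intro mult_mono) auto
  finally show ?thesis by (simp add: A_def k_def mult.commute)
qed

lemma ode_sol_unique:
  assumes p: "p absolutely_integrable_on {0..pi}"
    and y: "ode_sol p h y y'" and z: "ode_sol p h z z'" and "y 0 = z 0" "y' 0 = z' 0" and x: "x \<in> {0..pi}"
  shows "y x = z x" "y' x = z' x"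
proof -
  have s: "ode_sol p (\<lambda>_. 0) (\<lambda>t. y t - z t) (\<lambda>t. y' t - z' t)"
    using ode_sol_lincomb[OF y z, of 1 "-1"] by simp
  have *: "\<bar>y t - z t\<bar> \<le> 0" if "t \<in> {0..pi}" for t
    using ode_sol_bound[OF p _ s that] assms by (simp add: L1_def)
  show "y x = z x" using *[OF x] by simp
  show "y' x = z' x" using ode_sol_bound'[OF p _ s x, of 0] * x assms by (auto simp: L1_def)
qed

text \<open>Picard iteration contracts in the norm weighted by exp (- k x) as soon as k exceeds twice the
  L1 norm of p, so no subdivision of the interval is needed.\<close>
lemma ode_sol_exists:
  assumes p: "p absolutely_integrable_on {0..pi}" and h: "h absolutely_integrable_on {0..pi}"
  obtains y y' where "ode_sol p h y y'" "y 0 = c" "y' 0 = d"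
proof -
  define k where "k = 2 * L1 p + 1"
  have k: "k > 0" "L1 p \<le> k / 2" "L1 p \<ge> 0" using L1_nonneg[OF p] by (auto simp: k_def)
  \<comment> \<open>Clamping to [0,pi] extends functions to the real line, so that the contraction
    acts on the complete space of bounded continuous functions.\<close>
  define cl where "cl x = max 0 (min pi x)" for x :: real
  have cl: "cl x \<in> {0..pi}" for x by (auto simp: cl_def)
  have cl_id: "cl x = x" if "x \<in> {0..pi}" for x using that by (auto simp: cl_def)
  have ccl: "continuous_on UNIV cl" unfolding cl_def by (intro continuous_intros)
  have hi: "h integrable_on {0..pi}" using h by (simp add: absolutely_integrable_on_def)
  \<comment> \<open>The unknown z stands for exp (- k x) * y x, which turns the weighted norm into
    the plain sup norm; F z is the corresponding y'.\<close>
  define F where "F z t = d - integral {0..t} h + integral {0..t} (\<lambda>u. p u * (exp (k * u) * z u))" for z t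
  have pzA: "(\<lambda>u. p u * (exp (k * u) * z u)) integrable_on {0..pi}" if "continuous_on {0..pi} z" for z
    using absolutely_integrable_mult_continuous[OF p, of "\<lambda>u. exp (k * u) * z u"] that
    by (simp add: absolutely_integrable_on_def continuous_intros)
  have cF: "continuous_on {0..pi} (F z)" if "continuous_on {0..pi} z" for z
    unfolding F_def using pzA[OF that] hi by (intro continuous_intros indefinite_integral_continuous_1)
  define T0 where "T0 z x = exp (- k * x) * (c + integral {0..x} (F z))" for z x
  have cT0: "continuous_on {0..pi} (T0 z)" if "continuous_on {0..pi} z" for z
    unfolding T0_def using cF[OF that]
    by (intro continuous_intros indefinite_integral_continuous_1 integrable_continuous_real)
  have T0b: "(\<lambda>x. T0 z (cl x)) \<in> bcontfun" if z: "continuous_on {0..pi} z" for z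
  proof -
    have "bounded (T0 z ` {0..pi})" using cT0[OF z] by (intro compact_imp_bounded compact_continuous_image) auto
    then obtain B where B: "\<And>x. x \<in> {0..pi} \<Longrightarrow> norm (T0 z x) \<le> B" unfolding bounded_iff by blast
    show ?thesis
    proof (rule bcontfun_normI)
      show "continuous_on UNIV (\<lambda>x. T0 z (cl x))"
        using cl by (intro continuous_on_compose2[OF cT0[OF z] ccl]) blast
      show "norm (T0 z (cl x)) \<le> B" for x using B cl by auto
    qed
  qed
  define T :: "(real \<Rightarrow>\<^sub>C real) \<Rightarrow> (real \<Rightarrow>\<^sub>C real)" where "T z = Bcontfun (\<lambda>x. T0 (apply_bcontfun z) (cl x))" for z
  have Tap: "apply_bcontfun (T z) x = T0 (apply_bcontfun z) (cl x)" for z x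
    unfolding T_def using T0b[of "apply_bcontfun z"] by (simp add: Bcontfun_inverse)
  have "dist (T z) (T w) \<le> 1 / 2 * dist z w" for z w
  proof (rule dist_bound)
    fix x
    define D where "D = dist z w"
    have D: "\<bar>apply_bcontfun z u - apply_bcontfun w u\<bar> \<le> D" for u using dist_bounded[of z u w] by (simp add: D_def dist_real_def)
    have D0: "D \<ge> 0" by (simp add: D_def)
    let ?x = "cl x"
    have x: "?x \<in> {0..pi}" by (rule cl)
    have Fb: "\<bar>F (apply_bcontfun z) t - F (apply_bcontfun w) t\<bar> \<le> L1 p * D * exp (k * t)" if t: "t \<in> {0..pi}" for t
    proof -
      have sb: "(\<lambda>u. p u * (exp (k * u) * v u)) integrable_on {0..t}" if "continuous_on {0..pi} v" for v
        using integrable_on_subinterval[OF pzA[OF that], of 0 t] t by auto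
      have "F (apply_bcontfun z) t - F (apply_bcontfun w) t
          = integral {0..t} (\<lambda>u. p u * (exp (k * u) * (apply_bcontfun z u - apply_bcontfun w u)))"
        unfolding F_def using integral_diff[OF sb[of "apply_bcontfun z"] sb[of "apply_bcontfun w"]]
        by (simp add: right_diff_distrib)
      also have "\<bar>\<dots>\<bar> \<le> L1 p * (exp (k * t) * D)"
      proof (rule abs_integral_mult_le_L1[OF p _ t])
        fix u assume u: "u \<in> {0..t}"
        show "\<bar>exp (k * u) * (apply_bcontfun z u - apply_bcontfun w u)\<bar> \<le> exp (k * t) * D"
          unfolding abs_mult using D[of u] u k by (intro mult_mono) auto
      qed (intro continuous_intros, auto)
      finally show ?thesis by (simp add: mult_ac)
    qed
    have expi: "((\<lambda>t. L1 p * D * exp (k * t)) has_integral (L1 p * D * (exp (k * ?x) / k)) - (L1 p * D * (exp (k * 0) / k))) {0..?x}"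
      using x k by (intro fundamental_theorem_of_calculus)
        (auto intro!: derivative_eq_intros simp: has_real_derivative_iff_has_vector_derivative[symmetric])
    have Fi: "F (apply_bcontfun v) integrable_on {0..?x}" for v
      using cF[of "apply_bcontfun v"] x by (intro integrable_continuous_real) (auto intro: continuous_on_subset)
    have "T0 (apply_bcontfun z) ?x - T0 (apply_bcontfun w) ?x
        = exp (- k * ?x) * integral {0..?x} (\<lambda>t. F (apply_bcontfun z) t - F (apply_bcontfun w) t)"
      unfolding T0_def by (simp add: Fi integral_diff algebra_simps)
    also have "\<bar>\<dots>\<bar> \<le> exp (- k * ?x) * (L1 p * D * (exp (k * ?x) / k))"
      unfolding abs_mult abs_exp_cancel
    proof (rule mult_left_mono)
      have "\<bar>integral {0..?x} (\<lambda>t. F (apply_bcontfun z) t - F (apply_bcontfun w) t)\<bar>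
          \<le> integral {0..?x} (\<lambda>t. L1 p * D * exp (k * t))"
        using Fb x expi Fi by (intro abs_integral_le) (auto intro: integrable_diff)
      also have "\<dots> \<le> L1 p * D * (exp (k * ?x) / k)" unfolding integral_unique[OF expi] using k D0 by simp
      finally show "\<bar>integral {0..?x} (\<lambda>t. F (apply_bcontfun z) t - F (apply_bcontfun w) t)\<bar> \<le> L1 p * D * (exp (k * ?x) / k)" .
    qed simp
    also have "\<dots> = L1 p / k * D" by (simp add: exp_minus field_simps)
    also have "\<dots> \<le> 1 / 2 * D" using k D0 by (intro mult_right_mono) (auto simp: field_simps)
    finally show "dist (apply_bcontfun (T z) x) (apply_bcontfun (T w) x) \<le> 1 / 2 * dist z w"
      by (simp add: Tap dist_real_def D_def)
  qed
  then obtain z where z: "T z = z" using banach_fix_type[of "1/2" T] by auto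
  define y where "y x = exp (k * x) * apply_bcontfun z x" for x
  have cz: "continuous_on S (apply_bcontfun z)" for S by simp
  define y' where "y' = F (apply_bcontfun z)"
  have yeq: "y x = c + integral {0..x} y'" if "x \<in> {0..pi}" for x
    using Tap[of z x] cl_id[OF that] unfolding z by (simp add: y_def y'_def T0_def exp_minus)
  have cy': "continuous_on {0..pi} y'" unfolding y'_def by (rule cF[OF cz])
  have "ode_sol p h y y'"
    unfolding ode_sol_def
  proof (intro ballI conjI)
    fix x assume x: "x \<in> {0..pi}"
    have "((\<lambda>x. c + integral {0..x} y') has_real_derivative 0 + y' x) (at x within {0..pi})"
      using integral_has_real_derivative[OF cy' x] by (intro DERIV_add) auto
    then show "(y has_real_derivative y' x) (at x within {0..pi})"
      using x by (intro has_field_derivative_transform_within[where d = 1 and g = y]) (auto simp: yeq)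
    have pyi: "(\<lambda>u. p u * y u) integrable_on {0..x}"
      using integrable_on_subinterval[OF pzA[OF cz], of 0 x] x by (auto simp: y_def)
    have "h integrable_on {0..x}" using integrable_on_subinterval[OF hi, of 0 x] x by auto
    then have "((\<lambda>t. p t * y t - h t) has_integral (integral {0..x} (\<lambda>t. p t * y t) - integral {0..x} h)) {0..x}"
      using pyi by (intro has_integral_diff integrable_integral)
    then show "((\<lambda>t. p t * y t - h t) has_integral (y' x - y' 0)) {0..x}"
      by (simp add: y'_def F_def y_def)
  qed
  moreover have "y 0 = c" using yeq[of 0] by simp
  moreover have "y' 0 = d" by (simp add: y'_def F_def)
  ultimately show ?thesis using that by blast
qed

text \<open>Two integrations by parts leave the same term y' z', which cancels in the difference.
  Distinct coefficients p and r allow comparing solutions for different \<mu>, or for q and for the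
  free equation.\<close>

lemma ode_sol_green:
  assumes p: "p absolutely_integrable_on {0..pi}" and r: "r absolutely_integrable_on {0..pi}"
    and h: "h absolutely_integrable_on {0..pi}" and k: "k absolutely_integrable_on {0..pi}"
    and y: "ode_sol p h y y'" and z: "ode_sol r k z z'" and x: "x \<in> {0..pi}"
  shows "((\<lambda>t. (p t * y t - h t) * z t - y t * (r t * z t - k t)) has_integral
           (y' x * z x - y x * z' x - (y' 0 * z 0 - y 0 * z' 0))) {0..x}"
proof -
  have aux: "((\<lambda>t. (p t * y t - h t) * z t + y' t * z' t) has_integral (y' x * z x - y' 0 * z 0)) {0..x}"
    if p: "p absolutely_integrable_on {0..pi}" and h: "h absolutely_integrable_on {0..pi}"
      and y: "ode_sol p h y y'" and z: "ode_sol r k z z'" for p h r k y y' z z'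
  proof (rule integration_by_parts_absolutely_integrable)
    show "0 \<le> x" using x by simp
    have "(\<lambda>t. p t * y t - h t) absolutely_integrable_on {0..pi}"
      using absolutely_integrable_mult_continuous[OF p ode_sol_continuous[OF y]] h by (intro set_integral_diff)
    then show "(\<lambda>t. p t * y t - h t) absolutely_integrable_on {0..x}"
      using absolutely_integrable_on_subset_Icc x by auto
    show "z' absolutely_integrable_on {0..x}"
      using continuous_on_subset[OF ode_sol_continuous'[OF z], of "{0..x}"] x
      by (auto intro: absolutely_integrable_continuous_real)
    show "((\<lambda>t. p t * y t - h t) has_integral (y' s - y' 0)) {0..s}" if "s \<in> {0..x}" for s
      using y that x by (auto simp: ode_sol_def)
    show "(z' has_integral (z s - z 0)) {0..s}" if "s \<in> {0..x}" for s
      using ode_sol_integral[OF z] that x by auto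
  qed
  show ?thesis
    using has_integral_diff[OF aux[OF p h y z] aux[OF r k z y]] by (simp add: algebra_simps)
qed

text \<open>A weak form of Jordan's inequality: cos is at least 1/2 up to pi/3, and from there on
  sin is at least 0.8 > pi/4.\<close>

lemma half_le_sin:
  assumes "0 \<le> x" "x \<le> pi / 2"
  shows "x / 2 \<le> sin x"
proof (cases "x \<le> pi / 3")
  case True
  show ?thesis
  proof (cases "x = 0")
    case False
    then have "x > 0" using assms by simp
    then obtain z where z: "0 < z" "z < x" "sin x - sin 0 = (x - 0) * cos z"
      using MVT2[of 0 x sin cos] by (auto intro: DERIV_sin)
    have "cos (pi / 3) \<le> cos z" using z True by (intro cos_monotone_0_pi_le) auto
    then have "x * (1 / 2) \<le> x * cos z" using \<open>x > 0\<close> by (intro mult_left_mono) (auto simp: cos_60)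
    then show ?thesis using z by simp
  qed simp
next
  case False
  have "sin (pi / 3) \<le> sin x" using False assms by (intro sin_monotone_2pi_le) auto
  moreover have "(16/10)\<^sup>2 \<le> (3::real)" by (simp add: power2_eq_square)
  then have "16 / 10 \<le> sqrt 3" by (rule real_le_rsqrt)
  moreover have "pi < 3.2" using pi_approx by simp
  ultimately show ?thesis using assms by (simp add: sin_60)
qed

lemma half_abs_le_abs_sin: "\<bar>x\<bar> \<le> pi / 2 \<Longrightarrow> \<bar>x\<bar> / 2 \<le> \<bar>sin x\<bar>"
  using half_le_sin[of x] half_le_sin[of "-x"] by (cases "x \<ge> 0") auto

lemma abs_integral_diff_le:
  fixes f g :: "real \<Rightarrow> real"
  assumes "f integrable_on {0..pi}" "g integrable_on {0..pi}" "\<And>t. t \<in> {0..pi} \<Longrightarrow> \<bar>f t - g t\<bar> \<le> e"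
  shows "\<bar>integral {0..pi} f - integral {0..pi} g\<bar> \<le> pi * e"
proof -
  have "\<bar>integral {0..pi} (\<lambda>t. f t - g t)\<bar> \<le> integral {0..pi} (\<lambda>_. e)"
    using assms by (intro abs_integral_le) (auto intro: integrable_diff)
  then show ?thesis using assms by (simp add: integral_diff)
qed

lemma cos_square_integral: "((\<lambda>t. (cos ((real m + 1/2) * t))\<^sup>2) has_integral pi / 2) {0..pi}"
proof -
  define r where "r = real m + 1/2"
  have r: "r > 0" by (simp add: r_def)
  let ?F = "\<lambda>t. t / 2 + sin (2 * (r * t)) / (4 * r)"
  have "((\<lambda>t. (cos (r * t))\<^sup>2) has_integral (?F pi - ?F 0)) {0..pi}"
  proof (rule fundamental_theorem_of_calculus)
    fix t assume "t \<in> {0..pi}"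
    have "(?F has_real_derivative (1/2 + cos (2 * (r * t)) * (2 * r) / (4 * r))) (at t within {0..pi})"
      using r by (auto intro!: derivative_eq_intros)
    also have "1/2 + cos (2 * (r * t)) * (2 * r) / (4 * r) = (cos (r * t))\<^sup>2"
      using r unfolding cos_double_cos[of "r * t"] by (simp add: field_simps)
    finally show "(?F has_vector_derivative (cos (r * t))\<^sup>2) (at t within {0..pi})"
      by (simp add: has_real_derivative_iff_has_vector_derivative)
  qed simp
  moreover have "sin (2 * (r * pi)) = sin (real (2 * m + 1) * pi)" by (simp add: r_def algebra_simps)
  then have "sin (2 * (r * pi)) = 0" by (metis sin_npi)
  ultimately show ?thesis by (simp add: r_def)
qed

section \<open>Eigenvalues\<close>

locale sturm_liouville =
  fixes q :: "real \<Rightarrow> real" and \<alpha> :: real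
  assumes q: "q absolutely_integrable_on {0..pi}" and alpha: "0 < \<alpha>" "\<alpha> < pi"
begin

section \<open>The normalized solution and the characteristic function\<close>

lemma sin_alpha: "sin \<alpha> > 0" using alpha sin_gt_zero by blast

lemma q_minus: "(\<lambda>t. q t - \<mu>) absolutely_integrable_on {0..pi}"
  using q by (intro set_integral_diff) (auto intro: absolutely_integrable_continuous_real)

lemma L1_q_minus: "\<bar>\<mu>\<bar> \<le> R \<Longrightarrow> L1 (\<lambda>t. q t - \<mu>) \<le> L1 q + R * pi"
proof -
  assume R: "\<bar>\<mu>\<bar> \<le> R"
  have qa: "(\<lambda>t. \<bar>q t\<bar>) integrable_on {0..pi}" "(\<lambda>t. \<bar>q t - \<mu>\<bar>) integrable_on {0..pi}"
    using set_integrable_abs[OF q] set_integrable_abs[OF q_minus] by (simp_all add: absolutely_integrable_on_def)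
  have "L1 (\<lambda>t. q t - \<mu>) \<le> integral {0..pi} (\<lambda>t. \<bar>q t\<bar> + R)"
    unfolding L1_def using qa R by (intro integral_le integrable_add) auto
  also have "\<dots> = L1 q + R * pi" unfolding L1_def using qa by (subst integral_add) auto
  finally show ?thesis .
qed

text \<open>A pair is chosen so that the derivative stays available; \<open>sl_phi\<close> fixes
  only values, and uniqueness identifies them with \<open>Phi\<close> on [0,pi].\<close>

definition Phi_pair :: "real \<Rightarrow> (real \<Rightarrow> real) \<times> (real \<Rightarrow> real)" where
  "Phi_pair \<mu> = (SOME z. ode_sol (\<lambda>t. q t - \<mu>) (\<lambda>_. 0) (fst z) (snd z) \<and> fst z 0 = sin \<alpha> \<and> snd z 0 = - cos \<alpha>)"

definition Phi where "Phi \<mu> = fst (Phi_pair \<mu>)"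
definition Phi' where "Phi' \<mu> = snd (Phi_pair \<mu>)"

lemma Phi_props: "ode_sol (\<lambda>t. q t - \<mu>) (\<lambda>_. 0) (Phi \<mu>) (Phi' \<mu>) \<and> Phi \<mu> 0 = sin \<alpha> \<and> Phi' \<mu> 0 = - cos \<alpha>"
proof -
  obtain y y' where "ode_sol (\<lambda>t. q t - \<mu>) (\<lambda>_. 0) y y'" "y 0 = sin \<alpha>" "y' 0 = - cos \<alpha>"
    using ode_sol_exists[OF q_minus[of \<mu>], of "\<lambda>_. 0"] by (metis absolutely_integrable_zero)
  then have "\<exists>z. ode_sol (\<lambda>t. q t - \<mu>) (\<lambda>_. 0) (fst z) (snd z) \<and> fst z 0 = sin \<alpha> \<and> snd z 0 = - cos \<alpha>"
    by (intro exI[of _ "(y, y')"]) auto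
  then show ?thesis unfolding Phi_def Phi'_def Phi_pair_def by (rule someI_ex)
qed

lemmas Phi_sol = Phi_props[THEN conjunct1]

lemma Phi_0 [simp]: "Phi \<mu> 0 = sin \<alpha>" and Phi'_0 [simp]: "Phi' \<mu> 0 = - cos \<alpha>"
  using Phi_props by auto

lemma Phi_continuous: "continuous_on {0..pi} (Phi \<mu>)" and Phi'_continuous: "continuous_on {0..pi} (Phi' \<mu>)"
  using Phi_sol ode_sol_continuous ode_sol_continuous' by blast+

lemma sl_phi_eq:
  assumes x: "x \<in> {0..pi}"
  shows "sl_phi q \<alpha> \<mu> x = Phi \<mu> x"
  unfolding sl_phi_def sl_solution_iff_ode_sol
proof (rule the_equality)
  show "\<exists>y y'. ode_sol (\<lambda>t. q t - \<mu>) (\<lambda>_. 0) y y' \<and> y 0 = sin \<alpha> \<and> y' 0 = - cos \<alpha> \<and> y x = Phi \<mu> x"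
    using Phi_props by blast
  fix v assume "\<exists>y y'. ode_sol (\<lambda>t. q t - \<mu>) (\<lambda>_. 0) y y' \<and> y 0 = sin \<alpha> \<and> y' 0 = - cos \<alpha> \<and> y x = v"
  then obtain y y' where y: "ode_sol (\<lambda>t. q t - \<mu>) (\<lambda>_. 0) y y'" "y 0 = sin \<alpha>" "y' 0 = - cos \<alpha>" "y x = v" by blast
  show "v = Phi \<mu> x" using ode_sol_unique(1)[OF q_minus y(1) Phi_sol _ _ x] y by simp
qed

text \<open>The boundary condition makes (y 0, y' 0) a multiple of (sin \<alpha>, - cos \<alpha>),
  and sin \<alpha> > 0 lets the factor be read off from y 0. This is the geometric simplicity of the
  eigenvalues.\<close>

lemma left_boundary_multiple:
  assumes y: "ode_sol (\<lambda>t. q t - \<mu>) (\<lambda>_. 0) y y'" and bc: "y 0 * cos \<alpha> + y' 0 * sin \<alpha> = 0" and x: "x \<in> {0..pi}"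
  shows "y x = y 0 / sin \<alpha> * Phi \<mu> x"
proof -
  have s: "ode_sol (\<lambda>t. q t - \<mu>) (\<lambda>_. 0) (\<lambda>t. y 0 / sin \<alpha> * Phi \<mu> t) (\<lambda>t. y 0 / sin \<alpha> * Phi' \<mu> t)"
    using ode_sol_lincomb[OF Phi_sol[of \<mu>] Phi_sol[of \<mu>], where c = "y 0 / sin \<alpha>" and d = 0] by simp
  show ?thesis
    using ode_sol_unique(1)[OF q_minus y s _ _ x] bc sin_alpha by (simp add: field_simps)
qed

definition ev where "ev = {\<mu>. Phi \<mu> pi = 0}"

lemma sl_is_eigenvalue_iff: "sl_is_eigenvalue q \<alpha> 0 \<mu> \<longleftrightarrow> \<mu> \<in> ev"
proof
  assume "sl_is_eigenvalue q \<alpha> 0 \<mu>"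
  then obtain y y' x where y: "ode_sol (\<lambda>t. q t - \<mu>) (\<lambda>_. 0) y y'" "x \<in> {0..pi}" "y x \<noteq> 0"
      "y 0 * cos \<alpha> + y' 0 * sin \<alpha> = 0" "y pi = 0"
    unfolding sl_is_eigenvalue_def sl_solution_iff_ode_sol by auto
  have "y 0 \<noteq> 0" using left_boundary_multiple[OF y(1,4,2)] y by auto
  then show "\<mu> \<in> ev" using left_boundary_multiple[OF y(1,4), of pi] y(5) sin_alpha by (simp add: ev_def)
next
  assume "\<mu> \<in> ev"
  then have "Phi \<mu> pi * cos 0 + Phi' \<mu> pi * sin 0 = 0" by (simp add: ev_def)
  moreover have "\<exists>x\<in>{0..pi}. Phi \<mu> x \<noteq> 0" using sin_alpha by (intro bexI[of _ 0]) auto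
  moreover have "Phi \<mu> 0 * cos \<alpha> + Phi' \<mu> 0 * sin \<alpha> = 0" by simp
  ultimately show "sl_is_eigenvalue q \<alpha> 0 \<mu>"
    unfolding sl_is_eigenvalue_def sl_solution_iff_ode_sol using Phi_sol by blast
qed

section \<open>Orthogonality of the eigenfunctions\<close>

definition ip :: "(real \<Rightarrow> real) \<Rightarrow> (real \<Rightarrow> real) \<Rightarrow> real" where "ip f g = integral {0..pi} (\<lambda>t. f t * g t)"

lemma ip_self_0:
  assumes "continuous_on {0..pi} f" "ip f f = 0" "x \<in> {0..pi}"
  shows "f x = 0"
proof -
  have "continuous_on {0..pi} (\<lambda>t. f t * f t)" using assms(1) by (intro continuous_intros)
  then have "\<forall>x\<in>{0..pi}. f x * f x = 0"
    using assms(2) integral_eq_0_iff[of 0 pi "\<lambda>t. f t * f t"] by (simp add: ip_def)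
  then show ?thesis using assms by auto
qed

text \<open>In Green's identity the boundary terms cancel at 0 by the common initial data and vanish
  at pi by the eigenvalue condition.\<close>

lemma Phi_orthogonal:
  assumes "\<mu> \<in> ev" "\<nu> \<in> ev" "\<mu> \<noteq> \<nu>"
  shows "ip (Phi \<mu>) (Phi \<nu>) = 0"
proof -
  have "((\<lambda>t. ((q t - \<mu>) * Phi \<mu> t - 0) * Phi \<nu> t - Phi \<mu> t * ((q t - \<nu>) * Phi \<nu> t - 0)) has_integral
           (Phi' \<mu> pi * Phi \<nu> pi - Phi \<mu> pi * Phi' \<nu> pi - (Phi' \<mu> 0 * Phi \<nu> 0 - Phi \<mu> 0 * Phi' \<nu> 0))) {0..pi}"
    by (rule ode_sol_green[OF q_minus q_minus _ _ Phi_sol Phi_sol]) auto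
  then have "((\<lambda>t. (\<nu> - \<mu>) * (Phi \<mu> t * Phi \<nu> t)) has_integral 0) {0..pi}"
    using assms by (simp add: ev_def algebra_simps)
  then have "(\<nu> - \<mu>) * ip (Phi \<mu>) (Phi \<nu>) = 0" unfolding ip_def
    by (metis integral_unique integral_mult_right)
  then show ?thesis using assms by simp
qed

lemma Phi_norm_nonzero: "ip (Phi \<mu>) (Phi \<mu>) \<noteq> 0"
  using ip_self_0[OF Phi_continuous, of \<mu> 0] sin_alpha by auto

lemma Phi_norm_pos: "ip (Phi \<mu>) (Phi \<mu>) > 0"
proof -
  have "ip (Phi \<mu>) (Phi \<mu>) \<ge> 0"
    unfolding ip_def using Phi_continuous by (intro integral_nonneg integrable_continuous_real continuous_intros) auto
  then show ?thesis using Phi_norm_nonzero[of \<mu>] by linarith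
qed

section \<open>Dependence on the spectral parameter\<close>

lemma Phi_bounded: "\<exists>K. \<forall>\<mu> x. \<bar>\<mu>\<bar> \<le> R \<longrightarrow> x \<in> {0..pi} \<longrightarrow> \<bar>Phi \<mu> x\<bar> \<le> K"
proof (intro exI allI impI)
  fix \<mu> x assume R: "\<bar>\<mu>\<bar> \<le> R" and x: "x \<in> {0..pi}"
  have "\<bar>Phi \<mu> x\<bar> \<le> exp ((2 * L1 (\<lambda>t. q t - \<mu>) + 1) * pi) * (2 * (\<bar>sin \<alpha>\<bar> + pi * (\<bar>cos \<alpha>\<bar>)))"
    using ode_sol_bound[OF q_minus _ Phi_sol x] by (simp add: L1_def)
  also have "\<dots> \<le> exp ((2 * (L1 q + R * pi) + 1) * pi) * (2 * (\<bar>sin \<alpha>\<bar> + pi * (\<bar>cos \<alpha>\<bar>)))"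
    using L1_q_minus[OF R] by (intro mult_right_mono) auto
  finally show "\<bar>Phi \<mu> x\<bar> \<le> exp ((2 * (L1 q + R * pi) + 1) * pi) * (2 * (\<bar>sin \<alpha>\<bar> + pi * (\<bar>cos \<alpha>\<bar>)))" .
qed

text \<open>The difference solves the equation for \<mu> with zero initial data and source (\<mu> -
  \<nu>) * Phi \<nu>, and the a priori bound is linear in the source.\<close>

lemma Phi_lipschitz:
  "\<exists>C. C > 0 \<and> (\<forall>\<mu> \<nu> x. \<bar>\<mu>\<bar> \<le> R \<longrightarrow> \<bar>\<nu>\<bar> \<le> R \<longrightarrow> x \<in> {0..pi} \<longrightarrow> \<bar>Phi \<mu> x - Phi \<nu> x\<bar> \<le> C * \<bar>\<mu> - \<nu>\<bar>)"
proof -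
  obtain K where K: "\<And>\<mu> x. \<bar>\<mu>\<bar> \<le> R \<Longrightarrow> x \<in> {0..pi} \<Longrightarrow> \<bar>Phi \<mu> x\<bar> \<le> K" using Phi_bounded by blast
  define C where "C = exp ((2 * (L1 q + R * pi) + 1) * pi) * (2 * (pi * (pi * K)))"
  have C: "\<bar>Phi \<mu> x - Phi \<nu> x\<bar> \<le> C * \<bar>\<mu> - \<nu>\<bar>" if R: "\<bar>\<mu>\<bar> \<le> R" "\<bar>\<nu>\<bar> \<le> R" and x: "x \<in> {0..pi}" for \<mu> \<nu> x
  proof -
    have s: "ode_sol (\<lambda>t. q t - \<mu>) (\<lambda>t. (\<nu> - \<mu>) * Phi \<nu> t) (Phi \<nu>) (Phi' \<nu>)"
      by (rule ode_sol_cong[OF Phi_sol]) (simp add: algebra_simps)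
    have s2: "ode_sol (\<lambda>t. q t - \<mu>) (\<lambda>t. (\<mu> - \<nu>) * Phi \<nu> t) (\<lambda>t. Phi \<mu> t - Phi \<nu> t) (\<lambda>t. Phi' \<mu> t - Phi' \<nu> t)"
      using ode_sol_lincomb[OF Phi_sol s, of 1 "-1"] by (simp add: algebra_simps)
    have ci: "continuous_on {0..pi} (\<lambda>t. (\<mu> - \<nu>) * Phi \<nu> t)" using Phi_continuous by (intro continuous_intros)
    have "L1 (\<lambda>t. (\<mu> - \<nu>) * Phi \<nu> t) \<le> integral {0..pi} (\<lambda>t. \<bar>\<mu> - \<nu>\<bar> * K)"
      unfolding L1_def using ci K[OF R(2)]
      by (intro integral_le) (auto simp: abs_mult intro!: mult_left_mono integrable_continuous_real continuous_intros Phi_continuous)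
    then have L: "L1 (\<lambda>t. (\<mu> - \<nu>) * Phi \<nu> t) \<le> pi * K * \<bar>\<mu> - \<nu>\<bar>" by (simp add: mult_ac)
    have "\<bar>Phi \<mu> x - Phi \<nu> x\<bar> \<le> exp ((2 * L1 (\<lambda>t. q t - \<mu>) + 1) * pi) * (2 * (pi * (L1 (\<lambda>t. (\<mu> - \<nu>) * Phi \<nu> t))))"
      using ode_sol_bound[OF q_minus _ s2 x] ci by (simp add: absolutely_integrable_continuous_real)
    also have "\<dots> \<le> exp ((2 * (L1 q + R * pi) + 1) * pi) * (2 * (pi * (pi * K * \<bar>\<mu> - \<nu>\<bar>)))"
      using L1_q_minus[OF R(1)] L L1_nonneg[of "\<lambda>t. (\<mu> - \<nu>) * Phi \<nu> t"] ci
      by (intro mult_mono) (auto simp: absolutely_integrable_continuous_real)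
    finally show ?thesis by (simp add: C_def mult_ac)
  qed
  show ?thesis
  proof (intro exI[of _ "max C 1"] conjI allI impI)
    fix \<mu> \<nu> x assume "\<bar>\<mu>\<bar> \<le> R" "\<bar>\<nu>\<bar> \<le> R" "x \<in> {0..pi}"
    then have "\<bar>Phi \<mu> x - Phi \<nu> x\<bar> \<le> C * \<bar>\<mu> - \<nu>\<bar>" by (rule C)
    also have "\<dots> \<le> max C 1 * \<bar>\<mu> - \<nu>\<bar>" by (intro mult_right_mono) auto
    finally show "\<bar>Phi \<mu> x - Phi \<nu> x\<bar> \<le> max C 1 * \<bar>\<mu> - \<nu>\<bar>" .
  qed simp
qed

lemma Phi_pi_continuous: "continuous_on S (\<lambda>\<mu>. Phi \<mu> pi)"
proof -
  have "isCont (\<lambda>\<mu>. Phi \<mu> pi) \<mu>" for \<mu>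
  proof -
    obtain C where C: "C > 0" "\<And>\<nu> \<mu>'. \<bar>\<nu>\<bar> \<le> \<bar>\<mu>\<bar> + 1 \<Longrightarrow> \<bar>\<mu>'\<bar> \<le> \<bar>\<mu>\<bar> + 1 \<Longrightarrow> \<bar>Phi \<nu> pi - Phi \<mu>' pi\<bar> \<le> C * \<bar>\<nu> - \<mu>'\<bar>"
      using Phi_lipschitz[of "\<bar>\<mu>\<bar> + 1"] by auto
    show ?thesis
      unfolding continuous_at_eps_delta
    proof (intro allI impI)
      fix e :: real assume e: "e > 0"
      show "\<exists>d>0. \<forall>x'. dist x' \<mu> < d \<longrightarrow> dist (Phi x' pi) (Phi \<mu> pi) < e"
      proof (intro exI[of _ "min 1 (e / C)"] conjI allI impI)
        show "min 1 (e / C) > 0" using e C by simp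
        fix \<nu> assume \<nu>: "dist \<nu> \<mu> < min 1 (e / C)"
        have "C * \<bar>\<nu> - \<mu>\<bar> < e" using \<nu> C by (simp add: dist_real_def field_simps)
        moreover have "\<bar>Phi \<nu> pi - Phi \<mu> pi\<bar> \<le> C * \<bar>\<nu> - \<mu>\<bar>" using \<nu> by (intro C) (auto simp: dist_real_def)
        ultimately show "dist (Phi \<nu> pi) (Phi \<mu> pi) < e" by (simp add: dist_real_def)
      qed
    qed
  qed
  then show ?thesis by (simp add: continuous_at_imp_continuous_on)
qed

text \<open>At an accumulation point of eigenvalues the orthogonality relations would pass to the limit
  and force the eigenfunction to be orthogonal to itself.\<close>
lemma finite_ev_bounded: "finite (ev \<inter> {- R..R})"
proof (rule ccontr)
  assume inf: "infinite (ev \<inter> {- R..R})"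
  moreover have "bounded (ev \<inter> {- R..R})" by (meson bounded_closed_interval bounded_subset inf_le2)
  ultimately obtain \<mu> where \<mu>: "\<mu> islimpt (ev \<inter> {- R..R})" using bounded_infinite_imp_islimpt by blast
  then have \<mu>R: "\<bar>\<mu>\<bar> \<le> R"
    using closed_limpt[of "{- R..R}"] islimpt_subset[OF \<mu>, of "{- R..R}"] by auto
  obtain C where C: "C > 0" "\<And>\<mu> \<nu> x. \<bar>\<mu>\<bar> \<le> R \<Longrightarrow> \<bar>\<nu>\<bar> \<le> R \<Longrightarrow> x \<in> {0..pi} \<Longrightarrow> \<bar>Phi \<mu> x - Phi \<nu> x\<bar> \<le> C * \<bar>\<mu> - \<nu>\<bar>"
    using Phi_lipschitz by blast
  obtain K0 where K0: "\<And>\<mu> x. \<bar>\<mu>\<bar> \<le> R \<Longrightarrow> x \<in> {0..pi} \<Longrightarrow> \<bar>Phi \<mu> x\<bar> \<le> K0" using Phi_bounded by blast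
  define K where "K = max K0 1"
  have K: "\<And>\<mu> x. \<bar>\<mu>\<bar> \<le> R \<Longrightarrow> x \<in> {0..pi} \<Longrightarrow> \<bar>Phi \<mu> x\<bar> \<le> K" "K > 0" using K0 by (force simp: K_def)+
  \<comment> \<open>With this radius the inner product changes by at most half of the squared norm
    at the limit point, which contradicts the orthogonality for \<nu> and \<kappa>.\<close>
  define d where "d = ip (Phi \<mu>) (Phi \<mu>) / (4 * pi * K * C)"
  have d: "d > 0" using Phi_norm_pos C K by (simp add: d_def)
  have "infinite ((ev \<inter> {- R..R}) \<inter> ball \<mu> d)" using \<mu> d by (simp add: islimpt_eq_infinite_ball)
  then obtain \<nu> where \<nu>: "\<nu> \<in> ev \<inter> {- R..R} \<inter> ball \<mu> d" by (metis all_not_in_conv finite.emptyI)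
  have "infinite ((ev \<inter> {- R..R}) \<inter> ball \<mu> d - {\<nu>})" using \<open>infinite ((ev \<inter> {- R..R}) \<inter> ball \<mu> d)\<close> by simp
  then obtain \<kappa> where \<kappa>: "\<kappa> \<in> ev \<inter> {- R..R} \<inter> ball \<mu> d" "\<kappa> \<noteq> \<nu>" by (metis Diff_iff all_not_in_conv finite.emptyI singletonI)
  have R: "\<bar>\<nu>\<bar> \<le> R" "\<bar>\<kappa>\<bar> \<le> R" using \<nu> \<kappa> by auto
  have "\<bar>ip (Phi \<mu>) (Phi \<mu>) - ip (Phi \<nu>) (Phi \<kappa>)\<bar> \<le> pi * (2 * K * C * d)"
    unfolding ip_def
  proof (rule abs_integral_diff_le)
    fix t assume t: "t \<in> {0..pi}"
    have 1: "\<bar>Phi \<mu> t - Phi \<kappa> t\<bar> \<le> C * d" using C(2)[OF \<mu>R R(2) t] \<kappa> C(1)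
      by (auto simp: dist_real_def intro: order_trans[OF _ mult_left_mono])
    have 2: "\<bar>Phi \<mu> t - Phi \<nu> t\<bar> \<le> C * d" using C(2)[OF \<mu>R R(1) t] \<nu> C(1)
      by (auto simp: dist_real_def intro: order_trans[OF _ mult_left_mono])
    have "\<bar>Phi \<mu> t * Phi \<mu> t - Phi \<nu> t * Phi \<kappa> t\<bar> = \<bar>Phi \<mu> t * (Phi \<mu> t - Phi \<kappa> t) + (Phi \<mu> t - Phi \<nu> t) * Phi \<kappa> t\<bar>"
      by (simp add: algebra_simps)
    also have "\<dots> \<le> \<bar>Phi \<mu> t\<bar> * \<bar>Phi \<mu> t - Phi \<kappa> t\<bar> + \<bar>Phi \<mu> t - Phi \<nu> t\<bar> * \<bar>Phi \<kappa> t\<bar>"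
      unfolding abs_mult[symmetric] by (rule abs_triangle_ineq)
    also have "\<dots> \<le> K * (C * d) + (C * d) * K"
      using 1 2 K(1)[OF \<mu>R t] K(1)[OF R(2) t] K(2) C d by (intro add_mono mult_mono) auto
    finally show "\<bar>Phi \<mu> t * Phi \<mu> t - Phi \<nu> t * Phi \<kappa> t\<bar> \<le> 2 * K * C * d" by (simp add: mult_ac)
  qed (auto intro!: integrable_continuous_real continuous_intros Phi_continuous)
  moreover have "ip (Phi \<nu>) (Phi \<kappa>) = 0" using Phi_orthogonal \<nu> \<kappa> by auto
  moreover have "pi * (2 * K * C * d) = ip (Phi \<mu>) (Phi \<mu>) / 2" using C K by (simp add: d_def)
  ultimately show False using Phi_norm_pos[of \<mu>] by auto
qed

text \<open>With z a shifted fundamental solution of z'' = - mu z this is the variation-of-constants formula.\<close>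
lemma Phi_green_free:
  assumes z: "\<And>t. (z has_real_derivative z' t) (at t)" "\<And>t. (z' has_real_derivative - \<mu> * z t) (at t)"
    and x: "x \<in> {0..pi}"
  shows "integral {0..x} (\<lambda>t. q t * (Phi \<mu> t * z t)) = Phi' \<mu> x * z x - Phi \<mu> x * z' x + cos \<alpha> * z 0 + sin \<alpha> * z' 0"
proof -
  have "ode_sol (\<lambda>_. - \<mu>) (\<lambda>_. 0) z z'"
    unfolding ode_sol_def
  proof (intro ballI conjI)
    fix x assume x: "x \<in> {0..pi}"
    show "(z has_real_derivative z' x) (at x within {0..pi})" using z by (blast intro: has_field_derivative_at_within)
    show "((\<lambda>t. - \<mu> * z t - 0) has_integral z' x - z' 0) {0..x}"
      using x z(2) by (intro fundamental_theorem_of_calculus)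
        (auto simp: has_real_derivative_iff_has_vector_derivative[symmetric] intro: has_field_derivative_at_within)
  qed
  from integral_unique[OF ode_sol_green[OF q_minus[of \<mu>] _ _ _ Phi_sol this x]] show ?thesis
    by (simp add: algebra_simps absolutely_integrable_continuous_real)
qed

text \<open>In \<open>Phi_green_free\<close>, sin (\<rho> (x - t)) / \<rho> isolates Phi at x and
  cos (\<rho> (x - t)) isolates Phi' at x. The error terms contain Phi itself, so its maximum is
  first bounded self-consistently: for \<rho> \<ge> 2 * L1 q it is at most 2 plus half of
  itself.\<close>

lemma Phi_trig_asymptotics:
  assumes \<rho>: "\<rho> \<ge> 1" "\<rho> \<ge> 2 * L1 q" and x: "x \<in> {0..pi}"
  shows "\<bar>Phi (\<rho>\<^sup>2) x\<bar> \<le> 4"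
    and "\<bar>Phi (\<rho>\<^sup>2) x - sin \<alpha> * cos (\<rho> * x)\<bar> \<le> (1 + 4 * L1 q) / \<rho>"
    and "\<bar>Phi' (\<rho>\<^sup>2) x + \<rho> * sin \<alpha> * sin (\<rho> * x)\<bar> \<le> 1 + 4 * L1 q"
    and "\<bar>integral {0..x} (Phi (\<rho>\<^sup>2)) - sin \<alpha> * sin (\<rho> * x) / \<rho>\<bar> \<le> 2 * (1 + 4 * L1 q) / \<rho>\<^sup>2"
proof -
  have L: "L1 q \<ge> 0" using L1_nonneg q by blast
  let ?P = "Phi (\<rho>\<^sup>2)"
  have r0: "\<rho> > 0" using \<rho> by simp
  have repr: "?P x = sin \<alpha> * cos (\<rho> * x) - cos \<alpha> * sin (\<rho> * x) / \<rho> + integral {0..x} (\<lambda>t. q t * (?P t * (sin (\<rho> * (x - t)) / \<rho>)))"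
    if x: "x \<in> {0..pi}" for x
  proof -
    have "((\<lambda>t. sin (\<rho> * (x - t)) / \<rho>) has_real_derivative - cos (\<rho> * (x - t))) (at t)" for t
      using r0 by (auto intro!: derivative_eq_intros)
    moreover have "((\<lambda>t. - cos (\<rho> * (x - t))) has_real_derivative - \<rho>\<^sup>2 * (sin (\<rho> * (x - t)) / \<rho>)) (at t)" for t
      using r0 by (auto intro!: derivative_eq_intros simp: power2_eq_square)
    ultimately show ?thesis using Phi_green_free[OF _ _ x, of "\<lambda>t. sin (\<rho> * (x - t)) / \<rho>"] by fastforce
  qed
  have Pc: "continuous_on {0..pi} (\<lambda>t. \<bar>?P t\<bar>)" by (intro continuous_intros Phi_continuous)
  obtain xm where xm: "xm \<in> {0..pi}" "\<And>t. t \<in> {0..pi} \<Longrightarrow> \<bar>?P t\<bar> \<le> \<bar>?P xm\<bar>"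
    using continuous_attains_sup[OF _ _ Pc] by auto
  have main: "\<bar>?P x - sin \<alpha> * cos (\<rho> * x)\<bar> \<le> (1 + L1 q * M) / \<rho>"
    if M: "\<And>t. t \<in> {0..pi} \<Longrightarrow> \<bar>?P t\<bar> \<le> M" and x: "x \<in> {0..pi}" for x M
  proof -
    have "\<bar>integral {0..x} (\<lambda>t. q t * (?P t * (sin (\<rho> * (x - t)) / \<rho>)))\<bar> \<le> L1 q * (M / \<rho>)"
    proof (rule abs_integral_mult_le_L1[OF q _ x])
      show "continuous_on {0..pi} (\<lambda>t. ?P t * (sin (\<rho> * (x - t)) / \<rho>))" using r0 by (intro continuous_intros Phi_continuous) auto
      fix t assume "t \<in> {0..x}"
      then have "\<bar>?P t\<bar> * \<bar>sin (\<rho> * (x - t))\<bar> \<le> M * 1" using M[of t] x by (intro mult_mono) auto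
      then show "\<bar>?P t * (sin (\<rho> * (x - t)) / \<rho>)\<bar> \<le> M / \<rho>" using r0 by (simp add: abs_mult divide_right_mono)
    qed
    moreover have "\<bar>cos \<alpha> * sin (\<rho> * x) / \<rho>\<bar> \<le> 1 / \<rho>"
      using r0 mult_mono[of "\<bar>cos \<alpha>\<bar>" 1 "\<bar>sin (\<rho> * x)\<bar>" 1] by (simp add: abs_mult divide_right_mono)
    moreover have "(1 + L1 q * M) / \<rho> = 1 / \<rho> + L1 q * (M / \<rho>)" by (simp add: add_divide_distrib)
    ultimately show ?thesis unfolding repr[OF x] by linarith
  qed
  have bd: "\<bar>?P t\<bar> \<le> 4" if "t \<in> {0..pi}" for t
  proof -
    have "\<bar>sin \<alpha> * cos (\<rho> * xm)\<bar> \<le> 1 * 1" unfolding abs_mult by (intro mult_mono) auto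
    then have "\<bar>?P xm\<bar> \<le> 1 + (1 + L1 q * \<bar>?P xm\<bar>) / \<rho>" using main[of "\<bar>?P xm\<bar>" xm] xm by force
    also have "\<dots> = 1 + 1 / \<rho> + L1 q / \<rho> * \<bar>?P xm\<bar>" by (simp add: add_divide_distrib)
    also have "\<dots> \<le> 1 + 1 + 1 / 2 * \<bar>?P xm\<bar>" using \<rho> by (intro add_mono mult_right_mono) (auto simp: field_simps)
    finally show ?thesis using xm(2)[OF that] by linarith
  qed
  show "\<bar>?P x\<bar> \<le> 4" by (rule bd[OF x])
  show "\<bar>Phi (\<rho>\<^sup>2) x - sin \<alpha> * cos (\<rho> * x)\<bar> \<le> (1 + 4 * L1 q) / \<rho>" using main[of 4, OF bd x] by (simp add: mult.commute)
  have "integral {0..x} (\<lambda>t. q t * (?P t * cos (\<rho> * (x - t)))) = Phi' (\<rho>\<^sup>2) x + cos \<alpha> * cos (\<rho> * x) + \<rho> * sin \<alpha> * sin (\<rho> * x)"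
  proof -
    have "((\<lambda>t. cos (\<rho> * (x - t))) has_real_derivative \<rho> * sin (\<rho> * (x - t))) (at t)" for t
      by (auto intro!: derivative_eq_intros)
    moreover have "((\<lambda>t. \<rho> * sin (\<rho> * (x - t))) has_real_derivative - \<rho>\<^sup>2 * cos (\<rho> * (x - t))) (at t)" for t
      by (auto intro!: derivative_eq_intros simp: power2_eq_square)
    ultimately show ?thesis using Phi_green_free[OF _ _ x, of "\<lambda>t. cos (\<rho> * (x - t))"] by fastforce
  qed
  moreover have "\<bar>integral {0..x} (\<lambda>t. q t * (?P t * cos (\<rho> * (x - t))))\<bar> \<le> L1 q * 4"
  proof (rule abs_integral_mult_le_L1[OF q _ x])
    show "continuous_on {0..pi} (\<lambda>t. ?P t * cos (\<rho> * (x - t)))" by (intro continuous_intros Phi_continuous)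
    fix t assume "t \<in> {0..x}"
    then show "\<bar>?P t * cos (\<rho> * (x - t))\<bar> \<le> 4"
      using mult_mono[OF bd[of t] abs_cos_le_one[of "\<rho> * (x - t)"]] x by (simp add: abs_mult)
  qed
  moreover have "\<bar>cos \<alpha> * cos (\<rho> * x)\<bar> \<le> 1 * 1" unfolding abs_mult by (intro mult_mono) auto
  ultimately show D: "\<bar>Phi' (\<rho>\<^sup>2) x + \<rho> * sin \<alpha> * sin (\<rho> * x)\<bar> \<le> 1 + 4 * L1 q" by linarith
  have qi: "(\<lambda>t. q t * ?P t) integrable_on {0..x}"
    using absolutely_integrable_on_subset_Icc[OF absolutely_integrable_mult_continuous[OF q Phi_continuous], of 0 x] x
    by (auto simp: absolutely_integrable_on_def)
  have Pi: "?P integrable_on {0..x}"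
    using x by (intro integrable_continuous_real continuous_on_subset[OF Phi_continuous]) auto
  \<comment> \<open>The integrated differential equation expresses \<rho>^2 times the integral of
    Phi through Phi', which gains a power of \<rho> over integrating the estimate for Phi.\<close>
  have "Phi' (\<rho>\<^sup>2) x + cos \<alpha> = integral {0..x} (\<lambda>t. q t * ?P t - \<rho>\<^sup>2 * ?P t)"
    using integral_unique[OF ode_sol_has_integral[OF Phi_sol[of "\<rho>\<^sup>2"] x]] by (simp add: left_diff_distrib)
  also have "\<dots> = integral {0..x} (\<lambda>t. q t * ?P t) - \<rho>\<^sup>2 * integral {0..x} ?P"
    using qi Pi by (simp add: integral_diff integrable_on_mult_right)
  finally have e: "\<rho>\<^sup>2 * integral {0..x} ?P - \<rho> * sin \<alpha> * sin (\<rho> * x)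
     = integral {0..x} (\<lambda>t. q t * ?P t) - cos \<alpha> - (Phi' (\<rho>\<^sup>2) x + \<rho> * sin \<alpha> * sin (\<rho> * x))" by simp
  have "\<bar>integral {0..x} (\<lambda>t. q t * ?P t)\<bar> \<le> L1 q * 4"
    using bd x by (intro abs_integral_mult_le_L1[OF q Phi_continuous x]) auto
  then have "\<bar>\<rho>\<^sup>2 * integral {0..x} ?P - \<rho> * sin \<alpha> * sin (\<rho> * x)\<bar> \<le> 2 * (1 + 4 * L1 q)"
    unfolding e using D abs_cos_le_one[of \<alpha>]
      abs_triangle_ineq4[of "integral {0..x} (\<lambda>t. q t * ?P t)" "cos \<alpha>"]
      abs_triangle_ineq4[of "integral {0..x} (\<lambda>t. q t * ?P t) - cos \<alpha>" "Phi' (\<rho>\<^sup>2) x + \<rho> * sin \<alpha> * sin (\<rho> * x)"]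
    by argo
  moreover have "integral {0..x} ?P - sin \<alpha> * sin (\<rho> * x) / \<rho> = (\<rho>\<^sup>2 * integral {0..x} ?P - \<rho> * sin \<alpha> * sin (\<rho> * x)) / \<rho>\<^sup>2"
    using r0 by (simp add: field_simps power2_eq_square)
  ultimately show "\<bar>integral {0..x} ?P - sin \<alpha> * sin (\<rho> * x) / \<rho>\<bar> \<le> 2 * (1 + 4 * L1 q) / \<rho>\<^sup>2"
    by (simp add: divide_right_mono abs_divide)
qed

text \<open>For \<mu> = - \<kappa>^2 the comparison functions are hyperbolic, and the absorption
  argument works with the weight exp (- \<kappa> t). The main term sin \<alpha> * cosh (\<kappa> *
  pi) outweighs the error, so Phi cannot vanish at pi.\<close>

lemma ev_bounded_below: "\<exists>R. \<forall>\<mu>\<in>ev. - R \<le> \<mu>"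
proof -
  have L: "L1 q \<ge> 0" using L1_nonneg q by blast
  \<comment> \<open>The last threshold brings the relative error (1 + 4 * L1 q) / \<kappa> below sin
    \<alpha> / 2; the factor 1/2 comes from cosh y \<ge> exp y / 2.\<close>
  have "Phi (- \<kappa>\<^sup>2) pi > 0" if k: "\<kappa> \<ge> 1" "\<kappa> \<ge> 2 * L1 q" "\<kappa> > 2 * (1 + 4 * L1 q) / sin \<alpha>" for \<kappa>
  proof -
    let ?P = "Phi (- \<kappa>\<^sup>2)"
    have k0: "\<kappa> > 0" using k by simp
    have repr: "?P x = sin \<alpha> * cosh (\<kappa> * x) - cos \<alpha> * sinh (\<kappa> * x) / \<kappa> + integral {0..x} (\<lambda>t. q t * (?P t * (sinh (\<kappa> * (x - t)) / \<kappa>)))"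
      if x: "x \<in> {0..pi}" for x
    proof -
      have "((\<lambda>t. sinh (\<kappa> * (x - t)) / \<kappa>) has_real_derivative - cosh (\<kappa> * (x - t))) (at t)" for t
        using k0 by (auto intro!: derivative_eq_intros)
      moreover have "((\<lambda>t. - cosh (\<kappa> * (x - t))) has_real_derivative - (- \<kappa>\<^sup>2) * (sinh (\<kappa> * (x - t)) / \<kappa>)) (at t)" for t
        using k0 by (auto intro!: derivative_eq_intros simp: power2_eq_square)
      ultimately show ?thesis using Phi_green_free[OF _ _ x, of "\<lambda>t. sinh (\<kappa> * (x - t)) / \<kappa>"] by fastforce
    qed
    have sh: "\<bar>sinh y\<bar> \<le> exp y" "cosh y \<le> exp y" if "y \<ge> 0" for y :: real
      using that by (auto simp: sinh_def cosh_def abs_le_iff intro: order_trans[of _ 0])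
    have Pc: "continuous_on {0..pi} (\<lambda>t. exp (- \<kappa> * t) * \<bar>?P t\<bar>)" by (intro continuous_intros Phi_continuous)
    obtain xm where xm: "xm \<in> {0..pi}" "\<And>t. t \<in> {0..pi} \<Longrightarrow> exp (- \<kappa> * t) * \<bar>?P t\<bar> \<le> exp (- \<kappa> * xm) * \<bar>?P xm\<bar>"
      using continuous_attains_sup[OF _ _ Pc] by auto
    define M where "M = exp (- \<kappa> * xm) * \<bar>?P xm\<bar>"
    have M: "\<bar>?P t\<bar> \<le> M * exp (\<kappa> * t)" if "t \<in> {0..pi}" for t
      using xm(2)[OF that] by (simp add: M_def exp_minus field_simps)
    have M0: "M \<ge> 0" by (simp add: M_def)
    have main: "\<bar>?P x - sin \<alpha> * cosh (\<kappa> * x)\<bar> \<le> exp (\<kappa> * x) * ((1 + L1 q * M) / \<kappa>)" if x: "x \<in> {0..pi}" for x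
    proof -
      have "\<bar>integral {0..x} (\<lambda>t. q t * (?P t * (sinh (\<kappa> * (x - t)) / \<kappa>)))\<bar> \<le> L1 q * (M * exp (\<kappa> * x) / \<kappa>)"
      proof (rule abs_integral_mult_le_L1[OF q _ x])
        show "continuous_on {0..pi} (\<lambda>t. ?P t * (sinh (\<kappa> * (x - t)) / \<kappa>))" using k0 by (intro continuous_intros Phi_continuous) auto
        fix t assume t: "t \<in> {0..x}"
        have "\<bar>?P t\<bar> * \<bar>sinh (\<kappa> * (x - t))\<bar> \<le> (M * exp (\<kappa> * t)) * exp (\<kappa> * (x - t))"
          using M[of t] x t k0 M0 by (intro mult_mono sh) auto
        also have "\<dots> = M * exp (\<kappa> * x)" by (simp add: mult_exp_exp algebra_simps)
        finally show "\<bar>?P t * (sinh (\<kappa> * (x - t)) / \<kappa>)\<bar> \<le> M * exp (\<kappa> * x) / \<kappa>" using k0 by (simp add: abs_mult divide_right_mono)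
      qed
      moreover have "\<bar>cos \<alpha> * sinh (\<kappa> * x) / \<kappa>\<bar> \<le> exp (\<kappa> * x) / \<kappa>"
        using k0 x mult_mono[of "\<bar>cos \<alpha>\<bar>" 1 "\<bar>sinh (\<kappa> * x)\<bar>" "exp (\<kappa> * x)"] sh[of "\<kappa> * x"]
        by (simp add: abs_mult divide_right_mono)
      moreover have "exp (\<kappa> * x) * ((1 + L1 q * M) / \<kappa>) = exp (\<kappa> * x) / \<kappa> + L1 q * (M * exp (\<kappa> * x) / \<kappa>)"
        by (simp add: add_divide_distrib algebra_simps)
      ultimately show ?thesis unfolding repr[OF x] by linarith
    qed
    have "\<bar>?P xm\<bar> \<le> exp (\<kappa> * xm) * (1 + (1 + L1 q * M) / \<kappa>)"
    proof -
      have "\<bar>sin \<alpha> * cosh (\<kappa> * xm)\<bar> \<le> 1 * exp (\<kappa> * xm)" unfolding abs_mult using sh[of "\<kappa> * xm"] xm k0 by (intro mult_mono) auto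
      then show ?thesis using main[OF xm(1)] by (simp add: distrib_left)
    qed
    then have "M \<le> 1 + (1 + L1 q * M) / \<kappa>" by (simp add: M_def exp_minus field_simps)
    also have "\<dots> = 1 + 1 / \<kappa> + L1 q / \<kappa> * M" by (simp add: add_divide_distrib)
    also have "\<dots> \<le> 1 + 1 + 1 / 2 * M" using k M0 by (intro add_mono mult_right_mono) (auto simp: field_simps)
    finally have M4: "M \<le> 4" by simp
    have "exp (\<kappa> * pi) * ((1 + L1 q * M) / \<kappa>) \<le> exp (\<kappa> * pi) * ((1 + 4 * L1 q) / \<kappa>)"
      using M4 L k0 mult_left_mono[OF M4 L] by (intro mult_left_mono divide_right_mono) auto
    also have "(1 + 4 * L1 q) / \<kappa> < sin \<alpha> / 2" using k sin_alpha by (simp add: field_simps)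
    then have "exp (\<kappa> * pi) * ((1 + 4 * L1 q) / \<kappa>) < exp (\<kappa> * pi) * (sin \<alpha> / 2)" by (rule mult_strict_left_mono) simp
    also have "\<dots> \<le> sin \<alpha> * cosh (\<kappa> * pi)" using sin_alpha by (simp add: cosh_def field_simps)
    finally show "?P pi > 0" using main[of pi] by auto
  qed
  note pos = this
  define k where "k = 1 + 2 * L1 q + 2 * (1 + 4 * L1 q) / sin \<alpha>"
  have "2 * (1 + 4 * L1 q) / sin \<alpha> \<ge> 0" using L sin_alpha by simp
  have "- k\<^sup>2 \<le> \<mu>" if "\<mu> \<in> ev" for \<mu>
  proof (rule ccontr)
    assume "\<not> - k\<^sup>2 \<le> \<mu>"
    then have *: "k\<^sup>2 < - \<mu>" by simp
    define s where "s = sqrt (- \<mu>)"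
    have "- \<mu> \<ge> 0" using * zero_le_power2[of k] by linarith
    then have s: "k < s" "- s\<^sup>2 = \<mu>"
      using real_less_rsqrt[OF *] by (auto simp: s_def)
    have "Phi (- s\<^sup>2) pi > 0"
      using L \<open>2 * (1 + 4 * L1 q) / sin \<alpha> \<ge> 0\<close> s(1) unfolding k_def by (intro pos) linarith+
    then show False using that s by (simp add: ev_def)
  qed
  then show ?thesis by blast
qed

lemma finite_ev_below: "finite {\<mu> \<in> ev. \<mu> < x}"
proof -
  obtain R where "\<forall>\<mu>\<in>ev. - R \<le> \<mu>" using ev_bounded_below by blast
  then have "{\<mu> \<in> ev. \<mu> < x} \<subseteq> ev \<inter> {- (max R \<bar>x\<bar>)..max R \<bar>x\<bar>}" by force
  then show ?thesis using finite_ev_bounded finite_subset by blast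
qed

end

section \<open>Eigenvalues near the half-integers\<close>

lemma abs_sin_diff_le: "\<bar>sin a - sin b\<bar> \<le> \<bar>a - b\<bar>" for a b :: real
proof -
  have "\<bar>sin a - sin b\<bar> = 2 * (\<bar>sin ((a - b) / 2)\<bar> * \<bar>cos ((a + b) / 2)\<bar>)"
    unfolding sin_diff_sin by (simp add: abs_mult)
  also have "\<dots> \<le> 2 * (\<bar>(a - b) / 2\<bar> * 1)"
    by (intro mult_left_mono mult_mono abs_sin_x_le_abs_x) auto
  finally show ?thesis by simp
qed

lemma abs_cos_diff_le: "\<bar>cos a - cos b\<bar> \<le> \<bar>a - b\<bar>" for a b :: real
  using abs_sin_diff_le[of "pi / 2 - a" "pi / 2 - b"] by (simp add: sin_diff abs_minus_commute)

lemma abs_mult_diff_le: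
  fixes a a0 b b0 :: real
  assumes "\<bar>a - a0\<bar> \<le> e" "\<bar>b - b0\<bar> \<le> d" "\<bar>a\<bar> \<le> A" "\<bar>b0\<bar> \<le> B"
  shows "\<bar>a * b - a0 * b0\<bar> \<le> A * d + e * B"
proof -
  have "\<bar>a * b - a0 * b0\<bar> = \<bar>a * (b - b0) + (a - a0) * b0\<bar>" by (simp add: algebra_simps)
  also have "\<dots> \<le> \<bar>a\<bar> * \<bar>b - b0\<bar> + \<bar>a - a0\<bar> * \<bar>b0\<bar>"
    unfolding abs_mult[symmetric] by (rule abs_triangle_ineq)
  also have "\<dots> \<le> A * d + e * B" using assms by (intro add_mono mult_mono) auto
  finally show ?thesis .
qed

context sturm_liouville
begin

text \<open>C1 is the error numerator of the solution asymptotics, C2 bounds the displacement of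
  \<rho> from m + 1/2, and C3 adds to C1 the cost of this displacement inside the cosine over
  [0,pi].\<close>

definition C1 where "C1 = 1 + 4 * L1 q"
definition C2 where "C2 = C1 / sin \<alpha>"
definition C3 where "C3 = C1 + pi * C2"

lemma C_pos: "C1 \<ge> 1" "C2 > 0" "C3 > 0"
proof -
  show 1: "C1 \<ge> 1" using L1_nonneg[OF q] by (simp add: C1_def)
  then show 2: "C2 > 0" using sin_alpha by (simp add: C2_def)
  have "pi * C2 > 0" using 2 by simp
  then show "C3 > 0" using 1 unfolding C3_def by linarith
qed

text \<open>The lower bounds on m bring \<rho> into the range of
  \<open>Phi_trig_asymptotics\<close>. The intervals [m, m+1] are centred at the zeros of cos
  (\<rho> pi); neighbours share an endpoint.\<close>

definition near_ev where
  "near_ev m \<rho> \<longleftrightarrow> m \<ge> (1::nat) \<and> m \<ge> 2 * L1 q \<and> real m \<le> \<rho> \<and> \<rho> \<le> real m + 1 \<and> \<rho>\<^sup>2 \<in> ev"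

text \<open>At an eigenvalue the asymptotics at pi force cos (\<rho> pi) to be of order 1/m. Its
  modulus is |sin (d pi)| with |d| \<le> 1/2, hence at least |d| pi / 2.\<close>

lemma near_ev_close:
  assumes "near_ev m \<rho>"
  shows "\<bar>\<rho> - (real m + 1/2)\<bar> \<le> C2 / m"
proof -
  have m: "real m \<ge> 1" "\<rho> \<ge> 2 * L1 q" "real m \<le> \<rho>" "\<rho> \<le> real m + 1" "\<rho>\<^sup>2 \<in> ev" using assms by (auto simp: near_ev_def)
  define d where "d = \<rho> - (real m + 1/2)"
  have d: "\<bar>d\<bar> \<le> 1/2" using m(3,4) unfolding d_def by linarith
  have "\<rho> * pi = real m * pi + (pi / 2 + d * pi)" by (simp add: d_def algebra_simps)
  moreover have "cos (real m * pi + (pi / 2 + d * pi)) = - ((-1) ^ m * sin (d * pi))"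
    unfolding cos_add[of "real m * pi"] cos_add[of "pi / 2"] by simp
  ultimately have cs: "\<bar>cos (\<rho> * pi)\<bar> = \<bar>sin (d * pi)\<bar>" by (simp add: abs_mult power_abs)
  have "\<bar>d\<bar> * pi / 2 \<le> \<bar>sin (d * pi)\<bar>"
    using half_abs_le_abs_sin[of "d * pi"] mult_right_mono[OF d pi_ge_zero] by (simp add: abs_mult)
  then have "sin \<alpha> * (\<bar>d\<bar> * pi / 2) \<le> sin \<alpha> * \<bar>cos (\<rho> * pi)\<bar>"
    unfolding cs using sin_alpha by (intro mult_left_mono) auto
  also have "\<dots> = \<bar>Phi (\<rho>\<^sup>2) pi - sin \<alpha> * cos (\<rho> * pi)\<bar>" using m(5) sin_alpha by (simp add: ev_def abs_mult)
  also have "\<dots> \<le> C1 / \<rho>" using Phi_trig_asymptotics(2)[of \<rho> pi] m by (simp add: C1_def)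
  also have "\<dots> \<le> C1 / m" using m C_pos by (intro divide_left_mono) auto
  finally have "sin \<alpha> * (\<bar>d\<bar> * pi / 2) \<le> C1 / m" .
  then have "\<bar>d\<bar> * (pi / 2) \<le> C2 / m" using sin_alpha m by (simp add: C2_def field_simps)
  moreover have "\<bar>d\<bar> * 1 \<le> \<bar>d\<bar> * (pi / 2)" using pi_ge_two by (intro mult_left_mono) auto
  ultimately have "\<bar>d\<bar> \<le> C2 / m" by argo
  then show ?thesis by (simp add: d_def)
qed

lemma near_ev_Phi:
  assumes "near_ev m \<rho>" and x: "x \<in> {0..pi}"
  shows "\<bar>Phi (\<rho>\<^sup>2) x - sin \<alpha> * cos ((real m + 1/2) * x)\<bar> \<le> C3 / m" "\<bar>Phi (\<rho>\<^sup>2) x\<bar> \<le> 4"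
proof -
  have m: "real m \<ge> 1" "\<rho> \<ge> 2 * L1 q" "real m \<le> \<rho>" "\<rho> \<le> real m + 1" "\<rho>\<^sup>2 \<in> ev" using assms by (auto simp: near_ev_def)
  have 1: "\<bar>Phi (\<rho>\<^sup>2) x - sin \<alpha> * cos (\<rho> * x)\<bar> \<le> C1 / \<rho>"
    using Phi_trig_asymptotics(2)[of \<rho> x] m x by (simp add: C1_def)
  also have "C1 / \<rho> \<le> C1 / m" using m C_pos by (intro divide_left_mono) auto
  finally have 1: "\<bar>Phi (\<rho>\<^sup>2) x - sin \<alpha> * cos (\<rho> * x)\<bar> \<le> C1 / m" .
  have "\<bar>cos (\<rho> * x) - cos ((real m + 1/2) * x)\<bar> \<le> \<bar>\<rho> * x - (real m + 1/2) * x\<bar>" by (rule abs_cos_diff_le)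
  also have "\<dots> = \<bar>\<rho> - (real m + 1/2)\<bar> * x" using x by (simp add: left_diff_distrib[symmetric] abs_mult)
  also have "\<dots> \<le> C2 / m * pi" using near_ev_close[OF assms(1)] x by (intro mult_mono) auto
  finally have "\<bar>sin \<alpha>\<bar> * \<bar>cos (\<rho> * x) - cos ((real m + 1/2) * x)\<bar> \<le> 1 * (C2 / m * pi)"
    by (intro mult_mono) auto
  then have "\<bar>sin \<alpha> * cos (\<rho> * x) - sin \<alpha> * cos ((real m + 1/2) * x)\<bar> \<le> C2 / m * pi"
    by (simp add: abs_mult[symmetric] right_diff_distrib)
  moreover have "C3 / m = C1 / m + C2 / m * pi" by (simp add: C3_def add_divide_distrib)
  ultimately show "\<bar>Phi (\<rho>\<^sup>2) x - sin \<alpha> * cos ((real m + 1/2) * x)\<bar> \<le> C3 / m" using 1 by linarith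
  show "\<bar>Phi (\<rho>\<^sup>2) x\<bar> \<le> 4" using Phi_trig_asymptotics(1)[of \<rho> x] m x by simp
qed

lemma near_ev_ip:
  assumes "near_ev m \<rho>" "near_ev m \<sigma>"
  shows "\<bar>ip (Phi (\<rho>\<^sup>2)) (Phi (\<sigma>\<^sup>2)) - (sin \<alpha>)\<^sup>2 * (pi / 2)\<bar> \<le> pi * (5 * C3 / m)"
proof -
  let ?c = "\<lambda>t. sin \<alpha> * cos ((real m + 1/2) * t)"
  have i: "((\<lambda>t. ?c t * ?c t) has_integral (sin \<alpha>)\<^sup>2 * (pi / 2)) {0..pi}"
    using has_integral_mult_right[OF cos_square_integral[of m], of "(sin \<alpha>)\<^sup>2"]
    by (simp add: power2_eq_square mult_ac)
  have "\<bar>ip (Phi (\<rho>\<^sup>2)) (Phi (\<sigma>\<^sup>2)) - integral {0..pi} (\<lambda>t. ?c t * ?c t)\<bar> \<le> pi * (5 * C3 / m)"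
    unfolding ip_def
  proof (rule abs_integral_diff_le)
    fix t assume t: "t \<in> {0..pi}"
    have "\<bar>?c t\<bar> \<le> 1 * 1" unfolding abs_mult by (intro mult_mono) auto
    then show "\<bar>Phi (\<rho>\<^sup>2) t * Phi (\<sigma>\<^sup>2) t - ?c t * ?c t\<bar> \<le> 5 * C3 / m"
      using abs_mult_diff_le[OF near_ev_Phi(1)[OF assms(1) t] near_ev_Phi(1)[OF assms(2) t] near_ev_Phi(2)[OF assms(1) t], of 1]
      by simp
  qed (use i in \<open>auto intro!: integrable_continuous_real continuous_intros Phi_continuous\<close>)
  then show ?thesis using integral_unique[OF i] by simp
qed

text \<open>Both eigenfunctions are close to the same cosine, whose squared norm stays away from 0,
  whereas for distinct eigenvalues their inner product vanishes. The threshold is this contradiction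
  solved for m. No counting of zeros of eigenfunctions is involved.\<close>

lemma near_ev_unique:
  assumes "near_ev m \<rho>" "near_ev m \<sigma>" and m: "real m > 10 * C3 / (sin \<alpha>)\<^sup>2"
  shows "\<rho> = \<sigma>"
proof (rule ccontr)
  assume "\<rho> \<noteq> \<sigma>"
  moreover have "\<rho> \<ge> 0" "\<sigma> \<ge> 0" using assms by (auto simp: near_ev_def)
  ultimately have "\<rho>\<^sup>2 \<noteq> \<sigma>\<^sup>2" by simp
  then have "ip (Phi (\<rho>\<^sup>2)) (Phi (\<sigma>\<^sup>2)) = 0" using assms by (intro Phi_orthogonal) (auto simp: near_ev_def)
  then have "(sin \<alpha>)\<^sup>2 * (pi / 2) \<le> pi * (5 * C3 / m)" using near_ev_ip[OF assms(1,2)] by simp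
  moreover have "m \<ge> 1" using assms by (simp add: near_ev_def)
  ultimately have "(sin \<alpha>)\<^sup>2 * real m \<le> 10 * C3" by (simp add: field_simps)
  then show False using m sin_alpha by (simp add: field_simps)
qed

text \<open>The factor (-1)^m makes the leading term sin \<alpha> at m and - sin \<alpha> at m + 1,
  and m > C2 keeps the error below sin \<alpha>.\<close>

lemma near_ev_exists:
  assumes "m \<ge> 1" "m \<ge> 2 * L1 q" "real m > C2"
  shows "\<exists>\<rho>. near_ev m \<rho>"
proof -
  define g where "g \<rho> = (-1)^m * Phi (\<rho>\<^sup>2) pi" for \<rho> :: real
  have cg: "continuous_on S g" for S
    unfolding g_def by (intro continuous_intros continuous_on_compose2[OF Phi_pi_continuous[of UNIV]]) auto
  have asy: "\<bar>g \<rho> - sin \<alpha> * ((-1)^m * cos (\<rho> * pi))\<bar> < sin \<alpha>" if "\<rho> \<ge> m" for \<rho> :: real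
  proof -
    have "\<bar>g \<rho> - sin \<alpha> * ((-1)^m * cos (\<rho> * pi))\<bar> = \<bar>(-1)^m * (Phi (\<rho>\<^sup>2) pi - sin \<alpha> * cos (\<rho> * pi))\<bar>"
      by (simp add: g_def algebra_simps)
    also have "\<dots> = \<bar>Phi (\<rho>\<^sup>2) pi - sin \<alpha> * cos (\<rho> * pi)\<bar>" by (simp add: abs_mult power_abs)
    also have "\<dots> \<le> C1 / \<rho>" using Phi_trig_asymptotics(2)[of \<rho> pi] assms that by (simp add: C1_def)
    also have "\<dots> \<le> C1 / m" using assms that C_pos by (intro divide_left_mono) auto
    also have "\<dots> < sin \<alpha>" using assms sin_alpha by (simp add: C2_def pos_divide_less_eq mult.commute)
    finally show ?thesis .
  qed
  have "(-1::real)^m * cos (real m * pi) = 1" by (simp add: power_mult_distrib[symmetric])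
  then have 1: "g m > 0" using asy[of m] by auto
  have "(-1::real)^m * cos (real (Suc m) * pi) = -1"
    unfolding cos_npi by (simp add: power_mult_distrib[symmetric])
  then have c: "(-1::real)^m * cos ((real m + 1) * pi) = -1" unfolding of_nat_Suc by (simp only: add.commute)
  have "\<bar>g (real m + 1) - sin \<alpha> * (-1)\<bar> < sin \<alpha>" using asy[of "real m + 1"] unfolding c by simp
  then have 2: "g (real m + 1) < 0" by argo
  obtain \<rho> where "real m \<le> \<rho>" "\<rho> \<le> real m + 1" "g \<rho> = 0"
    using IVT2'[OF less_imp_le[OF 2] less_imp_le[OF 1] _ cg] by auto
  then show ?thesis using assms by (intro exI[of _ \<rho>]) (auto simp: near_ev_def g_def ev_def)
qed

section \<open>Enumeration of the eigenvalues\<close>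

definition rank where "rank \<mu> = card {\<nu> \<in> ev. \<nu> < \<mu>}"

lemma rank_less:
  assumes "\<mu> \<in> ev" "\<mu> < \<nu>"
  shows "rank \<mu> < rank \<nu>"
  unfolding rank_def using assms by (intro psubset_card_mono finite_ev_below) auto

lemma rank_less_iff: "\<mu> \<in> ev \<Longrightarrow> \<nu> \<in> ev \<Longrightarrow> rank \<mu> < rank \<nu> \<longleftrightarrow> \<mu> < \<nu>"
  using rank_less by (metis less_asym' linorder_less_linear)

lemma rank_inj: "inj_on rank ev"
  by (rule inj_onI) (metis rank_less linorder_less_linear less_irrefl)

lemma sl_eigenvalue_rank:
  assumes "\<mu> \<in> ev"
  shows "sl_eigenvalue q \<alpha> 0 (rank \<mu>) = \<mu>"
  unfolding sl_eigenvalue_def sl_is_eigenvalue_iff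
proof (rule the_equality)
  show "\<mu> \<in> ev \<and> card {m'. m' \<in> ev \<and> m' < \<mu>} = rank \<mu>" using assms by (simp add: rank_def)
  fix \<nu> assume "\<nu> \<in> ev \<and> card {m'. m' \<in> ev \<and> m' < \<nu>} = rank \<mu>"
  then have "\<nu> \<in> ev" "rank \<nu> = rank \<mu>" by (auto simp: rank_def)
  then show "\<nu> = \<mu>" using assms rank_inj by (auto dest: inj_onD)
qed

lemma infinite_ev: "infinite ev"
proof
  assume "finite ev"
  then obtain R where R: "\<And>\<mu>. \<mu> \<in> ev \<Longrightarrow> \<mu> \<le> R" using bdd_above_finite unfolding bdd_above_def by metis
  obtain m :: nat where m: "m \<ge> max (max 1 (2 * L1 q)) (max (C2 + 1) (R + 1))" using real_arch_simple by blast
  then obtain \<rho> where \<rho>: "near_ev m \<rho>" using near_ev_exists[of m] by auto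
  then have "\<rho> \<ge> 1" "\<rho> > R" "\<rho>\<^sup>2 \<in> ev" using m by (auto simp: near_ev_def)
  moreover have "\<rho> * 1 \<le> \<rho>\<^sup>2" using \<open>\<rho> \<ge> 1\<close> unfolding power2_eq_square by (intro mult_left_mono) auto
  ultimately show False using R[of "\<rho>\<^sup>2"] by simp
qed

text \<open>By induction the eigenvalues of rank below n form a set S of n elements, and the least
  eigenvalue outside S has exactly S below it.\<close>

lemma rank_surj: "\<exists>\<mu>\<in>ev. rank \<mu> = n"
proof (induction n rule: less_induct)
  case (less n)
  define S where "S = {\<mu> \<in> ev. rank \<mu> < n}"
  have "rank ` S = {..<n}" using less by (auto simp: S_def)
  moreover have inj: "inj_on rank S" using rank_inj by (rule inj_on_subset) (auto simp: S_def)
  ultimately have S: "finite S" "card S = n" using finite_image_iff[OF inj] card_image[OF inj] by auto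
  then have "infinite (ev - S)" using infinite_ev by simp
  then obtain \<nu> where \<nu>: "\<nu> \<in> ev - S" by (metis all_not_in_conv finite.emptyI)
  \<comment> \<open>Cutting off at \<nu> + 1 makes the set finite while retaining \<nu>, so a
    minimum exists.\<close>
  define T where "T = {\<mu> \<in> ev - S. \<mu> < \<nu> + 1}"
  have "T \<subseteq> {\<mu> \<in> ev. \<mu> < \<nu> + 1}" by (auto simp: T_def)
  then have T: "finite T" "\<nu> \<in> T" using \<nu> finite_subset[OF _ finite_ev_below] by (auto simp: T_def)
  define \<mu> where "\<mu> = Min T"
  have "\<mu> \<in> T" unfolding \<mu>_def using T by (intro Min_in) auto
  then have \<mu>: "\<mu> \<in> ev" "\<not> rank \<mu> < n" "\<mu> < \<nu> + 1" by (auto simp: T_def S_def)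
  have min: "\<mu> \<le> \<kappa>" if "\<kappa> \<in> T" for \<kappa> unfolding \<mu>_def using T that by (intro Min_le) auto
  have "{\<kappa> \<in> ev. \<kappa> < \<mu>} = S"
  proof (intro equalityI subsetI)
    fix \<kappa> assume "\<kappa> \<in> {\<kappa> \<in> ev. \<kappa> < \<mu>}"
    then show "\<kappa> \<in> S" using min[of \<kappa>] \<mu> by (auto simp: T_def)
  next
    fix \<kappa> assume "\<kappa> \<in> S"
    then have "\<kappa> \<in> ev" "rank \<kappa> < rank \<mu>" using \<mu> by (auto simp: S_def)
    then show "\<kappa> \<in> {\<kappa> \<in> ev. \<kappa> < \<mu>}" using rank_less_iff \<mu> by auto
  qed
  then show ?case using S \<mu> by (intro bexI[of _ \<mu>]) (auto simp: rank_def)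
qed

lemma sl_eigenvalue_in_ev: "sl_eigenvalue q \<alpha> 0 n \<in> ev"
  using rank_surj[of n] sl_eigenvalue_rank by metis

lemma sl_eigenvalue_inj: "inj (sl_eigenvalue q \<alpha> 0)"
  by (rule injI) (metis rank_surj sl_eigenvalue_rank)

lemma sl_eigenvalue_range: "\<mu> \<in> ev \<Longrightarrow> \<exists>n. \<mu> = sl_eigenvalue q \<alpha> 0 n"
  using sl_eigenvalue_rank by metis

text \<open>Some fixed shift between the index of an eigenvalue and the nearest half-integer is enough:
  convergence is insensitive to it, so it is not identified.\<close>
lemma eigenvalue_asymptotics:
  obtains n0 m0 :: nat and \<rho> where "real m0 > R"
    "\<And>j. near_ev (m0 + j) (\<rho> j)" "\<And>j. sl_eigenvalue q \<alpha> 0 (n0 + j) = (\<rho> j)\<^sup>2"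
proof -
  \<comment> \<open>A sum of all thresholds, from which each can be read off. The term 2 * C2 forces
    C2 / m < 1/2 and keeps the roots off the common endpoints of neighbouring intervals.\<close>
  define B where "B = 1 + 2 * L1 q + 2 * C2 + 10 * C3 / (sin \<alpha>)\<^sup>2 + \<bar>R\<bar>"
  have "10 * C3 / (sin \<alpha>)\<^sup>2 \<ge> 0" using C_pos by simp
  note Bpos = this C_pos(2) L1_nonneg[OF q]
  obtain m0 :: nat where m0: "real m0 > B" using reals_Archimedean2 by blast
  have m: "real m \<ge> 1" "m \<ge> 2 * L1 q" "real m > C2" "real m > 10 * C3 / (sin \<alpha>)\<^sup>2" "real m > 2 * C2" if "m \<ge> m0" for m
  proof -
    have "real m > B" using m0 that by linarith
    then show "real m \<ge> 1" "m \<ge> 2 * L1 q" "real m > C2" "real m > 10 * C3 / (sin \<alpha>)\<^sup>2" "real m > 2 * C2"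
      using Bpos abs_ge_zero[of R] unfolding B_def by linarith+
  qed
  have "\<exists>\<rho>. near_ev m \<rho>" if "m \<ge> m0" for m using m[OF that] by (intro near_ev_exists) auto
  then obtain r where r: "\<And>m. m \<ge> m0 \<Longrightarrow> near_ev m (r m)" by metis
  have uniq: "\<mu> = (r m)\<^sup>2" if "\<mu> \<in> ev" "m \<ge> m0" "(real m)\<^sup>2 \<le> \<mu>" "\<mu> \<le> (real m + 1)\<^sup>2" for \<mu> m
  proof -
    have mu0: "\<mu> \<ge> 0" using that by (meson order_trans zero_le_power2)
    have "near_ev m (sqrt \<mu>)"
      unfolding near_ev_def using m[OF that(2)] that mu0
      by (auto intro: real_le_rsqrt real_le_lsqrt)
    then have "sqrt \<mu> = r m" using near_ev_unique r m that by blast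
    then show ?thesis using real_sqrt_pow2[OF mu0] by simp
  qed
  have step: "rank ((r (Suc m))\<^sup>2) = Suc (rank ((r m)\<^sup>2))" if m0: "m \<ge> m0" for m
  proof -
    note n1 = r[OF m0] and n2 = r[of "Suc m", OF le_SucI[OF m0]]
    have rm: "real m \<le> r m" "r m \<le> real m + 1" "real m + 1 \<le> r (Suc m)" "r (Suc m) \<le> real m + 2"
      "(r m)\<^sup>2 \<in> ev" "(r (Suc m))\<^sup>2 \<in> ev" using n1 n2 by (auto simp: near_ev_def)
    have "C2 / m < 1/2" using m[OF m0] by (simp add: field_simps)
    then have "r m < real m + 1" using near_ev_close[OF n1] by linarith
    then have lt: "(r m)\<^sup>2 < (r (Suc m))\<^sup>2" using rm by (intro power_strict_mono) auto
    have "{\<nu> \<in> ev. \<nu> < (r (Suc m))\<^sup>2} = insert ((r m)\<^sup>2) {\<nu> \<in> ev. \<nu> < (r m)\<^sup>2}"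
    proof (intro equalityI subsetI)
      fix \<nu> assume \<nu>: "\<nu> \<in> {\<nu> \<in> ev. \<nu> < (r (Suc m))\<^sup>2}"
      \<comment> \<open>The first band lies below the root in [m, m+1]. In the other two, uniqueness
        leaves only the squares of r m and r (Suc m), and the latter is excluded by
        strictness.\<close>
      consider "\<nu> < (real m)\<^sup>2" | "(real m)\<^sup>2 \<le> \<nu>" "\<nu> \<le> (real m + 1)\<^sup>2" | "(real m + 1)\<^sup>2 < \<nu>" by linarith
      then show "\<nu> \<in> insert ((r m)\<^sup>2) {\<nu> \<in> ev. \<nu> < (r m)\<^sup>2}"
      proof cases
        case 1
        moreover have "(real m)\<^sup>2 \<le> (r m)\<^sup>2" using rm by (intro power_mono) auto
        ultimately show ?thesis using \<nu> by simp
      next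
        case 2
        then show ?thesis using uniq[of \<nu> m] \<nu> m0 by simp
      next
        case 3
        have "(r (Suc m))\<^sup>2 \<le> (real (Suc m) + 1)\<^sup>2" using rm by (intro power_mono) auto
        then have "\<nu> = (r (Suc m))\<^sup>2" using 3 \<nu> m0 by (intro uniq) (auto simp: add.commute)
        then show ?thesis using \<nu> by simp
      qed
    qed (use lt rm in auto)
    then show ?thesis unfolding rank_def using finite_ev_below by simp
  qed
  have rk: "rank ((r (m0 + j))\<^sup>2) = rank ((r m0)\<^sup>2) + j" for j
    by (induction j) (auto simp: step)
  show thesis
  proof (rule that[of m0 "\<lambda>j. r (m0 + j)" "rank ((r m0)\<^sup>2)"])
    show "real m0 > R" using m0 Bpos abs_ge_self[of R] unfolding B_def by linarith
    show "near_ev (m0 + j) (r (m0 + j))" for j using r by simp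
    show "sl_eigenvalue q \<alpha> 0 (rank ((r m0)\<^sup>2) + j) = (r (m0 + j))\<^sup>2" for j
      unfolding rk[symmetric] using r[of "m0 + j"] by (intro sl_eigenvalue_rank) (simp add: near_ev_def)
  qed
qed

text \<open>The comparison of the kernel integrals with those of the model problem q = 0, alpha = pi/2.\<close>
lemma eigenfunction_term_asymptotics:
  obtains C R where "C \<ge> 0"
    "\<And>m \<rho> x s. near_ev m \<rho> \<Longrightarrow> real m > R \<Longrightarrow> x \<in> {0..pi} \<Longrightarrow> s \<in> {0..pi} \<Longrightarrow>
      \<bar>Phi (\<rho>\<^sup>2) x * integral {0..s} (Phi (\<rho>\<^sup>2)) / ip (Phi (\<rho>\<^sup>2)) (Phi (\<rho>\<^sup>2))
        - 2 / pi * (cos ((real m + 1/2) * x) * sin ((real m + 1/2) * s) / (real m + 1/2))\<bar> \<le> C / (real m)\<^sup>2"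
proof -
  define a0 where "a0 = (sin \<alpha>)\<^sup>2 * (pi / 2)"
  have a0: "a0 > 0" using sin_alpha by (simp add: a0_def)
  \<comment> \<open>The summands are the costs of the integrated asymptotics, of replacing 1 /
    \<rho> by 1 / r, and of moving \<rho> to r inside the sine.\<close>
  define C4 where "C4 = 2 * C1 + C2 + pi * C2"
  define C5 where "C5 = 4 * C4 + C3"
  \<comment> \<open>The first summand pays for changing the product in the numerator, the second for
    changing the squared norm; the threshold R below keeps that norm at least a0 / 2.\<close>
  define C where "C = 2 * C5 / a0 + 10 * pi * C3 / a0\<^sup>2"
  define R where "R = 10 * pi * C3 / a0"
  have Cp: "C4 \<ge> 0" "C5 \<ge> 0" "C \<ge> 0"
  proof -
    show "C4 \<ge> 0" unfolding C4_def using C_pos by (intro add_nonneg_nonneg mult_nonneg_nonneg) auto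
    then show "C5 \<ge> 0" unfolding C5_def using C_pos by auto
    then show "C \<ge> 0" unfolding C_def using C_pos a0 by (intro add_nonneg_nonneg) auto
  qed
  show thesis
  proof (rule that[OF Cp(3), of R])
    fix m \<rho> x s assume nv: "near_ev m \<rho>" and mR: "real m > R" and x: "x \<in> {0..pi}" and s: "s \<in> {0..pi}"
    have m: "real m \<ge> 1" "\<rho> \<ge> 2 * L1 q" "real m \<le> \<rho>" "\<rho> \<le> real m + 1" using nv by (auto simp: near_ev_def)
    define r where "r = real m + 1/2"
    have r: "r \<ge> m" "r > 0" "\<bar>\<rho> - r\<bar> \<le> C2 / m" using near_ev_close[OF nv] by (auto simp: r_def)
    have rho0: "\<rho> > 0" using m by simp
    define A where "A = Phi (\<rho>\<^sup>2) x"
    define A0 where "A0 = sin \<alpha> * cos (r * x)"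
    define B where "B = integral {0..s} (Phi (\<rho>\<^sup>2))"
    define B0 where "B0 = sin \<alpha> * sin (r * s) / r"
    define a where "a = ip (Phi (\<rho>\<^sup>2)) (Phi (\<rho>\<^sup>2))"
    have A: "\<bar>A - A0\<bar> \<le> C3 / m" "\<bar>A\<bar> \<le> 4" using near_ev_Phi[OF nv x] by (auto simp: A_def A0_def r_def)
    have A01: "\<bar>A0\<bar> \<le> 1 * 1" unfolding A0_def abs_mult by (intro mult_mono) auto
    have aa: "\<bar>a - a0\<bar> \<le> pi * (5 * C3 / m)" using near_ev_ip[OF nv nv] by (simp add: a_def a0_def)
    have "pi * (5 * C3 / m) \<le> a0 / 2" using mR a0 m by (simp add: R_def field_simps)
    then have a: "a \<ge> a0 / 2" "a > 0" using aa a0 by auto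
    have "\<bar>sin \<alpha>\<bar> * \<bar>sin (r * s)\<bar> \<le> 1 * 1" by (intro mult_mono) auto
    then have "\<bar>B0\<bar> \<le> 1 / r" using r by (simp add: B0_def abs_mult divide_right_mono)
    also have "\<dots> \<le> 1 / m" using r m by (intro divide_left_mono) auto
    finally have B01: "\<bar>B0\<bar> \<le> 1 / m" .
    have B: "\<bar>B - B0\<bar> \<le> C4 / (real m)\<^sup>2"
    proof -
      have mm: "(real m)\<^sup>2 > 0" using m by simp
      have "\<bar>B - sin \<alpha> * sin (\<rho> * s) / \<rho>\<bar> \<le> 2 * C1 / \<rho>\<^sup>2"
        using Phi_trig_asymptotics(4)[of \<rho> s] m s by (simp add: B_def C1_def)
      also have "\<dots> \<le> 2 * C1 / (real m)\<^sup>2" using m C_pos mm by (intro divide_left_mono mult_pos_pos power_mono) auto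
      finally have 1: "\<bar>B - sin \<alpha> * sin (\<rho> * s) / \<rho>\<bar> \<le> 2 * C1 / (real m)\<^sup>2" .
      have "\<bar>sin (\<rho> * s) * (1 / \<rho> - 1 / r)\<bar> \<le> 1 * (C2 / m / (m * m))"
      proof -
        have "1 / \<rho> - 1 / r = (r - \<rho>) / (\<rho> * r)" using r rho0 by (simp add: field_simps)
        then have "\<bar>1 / \<rho> - 1 / r\<bar> = \<bar>\<rho> - r\<bar> / (\<rho> * r)" using r rho0 by (simp add: abs_divide abs_mult)
        also have "\<dots> \<le> (C2 / m) / (m * m)" using r m mult_mono[of "real m" \<rho> "real m" r] by (intro frac_le) auto
        finally show ?thesis unfolding abs_mult by (intro mult_mono) auto
      qed
      also have "\<dots> \<le> C2 / (real m)\<^sup>2" 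
      proof -
        have "C2 / m \<le> C2 / 1" using m C_pos by (intro divide_left_mono) auto
        from divide_right_mono[OF this, of "real m * real m"] show ?thesis by (simp add: power2_eq_square)
      qed
      finally have 2: "\<bar>sin (\<rho> * s) * (1 / \<rho> - 1 / r)\<bar> \<le> C2 / (real m)\<^sup>2" .
      have 3: "\<bar>(sin (\<rho> * s) - sin (r * s)) / r\<bar> \<le> pi * C2 / (real m)\<^sup>2"
      proof -
        have "\<bar>sin (\<rho> * s) - sin (r * s)\<bar> \<le> \<bar>\<rho> * s - r * s\<bar>" by (rule abs_sin_diff_le)
        also have "\<dots> = \<bar>\<rho> - r\<bar> * s" using s by (simp add: left_diff_distrib[symmetric] abs_mult)
        also have "\<dots> \<le> C2 / m * pi" using r s by (intro mult_mono) auto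
        finally have "\<bar>(sin (\<rho> * s) - sin (r * s)) / r\<bar> \<le> (C2 / m * pi) / m"
          unfolding abs_divide using r m by (intro frac_le) auto
        then show ?thesis by (simp add: power2_eq_square mult_ac)
      qed
      have eq: "sin \<alpha> * sin (\<rho> * s) / \<rho> - B0 = sin \<alpha> * (sin (\<rho> * s) * (1 / \<rho> - 1 / r) + (sin (\<rho> * s) - sin (r * s)) / r)"
        using r rho0 by (simp add: B0_def field_simps)
      have "\<bar>sin \<alpha> * sin (\<rho> * s) / \<rho> - B0\<bar> \<le> 1 * (C2 / (real m)\<^sup>2 + pi * C2 / (real m)\<^sup>2)"
        unfolding eq abs_mult[of "sin \<alpha>"]
        by (rule mult_mono[OF abs_sin_le_one order_trans[OF abs_triangle_ineq add_mono[OF 2 3]]]) simp_all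
      moreover have "\<bar>B - B0\<bar> \<le> \<bar>B - sin \<alpha> * sin (\<rho> * s) / \<rho>\<bar> + \<bar>sin \<alpha> * sin (\<rho> * s) / \<rho> - B0\<bar>"
        using abs_triangle_ineq[of "B - sin \<alpha> * sin (\<rho> * s) / \<rho>"] by simp
      moreover have "C4 / (real m)\<^sup>2 = 2 * C1 / (real m)\<^sup>2 + 1 * (C2 / (real m)\<^sup>2 + pi * C2 / (real m)\<^sup>2)"
        by (simp add: C4_def add_divide_distrib)
      ultimately show ?thesis using 1 by argo
    qed
    have AB: "\<bar>A * B - A0 * B0\<bar> \<le> C5 / (real m)\<^sup>2"
      using abs_mult_diff_le[OF A(1) B A(2) B01] by (simp add: C5_def power2_eq_square add_divide_distrib)
    have eq: "A * B / a - A0 * B0 / a0 = (A * B - A0 * B0) / a + A0 * B0 * (a0 - a) / (a * a0)"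
      using a a0 by (simp add: field_simps)
    have "\<bar>(A * B - A0 * B0) / a\<bar> \<le> (C5 / (real m)\<^sup>2) / (a0 / 2)"
      unfolding abs_divide using AB a a0 Cp by (intro frac_le) auto
    moreover have "\<bar>A0 * B0 * (a0 - a) / (a * a0)\<bar> \<le> (1 * (1 / m) * (pi * (5 * C3 / m))) / (a0 / 2 * a0)"
      unfolding abs_divide abs_mult using A01 B01 aa a a0 C_pos m
      by (intro frac_le mult_mono mult_nonneg_nonneg) (auto simp: abs_minus_commute)
    moreover have "(C5 / (real m)\<^sup>2) / (a0 / 2) + (1 * (1 / m) * (pi * (5 * C3 / m))) / (a0 / 2 * a0) = C / (real m)\<^sup>2"
      using a0 m by (simp add: C_def field_simps power2_eq_square)
    ultimately have "\<bar>A * B / a - A0 * B0 / a0\<bar> \<le> C / (real m)\<^sup>2" unfolding eq by linarith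
    moreover have "A0 * B0 / a0 = 2 / pi * (cos (r * x) * sin (r * s) / r)"
      using sin_alpha r by (simp add: A0_def B0_def a0_def field_simps power2_eq_square)
    ultimately show "\<bar>Phi (\<rho>\<^sup>2) x * integral {0..s} (Phi (\<rho>\<^sup>2)) / ip (Phi (\<rho>\<^sup>2)) (Phi (\<rho>\<^sup>2))
        - 2 / pi * (cos ((real m + 1/2) * x) * sin ((real m + 1/2) * s) / (real m + 1/2))\<bar> \<le> C / (real m)\<^sup>2"
      by (simp add: A_def B_def a_def r_def)
  qed
qed

end

section \<open>Completeness of the eigenfunctions\<close>

lemma L1_le: "h absolutely_integrable_on {0..pi} \<Longrightarrow> (\<And>t. t \<in> {0..pi} \<Longrightarrow> \<bar>h t\<bar> \<le> e) \<Longrightarrow> L1 h \<le> pi * e"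
  using integral_le[of "\<lambda>t. \<bar>h t\<bar>" "{0..pi}" "\<lambda>_. e"] integrable_const_ivl[of e 0 pi]
  by (simp add: L1_def absolutely_integrable_on_def)

lemmas continuous_absolutely_integrable = absolutely_integrable_continuous_real[where a = 0 and b = pi]

context sturm_liouville
begin

section \<open>The inner product on [0,pi]\<close>

lemma ip_commute: "ip f g = ip g f" by (simp add: ip_def mult.commute)

lemma ip_integrable:
  fixes f g :: "real \<Rightarrow> real"
  shows "f absolutely_integrable_on {0..pi} \<Longrightarrow> continuous_on {0..pi} g \<Longrightarrow> (\<lambda>t. f t * g t) integrable_on {0..pi}"
  using absolutely_integrable_mult_continuous[where g = f and y = g] by (simp add: absolutely_integrable_on_def)

lemma ip_integrable_continuous:
  fixes f g :: "real \<Rightarrow> real"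
  shows "continuous_on {0..pi} f \<Longrightarrow> continuous_on {0..pi} g \<Longrightarrow> (\<lambda>t. f t * g t) integrable_on {0..pi}"
  by (intro integrable_continuous_real continuous_intros)

lemma ip_cong: "(\<And>t. t \<in> {0..pi} \<Longrightarrow> f t = f' t) \<Longrightarrow> (\<And>t. t \<in> {0..pi} \<Longrightarrow> g t = g' t) \<Longrightarrow> ip f g = ip f' g'"
  unfolding ip_def by (rule integral_cong) auto

lemma ip_lincomb:
  assumes "continuous_on {0..pi} f" "continuous_on {0..pi} g" "continuous_on {0..pi} k"
  shows "ip (\<lambda>t. c * f t + d * g t) k = c * ip f k + d * ip g k"
proof -
  have "ip (\<lambda>t. c * f t + d * g t) k = integral {0..pi} (\<lambda>t. c * (f t * k t) + d * (g t * k t))"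
    unfolding ip_def by (simp add: algebra_simps)
  also have "\<dots> = c * ip f k + d * ip g k"
    unfolding ip_def using ip_integrable_continuous[OF assms(1,3)] ip_integrable_continuous[OF assms(2,3)]
    by (subst integral_add) (auto intro: integrable_on_mult_right)
  finally show ?thesis .
qed

lemma ip_scale: "ip (\<lambda>t. c * f t) g = c * ip f g"
  by (simp add: ip_def mult.assoc)

lemma ip_scale_both: "ip (\<lambda>t. c * f t) (\<lambda>t. c * f t) = c * c * ip f f"
proof -
  have "(\<lambda>t. c * f t * (c * f t)) = (\<lambda>t. (c * c) * (f t * f t))" by (simp add: mult_ac)
  then show ?thesis by (simp add: ip_def)
qed

lemma ip_nonneg: "continuous_on {0..pi} f \<Longrightarrow> ip f f \<ge> 0"
  unfolding ip_def by (intro integral_nonneg ip_integrable_continuous) auto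

lemma ip_square_lincomb:
  assumes "continuous_on {0..pi} f" "continuous_on {0..pi} g"
  shows "ip (\<lambda>t. f t + d * g t) (\<lambda>t. f t + d * g t) = ip f f + 2 * d * ip f g + d\<^sup>2 * ip g g"
proof -
  let ?s = "\<lambda>t. f t + d * g t"
  have cs: "continuous_on {0..pi} ?s" using assms by (intro continuous_intros)
  have "ip ?s ?s = ip f ?s + d * ip g ?s" using ip_lincomb[OF assms cs, of 1 d] by simp
  moreover have "ip ?s f = ip f f + d * ip g f" "ip ?s g = ip f g + d * ip g g"
    using ip_lincomb[OF assms assms(1), of 1 d] ip_lincomb[OF assms assms(2), of 1 d] by simp_all
  ultimately show ?thesis by (simp add: ip_commute[of f ?s] ip_commute[of g ?s] ip_commute[of g f] power2_eq_square algebra_simps)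
qed

text \<open>Cauchy-Schwarz against the constant 1, read off from the squared norm of |h| minus its
  mean.\<close>

lemma L1_square_le:
  assumes "continuous_on {0..pi} h"
  shows "(L1 h)\<^sup>2 \<le> pi * ip h h"
proof -
  have c: "continuous_on {0..pi} (\<lambda>t. \<bar>h t\<bar>)" using assms by (intro continuous_intros)
  have "0 \<le> ip (\<lambda>t. \<bar>h t\<bar> + (- L1 h / pi) * 1) (\<lambda>t. \<bar>h t\<bar> + (- L1 h / pi) * 1)"
    using c by (intro ip_nonneg continuous_on_add continuous_on_const)
  also have "\<dots> = ip (\<lambda>t. \<bar>h t\<bar>) (\<lambda>t. \<bar>h t\<bar>) + 2 * (- L1 h / pi) * ip (\<lambda>t. \<bar>h t\<bar>) (\<lambda>_. 1) + (- L1 h / pi)\<^sup>2 * ip (\<lambda>_. 1) (\<lambda>_. 1)"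
    by (rule ip_square_lincomb[OF c]) simp
  also have "ip (\<lambda>t. \<bar>h t\<bar>) (\<lambda>t. \<bar>h t\<bar>) = ip h h" by (simp add: ip_def)
  also have "ip (\<lambda>t. \<bar>h t\<bar>) (\<lambda>_. 1) = L1 h" by (simp add: ip_def L1_def)
  also have "ip (\<lambda>_. 1) (\<lambda>_. 1) = pi" by (simp add: ip_def)
  finally show ?thesis by (simp add: power2_eq_square field_simps)
qed

lemma ip_uniform_limit:
  assumes "uniform_limit {0..pi} F f sequentially" "uniform_limit {0..pi} H h sequentially"
    and c: "\<And>n. continuous_on {0..pi} (F n)" "\<And>n. continuous_on {0..pi} (H n)" "continuous_on {0..pi} f" "continuous_on {0..pi} h"
  shows "(\<lambda>n. ip (F n) (H n)) \<longlonglongrightarrow> ip f h"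
proof -
  have "uniform_limit {0..pi} (\<lambda>n t. F n t * H n t) (\<lambda>t. f t * h t) sequentially"
    using assms by (intro uniform_lim_mult compact_imp_bounded compact_continuous_image) auto
  moreover have "continuous_on {0..pi} (\<lambda>t. F n t * H n t)" for n using c by (intro continuous_intros)
  ultimately obtain I J where IJ: "\<And>n. ((\<lambda>t. F n t * H n t) has_integral I n) {0..pi}"
      "((\<lambda>t. f t * h t) has_integral J) {0..pi}" "(I \<longlongrightarrow> J) sequentially"
    by (rule uniform_limit_integral) auto
  then show ?thesis unfolding ip_def using integral_unique[OF IJ(1)] integral_unique[OF IJ(2)] by simp
qed

end

section \<open>The resolvent at a point outside the spectrum\<close>

locale sl_resolvent = sturm_liouville +
  fixes \<mu>0 :: real
  assumes mu0: "\<mu>0 \<notin> ev"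
begin

definition bvp :: "(real \<Rightarrow> real) \<Rightarrow> (real \<Rightarrow> real) \<Rightarrow> (real \<Rightarrow> real) \<Rightarrow> bool" where
  "bvp h u u' \<longleftrightarrow> ode_sol (\<lambda>t. q t - \<mu>0) h u u' \<and> u 0 * cos \<alpha> + u' 0 * sin \<alpha> = 0 \<and> u pi = 0"

lemma bvp_lincomb:
  assumes "bvp h u u'" "bvp k v v'"
  shows "bvp (\<lambda>t. c * h t + d * k t) (\<lambda>t. c * u t + d * v t) (\<lambda>t. c * u' t + d * v' t)"
proof -
  have "(c * u 0 + d * v 0) * cos \<alpha> + (c * u' 0 + d * v' 0) * sin \<alpha>
      = c * (u 0 * cos \<alpha> + u' 0 * sin \<alpha>) + d * (v 0 * cos \<alpha> + v' 0 * sin \<alpha>)" by (simp add: algebra_simps)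
  then show ?thesis using assms ode_sol_lincomb unfolding bvp_def by simp
qed

text \<open>The solution with zero initial data is corrected by a multiple of Phi \<mu>0. This
  respects the left condition, and Phi \<mu>0 pi \<noteq> 0 lets it meet the right one.\<close>

lemma bvp_exists:
  assumes h: "h absolutely_integrable_on {0..pi}"
  shows "\<exists>u u'. bvp h u u'"
proof -
  obtain v v' where v: "ode_sol (\<lambda>t. q t - \<mu>0) h v v'" "v 0 = 0" "v' 0 = 0"
    using ode_sol_exists[OF q_minus h] by metis
  define c where "c = v pi / Phi \<mu>0 pi"
  have "ode_sol (\<lambda>t. q t - \<mu>0) h (\<lambda>t. v t - c * Phi \<mu>0 t) (\<lambda>t. v' t - c * Phi' \<mu>0 t)"
    using ode_sol_lincomb[OF v(1) Phi_sol, where c = 1 and d = "-c"] by simp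
  then show ?thesis using v mu0 unfolding bvp_def ev_def
    by (intro exI[of _ "\<lambda>t. v t - c * Phi \<mu>0 t"] exI[of _ "\<lambda>t. v' t - c * Phi' \<mu>0 t"]) (simp add: c_def)
qed

text \<open>Subtracting the solution v with zero initial data leaves c * Phi \<mu>0, and u pi = 0
  determines c from v pi. Hence the initial data of u are controlled by L1 h and the a priori bounds
  apply. The bound on u' later supplies equicontinuity.\<close>

lemma bvp_bound:
  "\<exists>C>0. \<forall>h u u' x. h absolutely_integrable_on {0..pi} \<longrightarrow> bvp h u u' \<longrightarrow> x \<in> {0..pi} \<longrightarrow>
     \<bar>u x\<bar> \<le> C * L1 h \<and> \<bar>u' x\<bar> \<le> C * L1 h"
proof -
  define P where "P = L1 (\<lambda>t. q t - \<mu>0)"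
  have P: "P \<ge> 0" unfolding P_def by (rule L1_nonneg[OF q_minus])
  define E where "E = exp ((2 * P + 1) * pi)"
  have E: "E > 0" by (simp add: E_def)
  define c0 where "c0 = E * (2 * pi) / \<bar>Phi \<mu>0 pi\<bar>"
  have c0: "c0 > 0" using mu0 E by (simp add: c0_def ev_def)
  define D where "D = E * (2 * (c0 + pi * (c0 + 1)))"
  have D: "D > 0" using c0 E by (simp add: D_def add_pos_pos)
  show ?thesis
  proof (intro exI[of _ "c0 + 1 + P * D + D"] conjI allI impI)
    show "c0 + 1 + P * D + D > 0" using c0 P D by (simp add: add_pos_pos add_pos_nonneg)
    fix h u u' x assume h: "h absolutely_integrable_on {0..pi}" and u: "bvp h u u'" and x: "x \<in> {0..pi}"
    note us = u[unfolded bvp_def, THEN conjunct1]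
    have Lh: "L1 h \<ge> 0" by (rule L1_nonneg[OF h])
    obtain v v' where v: "ode_sol (\<lambda>t. q t - \<mu>0) h v v'" "v 0 = 0" "v' 0 = 0"
      using ode_sol_exists[OF q_minus h] by metis
    have vb: "\<bar>v pi\<bar> \<le> E * (2 * pi) * L1 h"
      using ode_sol_bound[OF q_minus h v(1), of pi] v by (simp add: E_def P_def mult.assoc)
    have w: "ode_sol (\<lambda>t. q t - \<mu>0) (\<lambda>_. 0) (\<lambda>t. u t - v t) (\<lambda>t. u' t - v' t)"
      using ode_sol_lincomb[OF us v(1), where c = 1 and d = "-1"] by simp
    define c where "c = u 0 / sin \<alpha>"
    have "u pi - v pi = (u 0 - v 0) / sin \<alpha> * Phi \<mu>0 pi"
      using u v by (intro left_boundary_multiple[OF w]) (auto simp: bvp_def)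
    then have "v pi = - c * Phi \<mu>0 pi" using u v by (simp add: bvp_def c_def)
    then have "\<bar>c\<bar> * \<bar>Phi \<mu>0 pi\<bar> \<le> E * (2 * pi) * L1 h" using vb by (simp add: abs_mult)
    then have c: "\<bar>c\<bar> \<le> c0 * L1 h" using mu0 by (simp add: c0_def ev_def field_simps)
    have "u 0 = c * sin \<alpha>" using sin_alpha by (simp add: c_def)
    then have u0: "\<bar>u 0\<bar> \<le> c0 * L1 h" using c mult_left_mono[OF abs_sin_le_one[of \<alpha>], of "\<bar>c\<bar>"] by (simp add: abs_mult)
    have "u' 0 = - c * cos \<alpha>" using u sin_alpha by (simp add: c_def bvp_def field_simps)
    then have u'0: "\<bar>u' 0\<bar> \<le> c0 * L1 h" using c mult_left_mono[OF abs_cos_le_one[of \<alpha>], of "\<bar>c\<bar>"] by (simp add: abs_mult)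
    have ux: "\<bar>u t\<bar> \<le> D * L1 h" if t: "t \<in> {0..pi}" for t
    proof -
      have "\<bar>u t\<bar> \<le> E * (2 * (\<bar>u 0\<bar> + pi * (\<bar>u' 0\<bar> + L1 h)))"
        using ode_sol_bound[OF q_minus h us t] by (simp add: E_def P_def)
      also have "\<dots> \<le> E * (2 * (c0 * L1 h + pi * (c0 * L1 h + L1 h)))"
        using u0 u'0 E by (intro mult_left_mono add_mono) auto
      finally show ?thesis by (simp add: D_def algebra_simps)
    qed
    have "\<bar>u' x\<bar> \<le> \<bar>u' 0\<bar> + L1 h + P * (D * L1 h)"
      unfolding P_def using ux x by (intro ode_sol_bound'[OF q_minus h us x]) auto
    also have "\<dots> \<le> (c0 + 1 + P * D) * L1 h" using u'0 by (simp add: algebra_simps)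
    also have "\<dots> \<le> (c0 + 1 + P * D + D) * L1 h" using D Lh by (intro mult_right_mono) auto
    finally show "\<bar>u' x\<bar> \<le> (c0 + 1 + P * D + D) * L1 h" .
    have "\<bar>u x\<bar> \<le> D * L1 h" by (rule ux[OF x])
    also have "\<dots> \<le> (c0 + 1 + P * D + D) * L1 h" using D Lh P c0 by (intro mult_right_mono) auto
    finally show "\<bar>u x\<bar> \<le> (c0 + 1 + P * D + D) * L1 h" .
  qed
qed

lemma bvp_symmetric:
  assumes h: "h absolutely_integrable_on {0..pi}" and k: "k absolutely_integrable_on {0..pi}"
    and u: "bvp h u u'" and w: "bvp k w w'"
  shows "ip u k = ip h w"
proof -
  have us: "ode_sol (\<lambda>t. q t - \<mu>0) h u u'" and ws: "ode_sol (\<lambda>t. q t - \<mu>0) k w w'" using u w by (auto simp: bvp_def)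
  \<comment> \<open>Multiplied by sin \<alpha>, the Wronskian at 0 becomes a combination of the two
    left boundary forms, which vanish.\<close>
  have "sin \<alpha> * (u' 0 * w 0 - u 0 * w' 0) = (u 0 * cos \<alpha> + u' 0 * sin \<alpha>) * w 0 - u 0 * (w 0 * cos \<alpha> + w' 0 * sin \<alpha>)"
    by (simp add: algebra_simps)
  then have "u' 0 * w 0 - u 0 * w' 0 = 0" using u w sin_alpha by (simp add: bvp_def)
  then have "((\<lambda>t. ((q t - \<mu>0) * u t - h t) * w t - u t * ((q t - \<mu>0) * w t - k t)) has_integral 0) {0..pi}"
    using ode_sol_green[OF q_minus q_minus h k us ws, of pi] u w by (simp add: bvp_def)
  then have "((\<lambda>t. k t * u t - h t * w t) has_integral 0) {0..pi}" by (simp add: algebra_simps)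
  then have "integral {0..pi} (\<lambda>t. k t * u t - h t * w t) = 0" by (rule integral_unique)
  then have "ip k u - ip h w = 0"
    unfolding ip_def using ip_integrable[OF k ode_sol_continuous[OF us]] ip_integrable[OF h ode_sol_continuous[OF ws]]
    by (simp add: integral_diff)
  then show ?thesis by (simp add: ip_commute)
qed

lemma bvp_Phi:
  assumes "\<mu> \<in> ev"
  shows "bvp (\<lambda>t. (\<mu> - \<mu>0) * Phi \<mu> t) (Phi \<mu>) (Phi' \<mu>)"
proof -
  have "ode_sol (\<lambda>t. q t - \<mu>0) (\<lambda>t. (\<mu> - \<mu>0) * Phi \<mu> t) (Phi \<mu>) (Phi' \<mu>)"
    by (rule ode_sol_cong[OF Phi_sol]) (simp add: algebra_simps)
  then show ?thesis using assms by (simp add: bvp_def ev_def)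
qed

text \<open>Phi \<mu> is the resolvent image of (\<mu> - \<mu>0) * Phi \<mu>, so symmetry turns the
  inner product of u with this multiple into that of h with Phi \<mu>; the factor is nonzero because
  \<mu>0 is no eigenvalue.\<close>

lemma bvp_orthogonal:
  assumes h: "h absolutely_integrable_on {0..pi}" and u: "bvp h u u'" and \<mu>: "\<mu> \<in> ev" and o: "ip h (Phi \<mu>) = 0"
  shows "ip u (Phi \<mu>) = 0"
proof -
  have "ip u (\<lambda>t. (\<mu> - \<mu>0) * Phi \<mu> t) = ip h (Phi \<mu>)"
    by (rule bvp_symmetric[OF h _ u bvp_Phi[OF \<mu>]]) (intro continuous_absolutely_integrable continuous_intros Phi_continuous)
  then have "(\<mu> - \<mu>0) * ip u (Phi \<mu>) = 0" using o ip_scale[of "\<mu> - \<mu>0" "Phi \<mu>" u] by (simp add: ip_commute)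
  then show ?thesis using \<mu> mu0 by auto
qed

definition ortho where "ortho = {h. continuous_on {0..pi} h \<and> (\<forall>\<mu>\<in>ev. ip h (Phi \<mu>) = 0)}"

lemma ortho_continuous: "h \<in> ortho \<Longrightarrow> continuous_on {0..pi} h" by (simp add: ortho_def)
lemma ortho_abs_int: "h \<in> ortho \<Longrightarrow> h absolutely_integrable_on {0..pi}"
  by (simp add: ortho_def continuous_absolutely_integrable)

lemma ortho_lincomb: "f \<in> ortho \<Longrightarrow> g \<in> ortho \<Longrightarrow> (\<lambda>t. c * f t + d * g t) \<in> ortho"
  unfolding ortho_def using ip_lincomb Phi_continuous by (auto intro!: continuous_intros)

text \<open>An eigenvector of the resolvent for \<kappa> solves the original problem at \<mu>0 + 1 /
  \<kappa> and is a multiple of Phi there. If nonzero, it would be an eigenfunction orthogonal to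
  itself.\<close>

lemma ortho_no_eigenfunction:
  assumes w: "w \<in> ortho" and \<kappa>: "\<kappa> \<noteq> 0" and b: "bvp w u u'" and e: "\<And>t. t \<in> {0..pi} \<Longrightarrow> u t = \<kappa> * w t" and x: "x \<in> {0..pi}"
  shows "w x = 0"
proof -
  define \<mu> where "\<mu> = \<mu>0 + 1 / \<kappa>"
  have us: "ode_sol (\<lambda>t. q t - \<mu>0) w u u'" using b by (simp add: bvp_def)
  have "ode_sol (\<lambda>t. q t - \<mu>0) (\<lambda>t. w t / \<kappa>) (\<lambda>t. u t / \<kappa>) (\<lambda>t. u' t / \<kappa>)"
    using ode_sol_lincomb[OF us us, where c = "1 / \<kappa>" and d = 0] by simp
  then have "ode_sol (\<lambda>t. q t - \<mu>0) (\<lambda>t. w t / \<kappa>) w (\<lambda>t. u' t / \<kappa>)"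
    by (rule ode_sol_cong_fun) (simp add: e \<kappa>)
  then have ws: "ode_sol (\<lambda>t. q t - \<mu>) (\<lambda>_. 0) w (\<lambda>t. u' t / \<kappa>)"
    by (rule ode_sol_cong) (simp add: \<mu>_def algebra_simps)
  have "\<kappa> * w 0 * cos \<alpha> + u' 0 * sin \<alpha> = 0" using b e[of 0] by (simp add: bvp_def)
  then have bc: "w 0 * cos \<alpha> + u' 0 / \<kappa> * sin \<alpha> = 0" using \<kappa> by (simp add: field_simps)
  define c where "c = w 0 / sin \<alpha>"
  have wc: "w t = c * Phi \<mu> t" if "t \<in> {0..pi}" for t
    unfolding c_def by (rule left_boundary_multiple[OF ws bc that])
  have "c = 0"
  proof (rule ccontr)
    assume c: "c \<noteq> 0"
    have "w pi = 0" using b e[of pi] \<kappa> by (simp add: bvp_def)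
    then have "\<mu> \<in> ev" using wc[of pi] c by (simp add: ev_def)
    then have "ip w (Phi \<mu>) = 0" using w by (simp add: ortho_def)
    moreover have "ip w (Phi \<mu>) = ip (\<lambda>t. c * Phi \<mu> t) (Phi \<mu>)" by (rule ip_cong) (simp_all add: wc)
    ultimately show False using c Phi_norm_nonzero by (simp add: ip_scale)
  qed
  then show ?thesis using wc[OF x] by simp
qed

definition G where "G h = (SOME u. \<exists>u'. bvp h u u')"

lemma G: "h absolutely_integrable_on {0..pi} \<Longrightarrow> \<exists>u'. bvp h (G h) u'"
  unfolding G_def using bvp_exists by (rule someI_ex)

lemma G_continuous: "h absolutely_integrable_on {0..pi} \<Longrightarrow> continuous_on {0..pi} (G h)"
  using G ode_sol_continuous unfolding bvp_def by blast

lemma G_ortho: "h \<in> ortho \<Longrightarrow> G h \<in> ortho"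
  using G[of h] bvp_orthogonal[of h "G h"] G_continuous[of h] ortho_abs_int by (auto simp: ortho_def)

lemma G_symmetric: "h absolutely_integrable_on {0..pi} \<Longrightarrow> k absolutely_integrable_on {0..pi} \<Longrightarrow> ip (G h) k = ip h (G k)"
  using G[of h] G[of k] bvp_symmetric[of h k "G h" _ "G k"] by metis

text \<open>G is a choice, so linearity is not built in; the last clause supplies it together with
  boundedness, since its right-hand side vanishes on linear relations. The Lipschitz clause is the
  equicontinuity for Arzela-Ascoli.\<close>

lemma G_bound:
  obtains C where "C > 0"
    "\<And>h x. h absolutely_integrable_on {0..pi} \<Longrightarrow> x \<in> {0..pi} \<Longrightarrow> \<bar>G h x\<bar> \<le> C * L1 h"
    "\<And>h x y. h absolutely_integrable_on {0..pi} \<Longrightarrow> x \<in> {0..pi} \<Longrightarrow> y \<in> {0..pi} \<Longrightarrow> \<bar>G h x - G h y\<bar> \<le> C * L1 h * \<bar>x - y\<bar>"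
    "\<And>h k c d x. h absolutely_integrable_on {0..pi} \<Longrightarrow> k absolutely_integrable_on {0..pi} \<Longrightarrow> x \<in> {0..pi} \<Longrightarrow>
       \<bar>c * G h x + d * G k x\<bar> \<le> C * L1 (\<lambda>t. c * h t + d * k t)"
proof -
  obtain C where C: "C > 0" "\<And>h u u' x. h absolutely_integrable_on {0..pi} \<Longrightarrow> bvp h u u' \<Longrightarrow> x \<in> {0..pi} \<Longrightarrow>
     \<bar>u x\<bar> \<le> C * L1 h \<and> \<bar>u' x\<bar> \<le> C * L1 h" using bvp_bound by blast
  show thesis
  proof (rule that[OF C(1)])
    fix h k :: "real \<Rightarrow> real" and c d x y
    assume h: "h absolutely_integrable_on {0..pi}" and x: "x \<in> {0..pi}"
    obtain u' where u': "bvp h (G h) u'" using G[OF h] by blast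
    show "\<bar>G h x\<bar> \<le> C * L1 h" using C(2)[OF h u' x] by blast
    { assume y: "y \<in> {0..pi}"
      show "\<bar>G h x - G h y\<bar> \<le> C * L1 h * \<bar>x - y\<bar>"
        using field_differentiable_bound[of "{0..pi}" "G h" u' "C * L1 h" x y] C(2)[OF h u'] x y
          ode_sol_deriv[of _ h "G h" u'] u' unfolding bvp_def real_norm_def by blast }
    { assume k: "k absolutely_integrable_on {0..pi}"
      obtain v' where v': "bvp k (G k) v'" using G[OF k] by blast
      have "(\<lambda>t. c * h t + d * k t) absolutely_integrable_on {0..pi}" using h k by (intro set_integral_add) auto
      then show "\<bar>c * G h x + d * G k x\<bar> \<le> C * L1 (\<lambda>t. c * h t + d * k t)"
        using C(2)[OF _ bvp_lincomb[OF u' v'] x] by blast }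
  qed
qed

text \<open>If G h vanishes on [0,pi], so does its derivative, endpoints included, and the
  integrated equation reduces to the primitive of h. A summable h can be determined only up to null
  sets.\<close>

lemma G_eq_0_imp_integral_0:
  assumes h: "h absolutely_integrable_on {0..pi}" and z: "\<And>t. t \<in> {0..pi} \<Longrightarrow> G h t = 0" and x: "x \<in> {0..pi}"
  shows "integral {0..x} h = 0"
proof -
  obtain u' where u': "ode_sol (\<lambda>t. q t - \<mu>0) h (G h) u'" using G[OF h] by (auto simp: bvp_def)
  have u0: "u' t = 0" if t: "t \<in> {0..pi}" for t
  proof -
    have "(G h has_vector_derivative u' t) (at t within cbox 0 pi)"
      using ode_sol_deriv[OF u' t] by (simp add: has_real_derivative_iff_has_vector_derivative)
    moreover have "(G h has_vector_derivative 0) (at t within cbox 0 pi)"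
      using t by (intro has_vector_derivative_transform[OF _ _ has_vector_derivative_const[of 0]]) (simp_all add: z)
    ultimately show ?thesis using vector_derivative_unique_within_closed_interval[of 0 pi t] t by auto
  qed
  have "((\<lambda>t. (q t - \<mu>0) * G h t - h t) has_integral 0) {0..x}"
    using ode_sol_has_integral[OF u' x] u0[OF x] u0[of 0] by simp
  then have "((\<lambda>t. - h t) has_integral 0) {0..x}"
    by (rule has_integral_eq[rotated]) (use z x in auto)
  from has_integral_neg[OF this] have "(h has_integral 0) {0..x}" by simp
  then show ?thesis by (rule integral_unique)
qed

lemma G_eq_0_imp_0:
  assumes h: "continuous_on {0..pi} h" and z: "\<And>t. t \<in> {0..pi} \<Longrightarrow> G h t = 0" and x: "x \<in> {0..pi}"
  shows "h x = 0"
proof -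
  have i: "integral {0..t} h = 0" if "t \<in> {0..pi}" for t
    using G_eq_0_imp_integral_0[OF continuous_absolutely_integrable[OF h] z that] by blast
  have "((\<lambda>t. integral {0..t} h) has_vector_derivative h x) (at x within cbox 0 pi)"
    using integral_has_vector_derivative[OF h x] by simp
  moreover have "((\<lambda>t. integral {0..t} h) has_vector_derivative 0) (at x within cbox 0 pi)"
    using x by (intro has_vector_derivative_transform[OF _ _ has_vector_derivative_const[of 0]]) (simp_all add: i)
  ultimately show ?thesis using vector_derivative_unique_within_closed_interval[of 0 pi x] x by auto
qed

text \<open>If the orthogonal complement of the eigenfunctions were non-trivial, a maximizing sequence for the norm
  of the resolvent on it would, by Arzela-Ascoli, produce an eigenfunction of the squared resolvent there.\<close>
lemma ortho_trivial:
  assumes h0: "h0 \<in> ortho" and x0: "x0 \<in> {0..pi}"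
  shows "h0 x0 = 0"
proof (rule ccontr)
  assume ne: "h0 x0 \<noteq> 0"
  obtain C where C: "C > 0"
    "\<And>h x. h absolutely_integrable_on {0..pi} \<Longrightarrow> x \<in> {0..pi} \<Longrightarrow> \<bar>G h x\<bar> \<le> C * L1 h"
    "\<And>h x y. h absolutely_integrable_on {0..pi} \<Longrightarrow> x \<in> {0..pi} \<Longrightarrow> y \<in> {0..pi} \<Longrightarrow> \<bar>G h x - G h y\<bar> \<le> C * L1 h * \<bar>x - y\<bar>"
    "\<And>h k c d x. h absolutely_integrable_on {0..pi} \<Longrightarrow> k absolutely_integrable_on {0..pi} \<Longrightarrow> x \<in> {0..pi} \<Longrightarrow>
       \<bar>c * G h x + d * G k x\<bar> \<le> C * L1 (\<lambda>t. c * h t + d * k t)"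
    using G_bound by blast
  note oc = ortho_continuous and oa = ortho_abs_int
  \<comment> \<open>Squared norms of resolvent images of unit vectors; the supremum M is the
    prospective eigenvalue of the squared resolvent.\<close>
  define V where "V = {ip (G h) (G h) | h. h \<in> ortho \<and> ip h h = 1}"
  have L1_unit: "L1 h \<le> pi" if h: "h \<in> ortho" "ip h h = 1" for h
  proof -
    have "(L1 h)\<^sup>2 \<le> pi" using L1_square_le[OF oc[OF h(1)]] h(2) by simp
    also have "pi = pi * 1" by simp
    also have "pi * 1 \<le> pi * pi" using pi_ge_two by (intro mult_left_mono) auto
    finally have "(L1 h)\<^sup>2 \<le> pi\<^sup>2" by (simp only: power2_eq_square[of pi])
    then show ?thesis by (rule power2_le_imp_le) simp
  qed
  have Gb: "\<bar>G h x\<bar> \<le> C * pi" if "h \<in> ortho" "ip h h = 1" "x \<in> {0..pi}" for h x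
    using C(2)[OF oa[OF that(1)] that(3)] mult_left_mono[OF L1_unit[OF that(1,2)], of C] C(1) by linarith
  have bdd: "bdd_above V"
  proof (rule bdd_aboveI[of _ "pi * (C * pi)\<^sup>2"])
    fix v assume "v \<in> V"
    then obtain h where h: "h \<in> ortho" "ip h h = 1" "v = ip (G h) (G h)" by (auto simp: V_def)
    have "integral {0..pi} (\<lambda>t. G h t * G h t) \<le> integral {0..pi} (\<lambda>t. (C * pi)\<^sup>2)"
    proof (rule integral_le)
      show "(\<lambda>t. G h t * G h t) integrable_on {0..pi}"
        using oc[OF G_ortho[OF h(1)]] by (intro ip_integrable_continuous)
      fix t assume "t \<in> {0..pi}"
      from power_mono[OF Gb[OF h(1,2) this], of 2] show "G h t * G h t \<le> (C * pi)\<^sup>2" by (simp add: power2_eq_square)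
    qed auto
    then show "v \<le> pi * (C * pi)\<^sup>2" using h by (simp add: ip_def)
  qed
  have ip0: "ip h0 h0 > 0"
    using ip_nonneg[OF oc[OF h0]] ip_self_0[OF oc[OF h0] _ x0] ne by (cases "ip h0 h0 = 0") auto
  define M where "M = Sup V"
  have scale: "ip (G h) (G h) \<le> M * ip h h" if h: "h \<in> ortho" for h
  proof (cases "ip h h = 0")
    case True
    then have "L1 h = 0" using L1_square_le[OF oc[OF h]] by simp
    then have "G h t = 0" if "t \<in> {0..pi}" for t using C(2)[OF oa[OF h] that] by simp
    then have "ip (G h) (G h) = ip (\<lambda>_. 0) (\<lambda>_. 0)" by (intro ip_cong) auto
    then show ?thesis using True by (simp add: ip_def)
  next
    case False
    then have pos: "ip h h > 0" using ip_nonneg[OF oc[OF h]] by simp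
    define c where "c = 1 / sqrt (ip h h)"
    have c2: "c * c = 1 / ip h h" using pos by (simp add: c_def)
    let ?k = "\<lambda>t. c * h t"
    have k: "?k \<in> ortho" using ortho_lincomb[OF h h, of c 0] by simp
    have "ip ?k ?k = c * c * ip h h" by (rule ip_scale_both)
    then have "ip ?k ?k = 1" using c2 pos by simp
    then have le: "ip (G ?k) (G ?k) \<le> M" unfolding M_def using k by (intro cSup_upper bdd) (auto simp: V_def)
    have "\<bar>1 * G ?k t + (- c) * G h t\<bar> \<le> C * L1 (\<lambda>t. 1 * ?k t + (- c) * h t)" if "t \<in> {0..pi}" for t
      by (rule C(4)[OF oa[OF k] oa[OF h] that])
    then have "G ?k t = c * G h t" if "t \<in> {0..pi}" for t using that by (fastforce simp: L1_def)
    then have "ip (G ?k) (G ?k) = ip (\<lambda>t. c * G h t) (\<lambda>t. c * G h t)" by (intro ip_cong)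
    also have "\<dots> = c * c * ip (G h) (G h)" by (rule ip_scale_both)
    finally have "ip (G ?k) (G ?k) = ip (G h) (G h) / ip h h" unfolding c2 by simp
    then show ?thesis using le pos by (simp only: pos_divide_le_eq)
  qed
  have "M > 0"
  proof -
    have "ip (G h0) (G h0) \<noteq> 0"
      using ip_self_0[OF oc[OF G_ortho[OF h0]]] G_eq_0_imp_0[OF oc[OF h0] _ x0] ne by blast
    then have "ip (G h0) (G h0) > 0" using ip_nonneg[OF oc[OF G_ortho[OF h0]]] by simp
    then show ?thesis using scale[OF h0] ip0 by (smt (verit) mult_nonpos_nonneg)
  qed
  have Vne: "V \<noteq> {}"
  proof -
    define c where "c = 1 / sqrt (ip h0 h0)"
    have "(\<lambda>t. c * h0 t) \<in> ortho" using ortho_lincomb[OF h0 h0, of c 0] by simp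
    moreover have "ip (\<lambda>t. c * h0 t) (\<lambda>t. c * h0 t) = c * c * ip h0 h0" by (rule ip_scale_both)
    then have "ip (\<lambda>t. c * h0 t) (\<lambda>t. c * h0 t) = 1" using ip0 by (simp add: c_def)
    ultimately show ?thesis by (auto simp: V_def)
  qed
  have "\<exists>h. h \<in> ortho \<and> ip h h = 1 \<and> ip (G h) (G h) > M - 1 / real (Suc n)" for n
  proof -
    have "M - 1 / real (Suc n) < Sup V" by (simp add: M_def)
    then obtain v where "v \<in> V" "M - 1 / real (Suc n) < v" using less_cSup_iff[OF Vne bdd] by blast
    then show ?thesis by (auto simp: V_def)
  qed
  then obtain H where H: "\<And>n. H n \<in> ortho" "\<And>n. ip (H n) (H n) = 1" "\<And>n. ip (G (H n)) (G (H n)) > M - 1 / real (Suc n)" by metis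
  define U where "U n = G (H n)" for n
  have Uo: "U n \<in> ortho" for n unfolding U_def by (rule G_ortho[OF H(1)])
  obtain g k where g: "continuous_on {0..pi} g" and k: "strict_mono (k :: nat \<Rightarrow> nat)"
    and conv: "\<And>e. 0 < e \<Longrightarrow> \<exists>N. \<forall>n x. n \<ge> N \<and> x \<in> {0..pi} \<longrightarrow> norm (U (k n) x - g x) < e"
  proof (rule Arzela_Ascoli[of "{0..pi}" U "C * pi"])
    show "norm (U n x) \<le> C * pi" if "x \<in> {0..pi}" for n x
      using Gb[OF H(1,2) that] by (simp add: U_def)
    fix x e :: real assume x: "x \<in> {0..pi}" and e: "e > 0"
    show "\<exists>d>0. \<forall>n y. y \<in> {0..pi} \<and> norm (x - y) < d \<longrightarrow> norm (U n x - U n y) < e"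
    proof (intro exI[of _ "e / (C * pi)"] conjI allI impI)
      show "0 < e / (C * pi)" using e C by simp
      fix n y assume y: "y \<in> {0..pi} \<and> norm (x - y) < e / (C * pi)"
      have "\<bar>U n x - U n y\<bar> \<le> C * L1 (H n) * \<bar>x - y\<bar>" unfolding U_def using C(3)[OF oa[OF H(1)] x] y by blast
      also have "\<dots> \<le> C * pi * \<bar>x - y\<bar>" using L1_unit[OF H(1,2)] C(1) by (intro mult_right_mono mult_left_mono) auto
      also have "\<dots> < e" using y C(1) by (simp add: field_simps)
      finally show "norm (U n x - U n y) < e" by simp
    qed
  qed auto
  have ul: "uniform_limit {0..pi} (\<lambda>n. U (k n)) g sequentially"
    unfolding uniform_limit_sequentially_iff dist_real_def using conv by fastforce
  have Uc: "continuous_on {0..pi} (U n)" for n by (rule oc[OF Uo])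
  have tlim: "(\<lambda>n. ip (U (k n)) (U (k n))) \<longlonglongrightarrow> M"
  proof (rule tendsto_sandwich[of "\<lambda>n. M - 1 / real (Suc n)" _ _ "\<lambda>_. M"])
    show "\<forall>\<^sub>F n in sequentially. M - 1 / real (Suc n) \<le> ip (U (k n)) (U (k n))"
    proof (intro always_eventually allI)
      fix n
      have "1 / real (Suc (k n)) \<le> 1 / real (Suc n)" using seq_suble[OF k, of n] by (intro divide_left_mono) auto
      then show "M - 1 / real (Suc n) \<le> ip (U (k n)) (U (k n))" using H(3)[of "k n"] by (simp add: U_def)
    qed
    show "\<forall>\<^sub>F n in sequentially. ip (U (k n)) (U (k n)) \<le> M"
      using scale[OF H(1)] by (intro always_eventually allI) (simp add: U_def H(2))
    show "(\<lambda>n. M - 1 / real (Suc n)) \<longlonglongrightarrow> M"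
      using tendsto_diff[OF tendsto_const LIMSEQ_inverse_real_of_nat, of M] by (simp add: inverse_eq_divide)
  qed simp
  moreover have "(\<lambda>n. ip (U (k n)) (U (k n))) \<longlonglongrightarrow> ip g g" by (rule ip_uniform_limit[OF ul ul Uc Uc g g])
  ultimately have ipg: "ip g g = M" using LIMSEQ_unique by blast
  have go: "g \<in> ortho"
  proof -
    have "ip g (Phi \<mu>) = 0" if "\<mu> \<in> ev" for \<mu>
    proof -
      have "(\<lambda>n. ip (U (k n)) (Phi \<mu>)) \<longlonglongrightarrow> ip g (Phi \<mu>)"
        by (rule ip_uniform_limit[OF ul _ Uc Phi_continuous g Phi_continuous]) (simp add: uniform_limit_iff)
      moreover have "ip (U n) (Phi \<mu>) = 0" for n using Uo that by (simp add: ortho_def)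
      ultimately show ?thesis by (simp add: LIMSEQ_const_iff)
    qed
    then show ?thesis using g by (simp add: ortho_def)
  qed
  have GGg: "G (G g) x = M * g x" if x: "x \<in> {0..pi}" for x
  proof -
    have ga: "g absolutely_integrable_on {0..pi}" "G g absolutely_integrable_on {0..pi}"
      using oa[OF go] oa[OF G_ortho[OF go]] by auto
    have Ua: "U n absolutely_integrable_on {0..pi}" "G (U n) absolutely_integrable_on {0..pi}" for n
      using oa[OF Uo] oa[OF G_ortho[OF Uo]] by auto
    have L1lim: "(\<lambda>n. L1 (\<lambda>t. 1 * U (k n) t + (-1) * g t)) \<longlonglongrightarrow> 0"
    proof (rule tendstoI)
      fix e :: real assume e: "e > 0"
      then obtain N where N: "\<And>n x. n \<ge> N \<Longrightarrow> x \<in> {0..pi} \<Longrightarrow> \<bar>U (k n) x - g x\<bar> < e / 4" using conv[of "e / 4"] by auto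
      have "dist (L1 (\<lambda>t. 1 * U (k n) t + (-1) * g t)) 0 < e" if "n \<ge> N" for n
      proof -
        have a: "(\<lambda>t. 1 * U (k n) t + (-1) * g t) absolutely_integrable_on {0..pi}"
          using Uc g by (intro continuous_absolutely_integrable continuous_intros)
        have "L1 (\<lambda>t. 1 * U (k n) t + (-1) * g t) \<le> pi * (e / 4)"
          using N[OF that] by (intro L1_le[OF a]) (auto intro: less_imp_le)
        also have "\<dots> < e" using e pi_less_4 by simp
        finally show ?thesis using L1_nonneg[OF a] by simp
      qed
      then show "\<forall>\<^sub>F n in sequentially. dist (L1 (\<lambda>t. 1 * U (k n) t + (-1) * g t)) 0 < e"
        unfolding eventually_sequentially by blast
    qed
    have lim1: "(\<lambda>n. G (G (U (k n))) x - G (G g) x) \<longlonglongrightarrow> 0"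
    proof (rule Lim_null_comparison)
      show "\<forall>\<^sub>F n in sequentially. norm (G (G (U (k n))) x - G (G g) x) \<le> C * (pi * (C * L1 (\<lambda>t. 1 * U (k n) t + (-1) * g t)))"
      proof (intro always_eventually allI)
        fix n
        let ?d = "\<lambda>t. 1 * G (U (k n)) t + (-1) * G g t"
        have "continuous_on {0..pi} ?d"
          using oc[OF G_ortho[OF Uo[of "k n"]]] oc[OF G_ortho[OF go]] by (intro continuous_intros)
        then have a: "L1 ?d \<le> pi * (C * L1 (\<lambda>t. 1 * U (k n) t + (-1) * g t))"
          by (rule L1_le[OF continuous_absolutely_integrable]) (rule C(4)[OF Ua(1) ga(1)])
        have b: "\<bar>1 * G (G (U (k n))) x + (-1) * G (G g) x\<bar> \<le> C * L1 ?d" by (rule C(4)[OF Ua(2) ga(2) x])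
        show "norm (G (G (U (k n))) x - G (G g) x) \<le> C * (pi * (C * L1 (\<lambda>t. 1 * U (k n) t + (-1) * g t)))"
          using order_trans[OF b mult_left_mono[OF a]] C(1) by simp
      qed
      show "(\<lambda>n. C * (pi * (C * L1 (\<lambda>t. 1 * U (k n) t + (-1) * g t)))) \<longlonglongrightarrow> 0"
        by (intro tendsto_mult_right_zero L1lim)
    qed
    have lim2: "(\<lambda>n. G (G (U (k n))) x - M * U (k n) x) \<longlonglongrightarrow> 0"
    proof (rule Lim_null_comparison)
      show "\<forall>\<^sub>F n in sequentially. norm (G (G (U (k n))) x - M * U (k n) x) \<le> C * sqrt (pi * (M * (M - ip (U (k n)) (U (k n)))))"
      proof (intro always_eventually allI)
        fix n
        let ?h = "H (k n)" and ?u = "U (k n)"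
        let ?d = "\<lambda>t. 1 * G ?u t + (- M) * ?h t"
        have c: "continuous_on {0..pi} (G ?u)" "continuous_on {0..pi} ?h" using oc[OF G_ortho[OF Uo]] oc[OF H(1)] by auto
        have cd: "continuous_on {0..pi} ?d" using c by (intro continuous_intros)
        \<comment> \<open>By this symmetry and ip (G u) (G u) \<le> M * ip u u, the squared norm of
          G u - M h is at most M * (M - ip u u), which tends to 0.\<close>
        have "ip (G ?u) ?h = ip ?u ?u" using G_symmetric[OF Ua(1) oa[OF H(1)]] by (simp add: U_def)
        then have "ip ?d ?d = ip (G ?u) (G ?u) - 2 * M * ip ?u ?u + M\<^sup>2"
          using ip_square_lincomb[OF c, of "- M"] H(2) by simp
        also have "\<dots> \<le> M * (M - ip ?u ?u)" using scale[OF Uo, of "k n"] by (simp add: power2_eq_square algebra_simps)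
        finally have "pi * ip ?d ?d \<le> pi * (M * (M - ip ?u ?u))" by (intro mult_left_mono) auto
        then have "(L1 ?d)\<^sup>2 \<le> pi * (M * (M - ip ?u ?u))" using L1_square_le[OF cd] by linarith
        then have a: "L1 ?d \<le> sqrt (pi * (M * (M - ip ?u ?u)))" by (rule real_le_rsqrt)
        \<comment> \<open>A further application of G converts the mean-square estimate into a
          pointwise one; here G h is u.\<close>
        have b: "\<bar>1 * G (G ?u) x + (- M) * G ?h x\<bar> \<le> C * L1 ?d" by (rule C(4)[OF Ua(2) oa[OF H(1)] x])
        have "norm (G (G ?u) x - M * ?u x) = \<bar>1 * G (G ?u) x + (- M) * G ?h x\<bar>" by (simp add: U_def)
        also have "\<dots> \<le> C * sqrt (pi * (M * (M - ip ?u ?u)))"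
          using order_trans[OF b mult_left_mono[OF a]] C(1) by simp
        finally show "norm (G (G ?u) x - M * ?u x) \<le> C * sqrt (pi * (M * (M - ip ?u ?u)))" .
      qed
      have "(\<lambda>n. C * sqrt (pi * (M * (M - ip (U (k n)) (U (k n)))))) \<longlonglongrightarrow> C * sqrt (pi * (M * (M - M)))"
        by (intro tendsto_intros tlim)
      then show "(\<lambda>n. C * sqrt (pi * (M * (M - ip (U (k n)) (U (k n)))))) \<longlonglongrightarrow> 0" by simp
    qed
    have "(\<lambda>n. M * U (k n) x) \<longlonglongrightarrow> M * g x"
      using tendsto_uniform_limitI[OF ul x] by (intro tendsto_intros)
    from tendsto_add[OF tendsto_diff[OF lim2 lim1] this] have "(\<lambda>n. G (G g) x) \<longlonglongrightarrow> M * g x" by simp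
    then show ?thesis by (simp add: LIMSEQ_const_iff)
  qed
  define s where "s = sqrt M"
  have s: "s > 0" "s * s = M" using \<open>M > 0\<close> by (auto simp: s_def)
  obtain g1 where b1: "bvp g (G g) g1" using G[OF oa[OF go]] by blast
  obtain g2 where b2: "bvp (G g) (G (G g)) g2" using G[OF oa[OF G_ortho[OF go]]] by blast
  \<comment> \<open>G^2 - M factors as (G - s)(G + s): w = G g + s g satisfies G w = s w and must
    vanish, whereupon g itself is an eigenvector for - s.\<close>
  let ?w = "\<lambda>t. 1 * G g t + s * g t"
  have "?w t = 0" if t: "t \<in> {0..pi}" for t
  proof (rule ortho_no_eigenfunction[OF ortho_lincomb[OF G_ortho[OF go] go] _ bvp_lincomb[OF b2 b1] _ t])
    show "s \<noteq> 0" using s by simp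
    show "1 * G (G g) t + s * G g t = s * (1 * G g t + s * g t)" if "t \<in> {0..pi}" for t
      using GGg[OF that] s(2) by (simp add: algebra_simps)
  qed
  then have "G g t = - s * g t" if "t \<in> {0..pi}" for t using that by (simp add: eq_neg_iff_add_eq_0)
  then have "g t = 0" if "t \<in> {0..pi}" for t
    using ortho_no_eigenfunction[OF go _ b1, of "- s"] s that by simp
  then have "ip g g = ip (\<lambda>_. 0) (\<lambda>_. 0)" by (intro ip_cong) auto
  then show False using ipg \<open>M > 0\<close> by (simp add: ip_def)
qed

end

context sturm_liouville
begin

text \<open>Applying the resolvent first smooths h: G h is continuous and still orthogonal to all
  eigenfunctions, hence zero. Continuity of h cannot be assumed, since it will be f - g, which may
  jump at pi.\<close>

theorem eigenfunctions_complete: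
  assumes h: "h absolutely_integrable_on {0..pi}" and o: "\<And>\<mu>. \<mu> \<in> ev \<Longrightarrow> ip h (Phi \<mu>) = 0" and x: "x \<in> {0..pi}"
  shows "integral {0..x} h = 0"
proof -
  have "infinite {0..1::real}" by (simp add: infinite_Icc)
  then have "\<not> {0..1} \<subseteq> ev \<inter> {- 1..1}" using finite_ev_bounded[of 1] finite_subset by blast
  then obtain \<mu>0 where "\<mu>0 \<notin> ev" by fastforce
  then interpret sl_resolvent q \<alpha> \<mu>0 by unfold_locales
  obtain u' where u': "bvp h (G h) u'" using G[OF h] by blast
  have "G h \<in> ortho" using G_continuous[OF h] bvp_orthogonal[OF h u'] o by (simp add: ortho_def)
  then show ?thesis by (intro G_eq_0_imp_integral_0[OF h _ x] ortho_trivial)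
qed

end

section \<open>Trigonometric sums\<close>

text \<open>Abel's inequality: after summation by parts the weight differences are non-negative and
  telescope to w p - w m.\<close>

lemma dirichlet_abel_bound:
  fixes w s :: "nat \<Rightarrow> real"
  assumes w: "\<And>k. 0 \<le> w k" "\<And>k. w (Suc k) \<le> w k" and s: "\<And>m. p \<le> m \<Longrightarrow> \<bar>\<Sum>k\<in>{p..<m}. s k\<bar> \<le> B" and "p \<le> m"
  shows "\<bar>\<Sum>k\<in>{p..<m}. w k * s k\<bar> \<le> w p * B"
proof -
  define S where "S m = (\<Sum>k\<in>{p..<m}. s k)" for m
  have eq: "(\<Sum>k\<in>{p..<m}. w k * s k) = w m * S m + (\<Sum>k\<in>{p..<m}. (w k - w (Suc k)) * S (Suc k))"
    using \<open>p \<le> m\<close>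
  proof (induction m rule: dec_induct)
    case (step m)
    then have "S (Suc m) = S m + s m" by (simp add: S_def)
    then show ?case using step by (simp add: algebra_simps)
  qed (simp add: S_def)
  have "\<bar>\<Sum>k\<in>{p..<m}. (w k - w (Suc k)) * S (Suc k)\<bar> \<le> (\<Sum>k\<in>{p..<m}. (w k - w (Suc k)) * B)"
  proof (rule order_trans[OF sum_abs sum_mono])
    fix k assume "k \<in> {p..<m}"
    then have "\<bar>S (Suc k)\<bar> \<le> B" unfolding S_def by (intro s) auto
    then show "\<bar>(w k - w (Suc k)) * S (Suc k)\<bar> \<le> (w k - w (Suc k)) * B"
      using w(2)[of k] by (simp add: abs_mult mult_left_mono)
  qed
  also have "\<dots> = (w p - w m) * B"
    using \<open>p \<le> m\<close> by (induction m rule: dec_induct) (simp_all add: algebra_simps)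
  finally have 1: "\<bar>\<Sum>k\<in>{p..<m}. (w k - w (Suc k)) * S (Suc k)\<bar> \<le> (w p - w m) * B" .
  have "\<bar>w m * S m\<bar> \<le> w m * B" using s[OF \<open>p \<le> m\<close>] w(1) by (simp add: S_def abs_mult mult_left_mono)
  then have "\<bar>\<Sum>k\<in>{p..<m}. w k * s k\<bar> \<le> w m * B + (w p - w m) * B" using 1 unfolding eq by linarith
  then show ?thesis by (simp add: algebra_simps)
qed

text \<open>Multiplication by 2 * sin (\<theta> / 2) turns each term into cos (k \<theta>) - cos ((k
  + 1) \<theta>), which telescopes.\<close>

lemma sin_half_integer_sum:
  assumes "p \<le> m"
  shows "2 * sin (\<theta> / 2) * (\<Sum>k\<in>{p..<m}. sin ((real k + 1/2) * \<theta>)) = cos (real p * \<theta>) - cos (real m * \<theta>)"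
  using assms
proof (induction m rule: dec_induct)
  case (step m)
  have "real m * \<theta> = (real m + 1/2) * \<theta> - \<theta> / 2" "real (Suc m) * \<theta> = (real m + 1/2) * \<theta> + \<theta> / 2"
    by (simp_all add: algebra_simps)
  then have "cos (real m * \<theta>) - cos (real (Suc m) * \<theta>) = 2 * sin (\<theta> / 2) * sin ((real m + 1/2) * \<theta>)"
    by (simp add: cos_add cos_diff)
  then show ?case using step by (simp add: distrib_left)
qed simp

definition sinc_sum :: "nat \<Rightarrow> nat \<Rightarrow> real \<Rightarrow> real" where
  "sinc_sum p m \<theta> = (\<Sum>k\<in>{p..<m}. sin ((real k + 1/2) * \<theta>) / (real k + 1/2))"

lemma sinc_sum_tail:
  assumes "p \<le> m" "\<bar>sin (\<theta> / 2)\<bar> \<ge> \<sigma>" "\<sigma> > 0"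
  shows "\<bar>sinc_sum p m \<theta>\<bar> \<le> 1 / ((real p + 1/2) * \<sigma>)"
proof -
  have "\<bar>\<Sum>k\<in>{p..<m}. 1 / (real k + 1/2) * sin ((real k + 1/2) * \<theta>)\<bar> \<le> 1 / (real p + 1/2) * (1 / \<sigma>)"
  proof (rule dirichlet_abel_bound[OF _ _ _ \<open>p \<le> m\<close>])
    fix m assume "p \<le> m"
    let ?S = "\<Sum>k\<in>{p..<m}. sin ((real k + 1/2) * \<theta>)"
    have "2 * (\<sigma> * \<bar>?S\<bar>) \<le> 2 * (\<bar>sin (\<theta> / 2)\<bar> * \<bar>?S\<bar>)" using assms by (intro mult_left_mono mult_right_mono) auto
    also have "\<dots> = \<bar>cos (real p * \<theta>) - cos (real m * \<theta>)\<bar>"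
      unfolding sin_half_integer_sum[OF \<open>p \<le> m\<close>, symmetric] by (simp add: abs_mult)
    also have "\<dots> \<le> 2" using abs_cos_le_one[of "real p * \<theta>"] abs_cos_le_one[of "real m * \<theta>"] by linarith
    finally show "\<bar>?S\<bar> \<le> 1 / \<sigma>" using assms by (simp add: field_simps)
  qed (auto simp: field_simps)
  then show ?thesis by (simp add: sinc_sum_def)
qed

text \<open>Split at k = 1 / theta: below, bound each term by theta; above, sum by parts.\<close>
lemma sinc_sum_bound_0_pi:
  assumes "0 \<le> \<theta>" "\<theta> \<le> pi" "p \<le> m"
  shows "\<bar>sinc_sum p m \<theta>\<bar> \<le> 9"
proof (cases "\<theta> = 0")
  case True
  then show ?thesis by (simp add: sinc_sum_def)
next
  case False
  then have th: "\<theta> > 0" using assms by simp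
  define n where "n = nat \<lceil>1 / \<theta>\<rceil>"
  have n: "real n \<ge> 1 / \<theta>" "real n \<le> 1 / \<theta> + 1"
  proof -
    show "real n \<ge> 1 / \<theta>" unfolding n_def by (rule real_nat_ceiling_ge)
    have "1 / \<theta> > 0" using th by simp
    then have "0 \<le> \<lceil>1 / \<theta>\<rceil>" by linarith
    then show "real n \<le> 1 / \<theta> + 1" unfolding n_def using of_int_ceiling_le_add_one[of "1 / \<theta>"] by simp
  qed
  have low: "\<bar>sinc_sum p m \<theta>\<bar> \<le> 5" if "m \<le> n" for m
  proof -
    have "\<bar>sinc_sum p m \<theta>\<bar> \<le> (\<Sum>k\<in>{p..<m}. \<theta>)"
      unfolding sinc_sum_def
    proof (rule order_trans[OF sum_abs sum_mono])
      fix k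
      have "\<bar>sin ((real k + 1/2) * \<theta>)\<bar> \<le> (real k + 1/2) * \<theta>" using abs_sin_x_le_abs_x[of "(real k + 1/2) * \<theta>"] th by simp
      then show "\<bar>sin ((real k + 1/2) * \<theta>) / (real k + 1/2)\<bar> \<le> \<theta>" by (simp add: abs_divide field_simps)
    qed
    also have "\<dots> = real (m - p) * \<theta>" by simp
    also have "\<dots> \<le> (1 / \<theta> + 1) * \<theta>" using n that th by (intro mult_right_mono) auto
    also have "\<dots> = 1 + \<theta>" using th by (simp add: field_simps)
    also have "\<dots> \<le> 5" using assms pi_less_4 by simp
    finally show ?thesis .
  qed
  have high: "\<bar>sinc_sum p m \<theta>\<bar> \<le> 4" if "n \<le> p" "p \<le> m" for p m
  proof -
    have "\<theta> / 4 \<le> \<bar>sin (\<theta> / 2)\<bar>" using half_le_sin[of "\<theta> / 2"] assms by simp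
    then have "\<bar>sinc_sum p m \<theta>\<bar> \<le> 1 / ((real p + 1/2) * (\<theta> / 4))" using th that by (intro sinc_sum_tail) auto
    also have "\<dots> \<le> 1 / ((1 / \<theta>) * (\<theta> / 4))" using n that th by (intro divide_left_mono mult_right_mono mult_pos_pos) auto
    finally show ?thesis using th by simp
  qed
  \<comment> \<open>A sum crossing the split index n costs 5 from below and 4 from above.\<close>
  consider "m \<le> n" | "n \<le> p" | "p \<le> n" "n \<le> m" by linarith
  then show ?thesis
  proof cases
    case 3
    then have "sinc_sum p m \<theta> = sinc_sum p n \<theta> + sinc_sum n m \<theta>"
      unfolding sinc_sum_def by (simp add: sum.atLeastLessThan_concat)
    then show ?thesis using low[of n] high[of n m] 3 by linarith
  qed (use low[of m] high[of p m] assms in auto)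
qed

lemma sinc_sum_minus: "sinc_sum p m (- \<theta>) = - sinc_sum p m \<theta>"
  by (simp add: sinc_sum_def sum_negf)

text \<open>Half-integer frequencies make the sum symmetric about pi, which carries the bound on
  [0,pi] over to the arguments s + x up to 2 pi.\<close>

lemma sinc_sum_reflect: "sinc_sum p m (2 * pi - \<theta>) = sinc_sum p m \<theta>"
proof -
  have "sin ((real k + 1/2) * (2 * pi - \<theta>)) = sin ((real k + 1/2) * \<theta>)" for k
  proof -
    have e: "(real k + 1/2) * (2 * pi - \<theta>) = real (2 * k + 1) * pi - (real k + 1/2) * \<theta>" by (simp add: algebra_simps)
    have "cos (real (2 * k + 1) * pi) = -1" unfolding cos_npi by simp
    then show ?thesis unfolding e sin_diff sin_npi by simp
  qed
  then show ?thesis by (simp add: sinc_sum_def)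
qed

lemma sinc_sum_bound:
  assumes "- pi \<le> \<theta>" "\<theta> \<le> 2 * pi" "p \<le> m"
  shows "\<bar>sinc_sum p m \<theta>\<bar> \<le> 9"
proof -
  consider "\<theta> \<le> 0" | "0 \<le> \<theta>" "\<theta> \<le> pi" | "pi \<le> \<theta>" by linarith
  then show ?thesis
  proof cases
    case 1 then show ?thesis using sinc_sum_bound_0_pi[of "- \<theta>"] assms by (simp add: sinc_sum_minus)
  next
    case 2 then show ?thesis using sinc_sum_bound_0_pi assms by simp
  next
    case 3 then show ?thesis using sinc_sum_bound_0_pi[of "2 * pi - \<theta>"] assms by (simp add: sinc_sum_reflect)
  qed
qed

text \<open>A window of the sums E for the model problem q = 0, \<alpha> = pi/2, with eigenfunctions
  cos ((k + 1/2) x) of squared norm pi/2.\<close>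

definition cs_sum :: "nat \<Rightarrow> nat \<Rightarrow> real \<Rightarrow> real \<Rightarrow> real" where
  "cs_sum p m x s = (\<Sum>k\<in>{p..<m}. 2 / pi * (cos ((real k + 1/2) * x) * sin ((real k + 1/2) * s) / (real k + 1/2)))"

lemma cs_sum_eq: "cs_sum p m x s = (sinc_sum p m (s + x) + sinc_sum p m (s - x)) / pi"
proof -
  have "2 / pi * (cos (r * x) * sin (r * s) / r) = (sin (r * (s + x)) / r + sin (r * (s - x)) / r) / pi" for r :: real
    by (simp add: distrib_left right_diff_distrib sin_add sin_diff add_divide_distrib[symmetric])
  then show ?thesis unfolding cs_sum_def sinc_sum_def by (simp only: sum.distrib sum_divide_distrib[symmetric])
qed

lemma cs_sum_bound:
  assumes "x \<in> {0..pi}" "s \<in> {0..pi}" "p \<le> m"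
  shows "\<bar>cs_sum p m x s\<bar> \<le> 18"
proof -
  have "\<bar>sinc_sum p m (s + x)\<bar> \<le> 9" "\<bar>sinc_sum p m (s - x)\<bar> \<le> 9" using assms by (auto intro!: sinc_sum_bound)
  then have "\<bar>cs_sum p m x s\<bar> \<le> 18 / pi" unfolding cs_sum_eq abs_divide by (simp add: divide_right_mono)
  also have "\<dots> \<le> 18 / 1" using pi_ge_two by (intro divide_left_mono) auto
  finally show ?thesis by simp
qed

text \<open>Both half-angle sines must stay away from 0. For s - x this is the distance d. The
  argument s + x is at least d, and it could approach 2 pi only with x near pi, which x \<le> b and
  d \<le> pi - b exclude. This is where b < pi enters.\<close>

lemma cs_sum_tail:
  assumes x: "0 \<le> x" "x \<le> b" "b < pi" and s: "s \<in> {0..pi}" and d: "0 < d" "d \<le> \<bar>s - x\<bar>" "d \<le> pi - b" and "p \<le> m"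
  shows "\<bar>cs_sum p m x s\<bar> \<le> 4 / ((real p + 1/2) * d)"
proof -
  have 1: "d / 4 \<le> \<bar>sin ((s - x) / 2)\<bar>" 
  proof -
    have "\<bar>s - x\<bar> \<le> pi" using x s by auto
    then show ?thesis using half_abs_le_abs_sin[of "(s - x) / 2"] d by auto
  qed
  have 2: "d / 4 \<le> \<bar>sin ((s + x) / 2)\<bar>"
  proof (cases "s + x \<le> pi")
    case True
    then show ?thesis using half_le_sin[of "(s + x) / 2"] x s d by auto
  next
    case False
    have "sin (pi - (s + x) / 2) = sin ((s + x) / 2)" by (simp add: sin_diff)
    moreover have "s \<le> pi" using s by simp
    then have "d / 2 \<le> pi - (s + x) / 2" using x d(3) by argo
    moreover have "(pi - (s + x) / 2) / 2 \<le> sin (pi - (s + x) / 2)" using False x s by (intro half_le_sin) auto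
    ultimately show ?thesis using abs_ge_self[of "sin ((s + x) / 2)"] by argo
  qed
  have "\<bar>sinc_sum p m (s + x)\<bar> \<le> 1 / ((real p + 1/2) * (d / 4))" "\<bar>sinc_sum p m (s - x)\<bar> \<le> 1 / ((real p + 1/2) * (d / 4))"
    using sinc_sum_tail[OF \<open>p \<le> m\<close> 2] sinc_sum_tail[OF \<open>p \<le> m\<close> 1] d by simp_all
  then have "\<bar>sinc_sum p m (s + x) + sinc_sum p m (s - x)\<bar> \<le> 2 * (4 / ((real p + 1/2) * d))" by simp
  then have "\<bar>cs_sum p m x s\<bar> \<le> 2 * (4 / ((real p + 1/2) * d)) / pi"
    unfolding cs_sum_eq abs_divide abs_of_nonneg[OF pi_ge_zero] by (rule divide_right_mono) simp
  also have "\<dots> \<le> 2 * (4 / ((real p + 1/2) * d)) / 2" using d pi_ge_two by (intro divide_left_mono) auto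
  finally show ?thesis by (simp add: mult.commute)
qed

text \<open>Comparison with the telescoping differences 1 / (k - 1) - 1 / k; m0 \<ge> 2 keeps the
  denominators positive.\<close>

lemma inverse_squares_tail:
  assumes "m0 \<ge> 2" "p \<le> q"
  shows "(\<Sum>j\<in>{p..<q}. 1 / (real (m0 + j))\<^sup>2) \<le> 1 / (real (m0 + p) - 1)"
proof -
  have "(\<Sum>j\<in>{p..<q}. 1 / (real (m0 + j))\<^sup>2) \<le> 1 / (real (m0 + p) - 1) - 1 / (real (m0 + q) - 1)"
    using \<open>p \<le> q\<close>
  proof (induction q rule: dec_induct)
    case (step q)
    have m: "real (m0 + q) \<ge> 2" using assms by simp
    have "1 / (real (m0 + q))\<^sup>2 \<le> 1 / ((real (m0 + q) - 1) * real (m0 + q))"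
      unfolding power2_eq_square using m by (intro divide_left_mono mult_right_mono mult_pos_pos) auto
    also have "\<dots> = 1 / (real (m0 + q) - 1) - 1 / real (m0 + q)" using m by (simp add: field_simps)
    finally show ?case using step by simp
  qed simp
  also have "\<dots> \<le> 1 / (real (m0 + p) - 1)" using assms by simp
  finally show ?thesis .
qed

section \<open>Comparison of the eigenfunction sums with the model sums\<close>

context sturm_liouville
begin

definition lam where "lam n = sl_eigenvalue q \<alpha> 0 n"

lemma lam_ev: "lam n \<in> ev" and lam_inj: "lam n = lam m \<longleftrightarrow> n = m" and lam_range: "\<mu> \<in> ev \<Longrightarrow> \<exists>n. \<mu> = lam n"
  using sl_eigenvalue_in_ev sl_eigenvalue_inj sl_eigenvalue_range by (auto simp: lam_def dest: injD)

text \<open>The n-th term at x in the expansion of the indicator function of [0,s].\<close>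

definition kern where "kern n x s = Phi (lam n) x * integral {0..s} (Phi (lam n)) / ip (Phi (lam n)) (Phi (lam n))"

text \<open>Eigenvalue indices and half-integers differ by a fixed shift, so p and q count from n0
  and m0 and the windows pair term by term. The errors of order 1/m^2 then add up to a tail.\<close>

lemma kern_sum_approx:
  obtains n0 m0 :: nat and C where "C \<ge> 0" "m0 \<ge> 2"
    "\<And>(p::nat) (q::nat) x s. p \<le> q \<Longrightarrow> x \<in> {0..pi} \<Longrightarrow> s \<in> {0..pi} \<Longrightarrow>
      \<bar>(\<Sum>n\<in>{n0 + p..<n0 + q}. kern n x s) - cs_sum (m0 + p) (m0 + q) x s\<bar> \<le> C / (real (m0 + p) - 1)"
proof -
  obtain C R where C: "C \<ge> 0" "\<And>m \<rho> x s. near_ev m \<rho> \<Longrightarrow> real m > R \<Longrightarrow> x \<in> {0..pi} \<Longrightarrow> s \<in> {0..pi} \<Longrightarrow>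
      \<bar>Phi (\<rho>\<^sup>2) x * integral {0..s} (Phi (\<rho>\<^sup>2)) / ip (Phi (\<rho>\<^sup>2)) (Phi (\<rho>\<^sup>2))
        - 2 / pi * (cos ((real m + 1/2) * x) * sin ((real m + 1/2) * s) / (real m + 1/2))\<bar> \<le> C / (real m)\<^sup>2"
    by (rule eigenfunction_term_asymptotics) (rule that; assumption)
  obtain n0 m0 :: nat and \<rho> where m0: "real m0 > max R 2" "\<And>j. near_ev (m0 + j) (\<rho> j)"
    "\<And>j. sl_eigenvalue q \<alpha> 0 (n0 + j) = (\<rho> j)\<^sup>2" 
    by (rule eigenvalue_asymptotics[of "max R 2"]) (rule that; assumption)
  show thesis
  proof (rule that[OF C(1), of m0 n0])
    show m2: "m0 \<ge> 2" using m0(1) by simp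
    fix p q :: nat and x s assume "p \<le> q" and x: "x \<in> {0..pi}" and s: "s \<in> {0..pi}"
    let ?c = "\<lambda>k. 2 / pi * (cos ((real k + 1/2) * x) * sin ((real k + 1/2) * s) / (real k + 1/2))"
    have "(\<Sum>n\<in>{n0 + p..<n0 + q}. kern n x s) = (\<Sum>j\<in>{p..<q}. kern (n0 + j) x s)"
      using sum.shift_bounds_nat_ivl[of "\<lambda>n. kern n x s" p n0 q] by (simp add: add.commute)
    moreover have "cs_sum (m0 + p) (m0 + q) x s = (\<Sum>j\<in>{p..<q}. ?c (m0 + j))"
      unfolding cs_sum_def using sum.shift_bounds_nat_ivl[of ?c p m0 q] by (simp add: add.commute)
    ultimately have eq: "(\<Sum>n\<in>{n0 + p..<n0 + q}. kern n x s) - cs_sum (m0 + p) (m0 + q) x s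
        = (\<Sum>j\<in>{p..<q}. kern (n0 + j) x s - ?c (m0 + j))" by (simp add: sum_subtractf)
    have "\<bar>\<Sum>j\<in>{p..<q}. kern (n0 + j) x s - ?c (m0 + j)\<bar> \<le> (\<Sum>j\<in>{p..<q}. C * (1 / (real (m0 + j))\<^sup>2))"
    proof (rule order_trans[OF sum_abs sum_mono])
      fix j
      have "real (m0 + j) > R" using m0(1) by simp
      from C(2)[OF m0(2) this x s] show "\<bar>kern (n0 + j) x s - ?c (m0 + j)\<bar> \<le> C * (1 / (real (m0 + j))\<^sup>2)"
        by (simp only: kern_def lam_def m0(3) times_divide_eq_right mult_1_right)
    qed
    also have "\<dots> = C * (\<Sum>j\<in>{p..<q}. 1 / (real (m0 + j))\<^sup>2)" by (rule sum_distrib_left[symmetric])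
    also have "\<dots> \<le> C * (1 / (real (m0 + p) - 1))" using C(1) inverse_squares_tail[OF m2 \<open>p \<le> q\<close>] by (intro mult_left_mono)
    finally show "\<bar>(\<Sum>n\<in>{n0 + p..<n0 + q}. kern n x s) - cs_sum (m0 + p) (m0 + q) x s\<bar> \<le> C / (real (m0 + p) - 1)"
      unfolding eq by simp
  qed
qed

text \<open>A crude bound for the finitely many initial terms that the asymptotics do not
  reach.\<close>

lemma kern_bounded: "\<exists>B. \<forall>x\<in>{0..pi}. \<forall>s\<in>{0..pi}. \<bar>kern n x s\<bar> \<le> B"
proof -
  obtain K where K: "\<And>x. x \<in> {0..pi} \<Longrightarrow> \<bar>Phi (lam n) x\<bar> \<le> K" using Phi_bounded[of "\<bar>lam n\<bar>"] by blast
  have K0: "K \<ge> 0" using K[of 0] by simp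
  have "\<bar>kern n x s\<bar> \<le> K * (K * pi) / ip (Phi (lam n)) (Phi (lam n))" if x: "x \<in> {0..pi}" and s: "s \<in> {0..pi}" for x s
  proof -
    have "\<bar>integral {0..s} (Phi (lam n))\<bar> \<le> integral {0..s} (\<lambda>_. K)"
      using K s by (intro abs_integral_le integrable_continuous_real continuous_on_subset[OF Phi_continuous]) auto
    also have "\<dots> \<le> K * pi" using s K0 by (simp add: mult.commute mult_left_mono)
    finally have "\<bar>Phi (lam n) x * integral {0..s} (Phi (lam n))\<bar> \<le> K * (K * pi)"
      unfolding abs_mult using K[OF x] K0 by (intro mult_mono) auto
    then show ?thesis using Phi_norm_pos[of "lam n"] by (simp add: kern_def abs_divide divide_right_mono)
  qed
  then show ?thesis by blast
qed

lemma kern_sum_bounded: "\<exists>B\<ge>0. \<forall>N x s. x \<in> {0..pi} \<longrightarrow> s \<in> {0..pi} \<longrightarrow> \<bar>\<Sum>n<N. kern n x s\<bar> \<le> B"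
proof -
  obtain n0 m0 :: nat and C where C: "C \<ge> 0" "m0 \<ge> 2" "\<And>(p::nat) (q::nat) x s. p \<le> q \<Longrightarrow> x \<in> {0..pi} \<Longrightarrow> s \<in> {0..pi} \<Longrightarrow>
      \<bar>(\<Sum>n\<in>{n0 + p..<n0 + q}. kern n x s) - cs_sum (m0 + p) (m0 + q) x s\<bar> \<le> C / (real (m0 + p) - 1)"
    by (rule kern_sum_approx) (rule that; assumption)
  obtain B where B: "\<And>n x s. x \<in> {0..pi} \<Longrightarrow> s \<in> {0..pi} \<Longrightarrow> \<bar>kern n x s\<bar> \<le> B n" using kern_bounded by metis
  have B0: "B n \<ge> 0" for n using B[of 0 0 n] by (meson abs_ge_zero atLeastAtMost_iff order_refl order_trans pi_ge_zero)
  have low: "\<bar>\<Sum>n<N. kern n x s\<bar> \<le> (\<Sum>n<n0. B n)" if "N \<le> n0" "x \<in> {0..pi}" "s \<in> {0..pi}" for N x s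
  proof -
    have "\<bar>\<Sum>n<N. kern n x s\<bar> \<le> (\<Sum>n<N. B n)" using B that by (intro order_trans[OF sum_abs sum_mono]) auto
    also have "\<dots> \<le> (\<Sum>n<n0. B n)" using that B0 by (intro sum_mono2) auto
    finally show ?thesis .
  qed
  have "\<bar>\<Sum>n<N. kern n x s\<bar> \<le> (\<Sum>n<n0. B n) + (18 + C)" if x: "x \<in> {0..pi}" and s: "s \<in> {0..pi}" for N x s
  proof (cases "N \<le> n0")
    case True
    then show ?thesis using low[OF True x s] C(1) by linarith
  next
    case False
    then obtain k where k: "N = n0 + k" using le_Suc_ex[of n0 N] by auto
    have "C / (real (m0 + 0) - 1) \<le> C / 1" using C by (intro divide_left_mono) auto
    then have "\<bar>\<Sum>n\<in>{n0 + 0..<n0 + k}. kern n x s\<bar> \<le> 18 + C"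
      using C(3)[of 0 k x s, OF _ x s] cs_sum_bound[OF x s, of "m0 + 0" "m0 + k"] by linarith
    moreover have "(\<Sum>n<N. kern n x s) = (\<Sum>n<n0. kern n x s) + (\<Sum>n\<in>{n0..<N}. kern n x s)"
      unfolding lessThan_atLeast0 using k by (subst sum.atLeastLessThan_concat) auto
    ultimately show ?thesis using low[OF order_refl x s] k by simp
  qed
  moreover have "(\<Sum>n<n0. B n) + (18 + C) \<ge> 0" using B0 C by (simp add: sum_nonneg)
  ultimately show ?thesis by blast
qed

lemma kern_sum_Cauchy:
  assumes "0 < d" "b < pi" "e > 0"
  shows "\<exists>N. \<forall>P Q x s. N \<le> P \<longrightarrow> P \<le> Q \<longrightarrow> 0 \<le> x \<longrightarrow> x \<le> b \<longrightarrow> s \<in> {0..pi} \<longrightarrow> d \<le> \<bar>s - x\<bar> \<longrightarrow>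
    \<bar>\<Sum>n\<in>{P..<Q}. kern n x s\<bar> \<le> e"
proof -
  obtain n0 m0 :: nat and C where C: "C \<ge> 0" "m0 \<ge> 2" "\<And>(p::nat) (q::nat) x s. p \<le> q \<Longrightarrow> x \<in> {0..pi} \<Longrightarrow> s \<in> {0..pi} \<Longrightarrow>
      \<bar>(\<Sum>n\<in>{n0 + p..<n0 + q}. kern n x s) - cs_sum (m0 + p) (m0 + q) x s\<bar> \<le> C / (real (m0 + p) - 1)"
    by (rule kern_sum_approx) (rule that; assumption)
  define d' where "d' = min d (pi - b)"
  have d': "0 < d'" "d' \<le> d" "d' \<le> pi - b" using assms by (auto simp: d'_def)
  define A where "A = C + 4 / d'"
  have A: "A > 0" unfolding A_def using C d' by (intro add_nonneg_pos) auto
  obtain N0 :: nat where N0: "real N0 > A / e" using reals_Archimedean2 by blast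
  have N0p: "real N0 > 0" using N0 A assms(3) by (meson divide_pos_pos less_trans)
  show ?thesis
  proof (intro exI[of _ "n0 + N0"] allI impI)
    fix P Q x s assume PQ: "n0 + N0 \<le> P" "P \<le> Q" and x: "0 \<le> x" "x \<le> b" and s: "s \<in> {0..pi}" and sx: "d \<le> \<bar>s - x\<bar>"
    obtain p where p: "P = n0 + p" "N0 \<le> p" using PQ le_Suc_ex[of "n0 + N0" P] by (metis add.assoc le_add1)
    obtain r where r: "Q = n0 + r" "p \<le> r" using PQ p le_Suc_ex[of P Q] by (metis add.assoc le_add1)
    have xx: "x \<in> {0..pi}" using x assms by auto
    have "\<bar>cs_sum (m0 + p) (m0 + r) x s\<bar> \<le> 4 / ((real (m0 + p) + 1/2) * d')"
      using d' sx r assms by (intro cs_sum_tail[OF x _ s]) auto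
    also have "\<dots> \<le> 4 / (real N0 * d')" using p d' N0p by (intro divide_left_mono mult_right_mono mult_pos_pos) auto
    finally have 1: "\<bar>cs_sum (m0 + p) (m0 + r) x s\<bar> \<le> 4 / d' / N0" by (simp add: mult.commute)
    have 2: "C / (real (m0 + p) - 1) \<le> C / N0" using p C N0p by (intro divide_left_mono) auto
    have "\<bar>\<Sum>n\<in>{P..<Q}. kern n x s\<bar> \<le> C / N0 + 4 / d' / N0"
      using C(3)[OF r(2) xx s] 1 2 unfolding p(1) r(1) by linarith
    also have "\<dots> = A / N0" by (simp add: A_def add_divide_distrib)
    also have "\<dots> \<le> e" using N0 N0p assms(3) by (simp add: field_simps)
    finally show "\<bar>\<Sum>n\<in>{P..<Q}. kern n x s\<bar> \<le> e" .
  qed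
qed

end

section \<open>Integrals against absolutely continuous functions\<close>

lemma abs_cont_onD_subdivision:
  assumes f: "abs_cont_on S f" and "\<epsilon> > 0"
  obtains \<delta> where "\<delta> > 0"
    "\<And>(t::nat \<Rightarrow> real) n. (\<And>k. k \<le> n \<Longrightarrow> t k \<in> S) \<Longrightarrow> (\<And>k. k < n \<Longrightarrow> t k \<le> t (Suc k)) \<Longrightarrow> t n - t 0 < \<delta> \<Longrightarrow>
       (\<Sum>k<n. \<bar>f (t (Suc k)) - f (t k)\<bar>) < \<epsilon>"
proof -
  obtain \<delta> where \<delta>: "\<delta> > 0" "\<And>(n::nat) (a::nat \<Rightarrow> real) b. ((\<forall>k<n. a k \<in> S \<and> b k \<in> S \<and> a k \<le> b k) \<and> (\<forall>k. Suc k < n \<longrightarrow> b k \<le> a (Suc k))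
          \<and> (\<Sum>k<n. b k - a k) < \<delta>) \<Longrightarrow> (\<Sum>k<n. \<bar>f (b k) - f (a k)\<bar>) < \<epsilon>"
    using assms unfolding abs_cont_on_def by blast
  show thesis
  proof (rule that[OF \<delta>(1)])
    fix t :: "nat \<Rightarrow> real" and n assume t: "\<And>k. k \<le> n \<Longrightarrow> t k \<in> S" "\<And>k. k < n \<Longrightarrow> t k \<le> t (Suc k)" "t n - t 0 < \<delta>"
    have "(\<Sum>k<n. t (Suc k) - t k) = t n - t 0" by (rule sum_lessThan_telescope)
    then show "(\<Sum>k<n. \<bar>f (t (Suc k)) - f (t k)\<bar>) < \<epsilon>" using t by (intro \<delta>(2)) auto
  qed
qed

lemma abs_cont_on_continuous:
  assumes "abs_cont_on S f"
  shows "continuous_on S f"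
  unfolding continuous_on_iff
proof (intro ballI allI impI)
  fix x e :: real assume x: "x \<in> S" and "e > 0"
  obtain \<delta> where \<delta>: "\<delta> > 0"
    "\<And>(t::nat \<Rightarrow> real) n. (\<And>k. k \<le> n \<Longrightarrow> t k \<in> S) \<Longrightarrow> (\<And>k. k < n \<Longrightarrow> t k \<le> t (Suc k)) \<Longrightarrow> t n - t 0 < \<delta> \<Longrightarrow>
       (\<Sum>k<n. \<bar>f (t (Suc k)) - f (t k)\<bar>) < e"
    using abs_cont_onD_subdivision[OF assms \<open>e > 0\<close>] by blast
  have *: "\<bar>f v - f u\<bar> < e" if "u \<in> S" "v \<in> S" "u \<le> v" "v - u < \<delta>" for u v
    using \<delta>(2)[of 1 "\<lambda>k. if k = 0 then u else v"] that by simp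
  show "\<exists>d>0. \<forall>x'\<in>S. dist x' x < d \<longrightarrow> dist (f x') (f x) < e"
  proof (intro exI[of _ \<delta>] conjI ballI impI \<delta>(1))
    fix y assume y: "y \<in> S" "dist y x < \<delta>"
    show "dist (f y) (f x) < e"
      using *[of x y] *[of y x] x y by (cases "x \<le> y") (auto simp: dist_real_def abs_minus_commute)
  qed
qed

text \<open>A block of length d containing a point at distance less than d from x has index within 1
  of the floor of x / d.\<close>

lemma card_near_blocks:
  fixes x d :: real
  assumes d: "d > 0" and near: "\<And>i. i \<in> I \<Longrightarrow> \<exists>t. real i * d \<le> t \<and> t \<le> (real i + 1) * d \<and> \<bar>t - x\<bar> < d"
  shows "card I \<le> 3"
proof -
  define m where "m = \<lfloor>x / d\<rfloor>"
  have "int ` I \<subseteq> {m - 1..m + 1}"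
  proof
    fix z assume "z \<in> int ` I"
    then obtain i where i: "z = int i" "i \<in> I" by blast
    obtain t where t: "real i * d \<le> t" "t \<le> (real i + 1) * d" "\<bar>t - x\<bar> < d" using near[OF i(2)] by blast
    have "real i * d < x + d" using t by argo
    then have 1: "real i < x / d + 1" using d by (simp add: field_simps)
    have "x - d < (real i + 1) * d" using t by argo
    then have "x / d - 1 < real i + 1" using d by (simp add: field_simps)
    then show "z \<in> {m - 1..m + 1}" using 1 unfolding i m_def by (auto; linarith)
  qed
  then have "card (int ` I) \<le> card {m - 1..m + 1}" by (intro card_mono) auto
  moreover have "card (int ` I) = card I" by (intro card_image) simp
  ultimately show ?thesis by simp
qed

text \<open>Summation by parts over the subdivision turns the integral into a sum of increments of f weighted by
  values of the primitive E; only boundedly many blocks of a fixed coarse subdivision lie near x.\<close>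
lemma abs_cont_integral_bound:
  assumes f: "abs_cont_on {0..pi} f" and \<epsilon>: "\<epsilon> > 0"
  shows "\<exists>\<delta> V. \<delta> > 0 \<and> V \<ge> 0 \<and> (\<forall>D x B \<eta>. continuous_on {0..pi} D \<longrightarrow>
      (\<forall>s\<in>{0..pi}. \<bar>integral {0..s} D\<bar> \<le> B) \<longrightarrow>
      (\<forall>s\<in>{0..pi}. \<delta> \<le> \<bar>s - x\<bar> \<longrightarrow> \<bar>integral {0..s} D\<bar> \<le> \<eta>) \<longrightarrow> \<bar>integral {0..pi} D\<bar> \<le> \<eta> \<longrightarrow>
      \<bar>integral {0..pi} (\<lambda>t. f t * D t)\<bar> \<le> V * \<eta> + \<epsilon> * B)"
proof -
  obtain \<gamma> where \<gamma>: "\<gamma> > 0"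
    "\<And>(t::nat \<Rightarrow> real) n. (\<And>k. k \<le> n \<Longrightarrow> t k \<in> {0..pi}) \<Longrightarrow> (\<And>k. k < n \<Longrightarrow> t k \<le> t (Suc k)) \<Longrightarrow> t n - t 0 < \<gamma> \<Longrightarrow>
       (\<Sum>k<n. \<bar>f (t (Suc k)) - f (t k)\<bar>) < \<epsilon> / 3"
    using abs_cont_onD_subdivision[OF f, of "\<epsilon> / 3"] \<epsilon> by auto
  obtain K :: nat where K: "pi / \<gamma> < real K" using reals_Archimedean2 by blast
  have "pi / \<gamma> > 0" using \<gamma> by simp
  then have K0: "K > 0" using K by (metis less_trans of_nat_0_less_iff)
  \<comment> \<open>Blocks of length d < \<gamma> carry variation at most \<epsilon> / 3 each, so
    the at most three blocks near x contribute at most \<epsilon> * B.\<close>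
  define d where "d = pi / K"
  have d: "d > 0" "d < \<gamma>" using K K0 \<gamma> by (auto simp: d_def field_simps)
  \<comment> \<open>The boundary value at pi plus a bound for the total variation of f, the factors
    that meet \<eta>.\<close>
  define V where "V = \<bar>f pi\<bar> + K * (\<epsilon> / 3)"
  have fc: "continuous_on {0..pi} f" using f by (rule abs_cont_on_continuous)
  show ?thesis
  proof (rule exI[of _ d], rule exI[of _ V], intro conjI allI impI)
    show "d > 0" by (rule d(1))
    show "V \<ge> 0" using \<epsilon> by (simp add: V_def)
    fix D :: "real \<Rightarrow> real" and x B \<eta>
    assume D: "continuous_on {0..pi} D" and B': "\<forall>s\<in>{0..pi}. \<bar>integral {0..s} D\<bar> \<le> B"
      and \<eta>': "\<forall>s\<in>{0..pi}. d \<le> \<bar>s - x\<bar> \<longrightarrow> \<bar>integral {0..s} D\<bar> \<le> \<eta>" and \<eta>pi: "\<bar>integral {0..pi} D\<bar> \<le> \<eta>"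
    note B = B'[rule_format] and \<eta> = \<eta>'[rule_format]
    define E where "E s = integral {0..s} D" for s
    have Di: "D integrable_on {0..pi}" "(\<lambda>t. \<bar>D t\<bar>) integrable_on {0..pi}" "(\<lambda>t. f t * D t) integrable_on {0..pi}"
      using D fc by (auto intro!: integrable_continuous_real continuous_intros)
    have B0: "B \<ge> 0" using B[of 0] by simp
    have \<eta>0: "\<eta> \<ge> 0" using \<eta>pi by (meson abs_ge_zero order_trans)
    define MD where "MD = integral {0..pi} (\<lambda>t. \<bar>D t\<bar>)"
    have MD: "MD \<ge> 0" unfolding MD_def using Di by (intro integral_nonneg) auto
    have "\<bar>integral {0..pi} (\<lambda>t. f t * D t)\<bar> \<le> V * \<eta> + \<epsilon> * B + e" if e: "e > 0" for e
    proof -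
      have "uniformly_continuous_on {0..pi} f" using fc compact_uniformly_continuous by blast
      moreover have "e / (MD + 1) > 0" using e MD by simp
      ultimately obtain h where h: "h > 0" "\<And>s t. s \<in> {0..pi} \<Longrightarrow> t \<in> {0..pi} \<Longrightarrow> dist t s < h \<Longrightarrow> dist (f t) (f s) < e / (MD + 1)"
        unfolding uniformly_continuous_on_def by metis
      \<comment> \<open>Each coarse block is refined into L pieces to make the Riemann-Stieltjes
        error at most e. L may depend on D, whereas d and V do not; this keeps the estimate uniform
        over all partial sums.\<close>
      obtain L :: nat where L: "d / h < real L" using reals_Archimedean2 by blast
      have "d / h > 0" using d h by simp
      then have L0: "L > 0" using L by (metis less_trans of_nat_0_less_iff)
      define t where "t j = real j * (d / L)" for j :: nat
      let ?n = "K * L"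
      have t0: "t 0 = 0" and tn: "t ?n = pi" using K0 L0 by (auto simp: t_def d_def)
      have tS: "t (Suc j) - t j = d / L" for j by (simp add: t_def add_divide_distrib distrib_right)
      have mesh: "d / L < h" "d / L > 0" using L L0 h d by (auto simp: field_simps)
      have tle: "t j \<le> t (Suc j)" for j using tS[of j] mesh by linarith
      have tmono: "mono t" using tle by (simp add: mono_iff_le_Suc)
      have tin: "t j \<in> {0..pi}" if "j \<le> ?n" for j
        using monoD[OF tmono, of 0 j] monoD[OF tmono that] t0 tn by auto
      have tL: "t (i * L) = real i * d" for i using L0 by (simp add: t_def)
      have split: "integral {0..t m} g = (\<Sum>j<m. integral {t j..t (Suc j)} g)" if "g integrable_on {0..pi}" "m \<le> ?n"
        for g :: "real \<Rightarrow> real" and m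
        using that(2)
      proof (induction m)
        case 0 then show ?case by (simp add: t0)
      next
        case (Suc m)
        have "integral {0..t (Suc m)} g - integral {0..t m} g = integral {t m..t (Suc m)} g"
          using tin[of m] tin[of "Suc m"] Suc.prems tle by (intro integral_Icc_diff[OF that(1)]) auto
        then show ?case using Suc by simp
      qed
      have sub: "g integrable_on {t j..t (Suc j)}" if "g integrable_on {0..pi}" "j < ?n" for g :: "real \<Rightarrow> real" and j
        using tin[of j] tin[of "Suc j"] that(2) by (intro integrable_on_subinterval[OF that(1)]) auto
      define R where "R = (\<Sum>j<?n. f (t (Suc j)) * (E (t (Suc j)) - E (t j)))"
      have Ed: "E (t (Suc j)) - E (t j) = integral {t j..t (Suc j)} D" if "j < ?n" for j
        unfolding E_def using tin[of j] tin[of "Suc j"] that tle by (intro integral_Icc_diff[OF Di(1)]) auto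
      have "integral {0..pi} (\<lambda>t. f t * D t) - R
          = (\<Sum>j<?n. integral {t j..t (Suc j)} (\<lambda>t. f t * D t) - f (t (Suc j)) * (E (t (Suc j)) - E (t j)))"
        using split[OF Di(3) order_refl] by (simp add: tn R_def sum_subtractf)
      moreover have "\<bar>\<Sum>j<?n. integral {t j..t (Suc j)} (\<lambda>t. f t * D t) - f (t (Suc j)) * (E (t (Suc j)) - E (t j))\<bar>
          \<le> (\<Sum>j<?n. e / (MD + 1) * integral {t j..t (Suc j)} (\<lambda>t. \<bar>D t\<bar>))"
      proof (rule order_trans[OF sum_abs sum_mono])
        fix j assume "j \<in> {..<?n}"
        then have j: "j < ?n" by simp
        have i2: "(\<lambda>u. f (t (Suc j)) * D u) integrable_on {t j..t (Suc j)}" using sub[OF Di(1) j] by (rule integrable_on_mult_right)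
        have "integral {t j..t (Suc j)} (\<lambda>t. f t * D t) - f (t (Suc j)) * (E (t (Suc j)) - E (t j))
            = integral {t j..t (Suc j)} (\<lambda>u. f u * D u - f (t (Suc j)) * D u)"
          unfolding Ed[OF j] integral_diff[OF sub[OF Di(3) j] i2] by simp
        moreover have "\<bar>integral {t j..t (Suc j)} (\<lambda>u. f u * D u - f (t (Suc j)) * D u)\<bar>
            \<le> integral {t j..t (Suc j)} (\<lambda>u. e / (MD + 1) * \<bar>D u\<bar>)"
        proof (rule abs_integral_le)
          show "(\<lambda>u. f u * D u - f (t (Suc j)) * D u) integrable_on {t j..t (Suc j)}"
            by (rule integrable_diff[OF sub[OF Di(3) j] i2])
          show "(\<lambda>u. e / (MD + 1) * \<bar>D u\<bar>) integrable_on {t j..t (Suc j)}"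
            using sub[OF Di(2) j] by (rule integrable_on_mult_right)
          fix u assume u: "u \<in> {t j..t (Suc j)}"
          have "dist (f u) (f (t (Suc j))) < e / (MD + 1)"
            using u tin[of j] tin[of "Suc j"] j tS[of j] mesh by (intro h(2)) (auto simp: dist_real_def)
          then have "\<bar>f u - f (t (Suc j))\<bar> * \<bar>D u\<bar> \<le> e / (MD + 1) * \<bar>D u\<bar>"
            by (intro mult_right_mono) (auto simp: dist_real_def)
          then show "\<bar>f u * D u - f (t (Suc j)) * D u\<bar> \<le> e / (MD + 1) * \<bar>D u\<bar>"
            by (simp add: abs_mult[symmetric] left_diff_distrib)
        qed
        ultimately show "\<bar>integral {t j..t (Suc j)} (\<lambda>t. f t * D t) - f (t (Suc j)) * (E (t (Suc j)) - E (t j))\<bar>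
            \<le> e / (MD + 1) * integral {t j..t (Suc j)} (\<lambda>t. \<bar>D t\<bar>)" by simp
      qed
      moreover have "(\<Sum>j<?n. e / (MD + 1) * integral {t j..t (Suc j)} (\<lambda>t. \<bar>D t\<bar>)) = e / (MD + 1) * MD"
        using split[OF Di(2) order_refl] by (simp add: sum_distrib_left tn MD_def)
      moreover have "e / (MD + 1) * MD \<le> e" using e MD by (simp add: field_simps)
      ultimately have I: "\<bar>integral {0..pi} (\<lambda>t. f t * D t) - R\<bar> \<le> e" by linarith
      have abel: "(\<Sum>j<m. f (t (Suc j)) * (E (t (Suc j)) - E (t j)))
          = f (t m) * E (t m) - (\<Sum>j<m. E (t j) * (f (t (Suc j)) - f (t j)))" for m
        by (induction m) (simp_all add: algebra_simps t0 E_def)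
      define a where "a j = \<bar>E (t j)\<bar> * \<bar>f (t (Suc j)) - f (t j)\<bar>" for j
      have var: "(\<Sum>j\<in>{i * L..<i * L + L}. \<bar>f (t (Suc j)) - f (t j)\<bar>) \<le> \<epsilon> / 3" if i: "i < K" for i
      proof -
        have iL: "i * L + L \<le> ?n" using i by (metis Suc_leI add.commute mult_Suc mult_le_mono1)
        have "(\<Sum>k<L. \<bar>f (t (i * L + Suc k)) - f (t (i * L + k))\<bar>) < \<epsilon> / 3"
        proof (rule \<gamma>(2)[of L "\<lambda>k. t (i * L + k)"])
          show "t (i * L + k) \<in> {0..pi}" if "k \<le> L" for k using that iL by (intro tin) linarith
          show "t (i * L + k) \<le> t (i * L + Suc k)" for k using tle[of "i * L + k"] by simp
          have "t (i * L + L) = (real i + 1) * d" using tL[of "Suc i"] by (simp add: add.commute)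
          then show "t (i * L + L) - t (i * L + 0) < \<gamma>" using tL[of i] d by (simp add: distrib_right)
        qed
        then show ?thesis
          using sum.shift_bounds_nat_ivl[of "\<lambda>j. \<bar>f (t (Suc j)) - f (t j)\<bar>" 0 "i * L" L]
          by (simp add: atLeast0LessThan add.commute)
      qed
      define I where "I = {i. i < K \<and> (\<exists>j\<in>{i * L..<i * L + L}. \<bar>t j - x\<bar> < d)}"
      have fI: "finite I" by (simp add: I_def)
      have cI: "card I \<le> 3"
      proof (rule card_near_blocks[OF d(1)])
        fix i assume "i \<in> I"
        then obtain j where j: "i * L \<le> j" "j < i * L + L" "\<bar>t j - x\<bar> < d" by (auto simp: I_def)
        have "real i * d \<le> t j" using monoD[OF tmono j(1)] tL by simp
        moreover have "t j \<le> (real i + 1) * d" using monoD[OF tmono, of j "Suc i * L"] j(2) tL[of "Suc i"] by (simp add: add.commute)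
        ultimately show "\<exists>t. real i * d \<le> t \<and> t \<le> (real i + 1) * d \<and> \<bar>t - x\<bar> < d" using j(3) by blast
      qed
      have blk: "(\<Sum>j\<in>{i * L..<i * L + L}. a j) \<le> \<eta> * (\<epsilon> / 3) + (if i \<in> I then B * (\<epsilon> / 3) else 0)" if i: "i < K" for i
      proof -
        have iL: "i * L + L \<le> ?n" using i by (metis Suc_leI add.commute mult_Suc mult_le_mono1)
        define C where "C = (if i \<in> I then B else \<eta>)"
        have C0: "C \<ge> 0" using B0 \<eta>0 by (simp add: C_def)
        have "\<bar>E (t j)\<bar> \<le> C" if j: "j \<in> {i * L..<i * L + L}" for j
        proof -
          have jn: "t j \<in> {0..pi}" using j iL by (intro tin) simp
          show ?thesis
          proof (cases "i \<in> I")
            case True then show ?thesis using B[OF jn] by (simp add: C_def E_def)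
          next
            case False
            then have "d \<le> \<bar>t j - x\<bar>" using i j unfolding I_def by force
            then show ?thesis using \<eta>[OF jn] False by (simp add: C_def E_def)
          qed
        qed
        then have "(\<Sum>j\<in>{i * L..<i * L + L}. a j) \<le> (\<Sum>j\<in>{i * L..<i * L + L}. C * \<bar>f (t (Suc j)) - f (t j)\<bar>)"
          unfolding a_def by (intro sum_mono mult_right_mono) auto
        also have "\<dots> \<le> C * (\<epsilon> / 3)" unfolding sum_distrib_left[symmetric] using var[OF i] C0 by (intro mult_left_mono)
        also have "\<dots> \<le> \<eta> * (\<epsilon> / 3) + (if i \<in> I then B * (\<epsilon> / 3) else 0)" using \<eta>0 \<epsilon> by (simp add: C_def)
        finally show ?thesis .
      qed
      have "\<bar>\<Sum>j<?n. E (t j) * (f (t (Suc j)) - f (t j))\<bar> \<le> (\<Sum>j<?n. a j)"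
        unfolding a_def abs_mult[symmetric] by (rule sum_abs)
      also have "\<dots> = (\<Sum>i<K. \<Sum>j\<in>{i * L..<i * L + L}. a j)" by (rule sum.nat_group[symmetric])
      also have "\<dots> \<le> (\<Sum>i<K. \<eta> * (\<epsilon> / 3) + (if i \<in> I then B * (\<epsilon> / 3) else 0))" using blk by (intro sum_mono) auto
      also have "\<dots> = K * (\<eta> * (\<epsilon> / 3)) + (\<Sum>i\<in>{..<K} \<inter> I. B * (\<epsilon> / 3))"
        unfolding sum.distrib sum.inter_restrict[OF finite_lessThan] by simp
      also have "{..<K} \<inter> I = I" by (auto simp: I_def)
      also have "(\<Sum>i\<in>I. B * (\<epsilon> / 3)) = card I * (B * (\<epsilon> / 3))" by simp
      also have "real (card I) * (B * (\<epsilon> / 3)) \<le> 3 * (B * (\<epsilon> / 3))" using cI B0 \<epsilon> by (intro mult_right_mono) auto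
      finally have S: "\<bar>\<Sum>j<?n. E (t j) * (f (t (Suc j)) - f (t j))\<bar> \<le> K * (\<eta> * (\<epsilon> / 3)) + \<epsilon> * B" by (simp add: mult.commute)
      have "\<bar>f pi * E pi\<bar> \<le> \<bar>f pi\<bar> * \<eta>" unfolding abs_mult E_def using \<eta>pi by (intro mult_left_mono) auto
      then have "\<bar>R\<bar> \<le> \<bar>f pi\<bar> * \<eta> + (K * (\<eta> * (\<epsilon> / 3)) + \<epsilon> * B)"
        using S abel[of ?n] unfolding R_def tn by linarith
      also have "\<dots> = V * \<eta> + \<epsilon> * B" by (simp add: V_def algebra_simps)
      finally show ?thesis using I by linarith
    qed
    then show "\<bar>integral {0..pi} (\<lambda>t. f t * D t)\<bar> \<le> V * \<eta> + \<epsilon> * B" by (rule field_le_epsilon)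
  qed
qed

section \<open>Uniform convergence of the expansion\<close>

context sturm_liouville
begin

definition coef where "coef f n = ip f (Phi (lam n)) / ip (Phi (lam n)) (Phi (lam n))"

text \<open>Integral kernel of the partial-sum operator over the index set W; its primitive in t is
  the corresponding sum of \<open>kern\<close>.\<close>

definition kernel where "kernel W x t = (\<Sum>n\<in>W. Phi (lam n) x / ip (Phi (lam n)) (Phi (lam n)) * Phi (lam n) t)"

lemma kernel_continuous: "continuous_on {0..pi} (kernel W x)"
  unfolding kernel_def by (intro continuous_intros Phi_continuous)

lemma kernel_integral:
  assumes "finite W" "s \<in> {0..pi}"
  shows "integral {0..s} (kernel W x) = (\<Sum>n\<in>W. kern n x s)"
proof -
  have i: "(\<lambda>t. C * Phi (lam n) t) integrable_on {0..s}" for n C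
    using assms by (intro integrable_on_mult_right integrable_continuous_real continuous_on_subset[OF Phi_continuous]) auto
  then show ?thesis
    unfolding kernel_def kern_def integral_sum[OF assms(1) i] by simp
qed

lemma kernel_expansion:
  assumes "finite W" "continuous_on {0..pi} f"
  shows "integral {0..pi} (\<lambda>t. f t * kernel W x t) = (\<Sum>n\<in>W. coef f n * Phi (lam n) x)"
proof -
  have i: "(\<lambda>t. C * (f t * Phi (lam n) t)) integrable_on {0..pi}" for n C
    by (rule integrable_on_mult_right[OF ip_integrable_continuous[OF assms(2) Phi_continuous]])
  have "integral {0..pi} (\<lambda>t. f t * kernel W x t)
      = integral {0..pi} (\<lambda>t. \<Sum>n\<in>W. Phi (lam n) x / ip (Phi (lam n)) (Phi (lam n)) * (f t * Phi (lam n) t))"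
    unfolding kernel_def sum_distrib_left by (simp add: mult_ac)
  also have "\<dots> = (\<Sum>n\<in>W. Phi (lam n) x / ip (Phi (lam n)) (Phi (lam n)) * ip f (Phi (lam n)))"
    unfolding integral_sum[OF assms(1) i] by (simp add: ip_def[of f])
  finally show ?thesis by (simp add: coef_def mult.commute)
qed

text \<open>With \<epsilon> = 1 and \<eta> = B the distance from x becomes irrelevant, so the bound
  holds up to x = pi.\<close>

lemma partial_sums_bounded:
  assumes f: "abs_cont_on {0..pi} f"
  shows "\<exists>M. \<forall>N. \<forall>x\<in>{0..pi}. \<bar>\<Sum>n<N. coef f n * Phi (lam n) x\<bar> \<le> M"
proof -
  obtain B where B: "B \<ge> 0" "\<And>N x s. x \<in> {0..pi} \<Longrightarrow> s \<in> {0..pi} \<Longrightarrow> \<bar>\<Sum>n<N. kern n x s\<bar> \<le> B"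
    using kern_sum_bounded by blast
  obtain \<delta> V where V: "\<forall>D x B \<eta>. continuous_on {0..pi} D \<longrightarrow>
      (\<forall>s\<in>{0..pi}. \<bar>integral {0..s} D\<bar> \<le> B) \<longrightarrow>
      (\<forall>s\<in>{0..pi}. \<delta> \<le> \<bar>s - x\<bar> \<longrightarrow> \<bar>integral {0..s} D\<bar> \<le> \<eta>) \<longrightarrow> \<bar>integral {0..pi} D\<bar> \<le> \<eta> \<longrightarrow>
      \<bar>integral {0..pi} (\<lambda>t. f t * D t)\<bar> \<le> V * \<eta> + 1 * B"
    using abs_cont_integral_bound[OF f zero_less_one] by (elim exE conjE)
  have "\<bar>\<Sum>n<N. coef f n * Phi (lam n) x\<bar> \<le> V * B + 1 * B" if x: "x \<in> {0..pi}" for N x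
    unfolding kernel_expansion[OF finite_lessThan abs_cont_on_continuous[OF f], symmetric]
    by (rule V[rule_format, OF kernel_continuous]) (simp_all add: kernel_integral B(2)[OF x])
  then show ?thesis by blast
qed

lemma partial_sums_Cauchy:
  assumes f: "abs_cont_on {0..pi} f" and b: "b < pi" and e: "e > 0"
  shows "\<exists>N. \<forall>P Q x. N \<le> P \<longrightarrow> P \<le> Q \<longrightarrow> 0 \<le> x \<longrightarrow> x \<le> b \<longrightarrow> \<bar>\<Sum>n\<in>{P..<Q}. coef f n * Phi (lam n) x\<bar> \<le> e"
proof -
  obtain B where B: "B \<ge> 0" "\<And>N x s. x \<in> {0..pi} \<Longrightarrow> s \<in> {0..pi} \<Longrightarrow> \<bar>\<Sum>n<N. kern n x s\<bar> \<le> B"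
    using kern_sum_bounded by blast
  \<comment> \<open>Half of e is reserved for s near x, where windows are bounded only by 2 * B, the
    other half for the rest through \<eta>; the added 1 excludes a zero denominator.\<close>
  define \<epsilon> where "\<epsilon> = e / (2 * (2 * B + 1))"
  have \<epsilon>: "\<epsilon> > 0" using e B by (simp add: \<epsilon>_def)
  obtain \<delta> V where \<delta>: "\<delta> > 0" "V \<ge> 0" "\<forall>D x B \<eta>. continuous_on {0..pi} D \<longrightarrow>
      (\<forall>s\<in>{0..pi}. \<bar>integral {0..s} D\<bar> \<le> B) \<longrightarrow>
      (\<forall>s\<in>{0..pi}. \<delta> \<le> \<bar>s - x\<bar> \<longrightarrow> \<bar>integral {0..s} D\<bar> \<le> \<eta>) \<longrightarrow> \<bar>integral {0..pi} D\<bar> \<le> \<eta> \<longrightarrow>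
      \<bar>integral {0..pi} (\<lambda>t. f t * D t)\<bar> \<le> V * \<eta> + \<epsilon> * B"
    using abs_cont_integral_bound[OF f \<epsilon>] by (elim exE conjE)
  define \<eta> where "\<eta> = e / (2 * (V + 1))"
  have \<eta>: "\<eta> > 0" using e \<delta> by (simp add: \<eta>_def)
  \<comment> \<open>The minimum also admits s = pi, at distance at least pi - b from x, as the
    boundary term requires.\<close>
  have d: "min \<delta> (pi - b) > 0" using \<delta> b by simp
  obtain N where N: "\<And>P Q x s. N \<le> P \<Longrightarrow> P \<le> Q \<Longrightarrow> 0 \<le> x \<Longrightarrow> x \<le> b \<Longrightarrow> s \<in> {0..pi} \<Longrightarrow> min \<delta> (pi - b) \<le> \<bar>s - x\<bar> \<Longrightarrow>
    \<bar>\<Sum>n\<in>{P..<Q}. kern n x s\<bar> \<le> \<eta>" using kern_sum_Cauchy[OF d b \<eta>] by blast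
  show ?thesis
  proof (intro exI[of _ N] allI impI)
    fix P Q x assume PQ: "N \<le> P" "P \<le> Q" and x: "0 \<le> x" "x \<le> b"
    have xx: "x \<in> {0..pi}" using x b by simp
    have W: "\<bar>\<Sum>n\<in>{P..<Q}. kern n x s\<bar> \<le> 2 * B" if s: "s \<in> {0..pi}" for s
    proof -
      have "(\<Sum>n<Q. kern n x s) = (\<Sum>n<P. kern n x s) + (\<Sum>n\<in>{P..<Q}. kern n x s)"
        unfolding lessThan_atLeast0 using PQ by (subst sum.atLeastLessThan_concat) auto
      then show ?thesis using B(2)[OF xx s, of P] B(2)[OF xx s, of Q] by linarith
    qed
    have "\<bar>\<Sum>n\<in>{P..<Q}. coef f n * Phi (lam n) x\<bar> \<le> V * \<eta> + \<epsilon> * (2 * B)"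
      unfolding kernel_expansion[OF finite_atLeastLessThan abs_cont_on_continuous[OF f], symmetric]
    proof (rule \<delta>(3)[rule_format, OF kernel_continuous, where x = x])
      fix s assume s: "s \<in> {0..pi}"
      show "\<bar>integral {0..s} (kernel {P..<Q} x)\<bar> \<le> 2 * B" unfolding kernel_integral[OF finite_atLeastLessThan s] by (rule W[OF s])
      assume "\<delta> \<le> \<bar>s - x\<bar>"
      then show "\<bar>integral {0..s} (kernel {P..<Q} x)\<bar> \<le> \<eta>"
        unfolding kernel_integral[OF finite_atLeastLessThan s] by (intro N PQ x s) simp
    next
      have "pi \<in> {0..pi}" by simp
      from kernel_integral[OF finite_atLeastLessThan this]
      show "\<bar>integral {0..pi} (kernel {P..<Q} x)\<bar> \<le> \<eta>" using N[OF PQ x, of pi] x by simp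
    qed
    also have "V * \<eta> \<le> e / 2" using \<delta>(2) e by (simp add: \<eta>_def field_simps)
    also have "\<epsilon> * (2 * B) \<le> e / 2" using B(1) e by (simp add: \<epsilon>_def field_simps)
    finally show "\<bar>\<Sum>n\<in>{P..<Q}. coef f n * Phi (lam n) x\<bar> \<le> e" by simp
  qed
qed

text \<open>Uniform convergence on [0,b] alone says nothing about coefficients over [0,pi]. The
  uniform bound M does, by dominated convergence to the pointwise limit g on the whole interval.
  Equality with f is then recovered on [0,b], where both are continuous.\<close>

lemma expansion_uniform:
  assumes f: "abs_cont_on {0..pi} f" and b: "0 < b" "b < pi" and e: "e > 0"
  shows "\<exists>N. \<forall>P\<ge>N. \<forall>x\<in>{0..b}. \<bar>f x - (\<Sum>n<P. coef f n * Phi (lam n) x)\<bar> \<le> e"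
proof -
  define S where "S N x = (\<Sum>n<N. coef f n * Phi (lam n) x)" for N x
  have fc: "continuous_on {0..pi} f" by (rule abs_cont_on_continuous[OF f])
  have Sc: "continuous_on {0..pi} (S N)" for N unfolding S_def by (intro continuous_intros Phi_continuous)
  obtain M where M: "\<And>N x. x \<in> {0..pi} \<Longrightarrow> \<bar>S N x\<bar> \<le> M" using partial_sums_bounded[OF f] unfolding S_def by blast
  \<comment> \<open>The endpoint c stays free: c = b serves uniform convergence, c = x pointwise
    convergence at each x < pi.\<close>
  have SC: "\<exists>N. \<forall>P\<ge>N. \<forall>Q\<ge>N. \<forall>x\<in>{0..c}. \<bar>S P x - S Q x\<bar> \<le> e" if c: "c < pi" and e: "e > 0" for c e
  proof -
    obtain N where N: "\<And>P Q x. N \<le> P \<Longrightarrow> P \<le> Q \<Longrightarrow> 0 \<le> x \<Longrightarrow> x \<le> c \<Longrightarrow> \<bar>\<Sum>n\<in>{P..<Q}. coef f n * Phi (lam n) x\<bar> \<le> e"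
      using partial_sums_Cauchy[OF f c e] by blast
    have *: "\<bar>S P x - S Q x\<bar> \<le> e" if "N \<le> P" "P \<le> Q" "x \<in> {0..c}" for P Q x
    proof -
      have "S Q x = S P x + (\<Sum>n\<in>{P..<Q}. coef f n * Phi (lam n) x)"
        unfolding S_def lessThan_atLeast0 using that by (subst sum.atLeastLessThan_concat) auto
      then show ?thesis using N[of P Q x] that by simp
    qed
    have "\<bar>S P x - S Q x\<bar> \<le> e" if "N \<le> P" "N \<le> Q" "x \<in> {0..c}" for P Q x
      using *[of P Q x] *[of Q P x] that by (cases "P \<le> Q") (auto simp: abs_minus_commute)
    then show ?thesis by blast
  qed
  define g where "g x = lim (\<lambda>N. S N x)" for x
  have lim: "(\<lambda>N. S N x) \<longlonglongrightarrow> g x" if x: "x \<in> {0..pi}" for x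
  proof (cases "x = pi")
    case True
    \<comment> \<open>All terms vanish at pi, so g pi = 0 whatever f pi is.\<close>
    have "Phi (lam n) pi = 0" for n using lam_ev[of n] by (simp add: ev_def)
    then show ?thesis using True by (simp add: g_def S_def)
  next
    case False
    have "Cauchy (\<lambda>N. S N x)"
    proof (rule CauchyI)
      fix e :: real assume "e > 0"
      then obtain N where N: "\<forall>P\<ge>N. \<forall>Q\<ge>N. \<forall>y\<in>{0..x}. \<bar>S P y - S Q y\<bar> \<le> e / 2" using SC[of x "e / 2"] x False by auto
      have "norm (S P x - S Q x) < e" if "P \<ge> N" "Q \<ge> N" for P Q
      proof -
        have "\<bar>S P x - S Q x\<bar> \<le> e / 2" using N that x by simp
        then show ?thesis using \<open>e > 0\<close> by simp
      qed
      then show "\<exists>M. \<forall>m\<ge>M. \<forall>n\<ge>M. norm (S m x - S n x) < e" by blast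
    qed
    then show ?thesis unfolding g_def by (simp add: convergent_LIMSEQ_iff Cauchy_convergent_iff)
  qed
  have gM: "\<bar>g x\<bar> \<le> M" if "x \<in> {0..pi}" for x
    using LIMSEQ_le_const2[OF tendsto_rabs[OF lim[OF that]], of M] M[OF that] by blast
  have unif: "\<exists>N. \<forall>P\<ge>N. \<forall>x\<in>{0..b}. \<bar>g x - S P x\<bar> \<le> e" if "e > 0" for e
  proof -
    obtain N where N: "\<And>P Q x. P \<ge> N \<Longrightarrow> Q \<ge> N \<Longrightarrow> x \<in> {0..b} \<Longrightarrow> \<bar>S Q x - S P x\<bar> \<le> e" using SC[OF b(2) \<open>e > 0\<close>] by blast
    have "\<bar>g x - S P x\<bar> \<le> e" if "P \<ge> N" "x \<in> {0..b}" for P x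
    proof (rule LIMSEQ_le_const2)
      show "(\<lambda>Q. \<bar>S Q x - S P x\<bar>) \<longlonglongrightarrow> \<bar>g x - S P x\<bar>"
        using that b by (intro tendsto_intros lim) auto
      show "\<exists>K. \<forall>Q\<ge>K. \<bar>S Q x - S P x\<bar> \<le> e" using N that by blast
    qed
    then show ?thesis by blast
  qed
  have gc: "continuous_on {0..b} g"
  proof (rule uniform_limit_theorem[of _ S sequentially])
    show "\<forall>\<^sub>F n in sequentially. continuous_on {0..b} (S n)"
      using continuous_on_subset[OF Sc] b by (intro always_eventually) auto
    show "uniform_limit {0..b} S g sequentially"
      unfolding uniform_limit_sequentially_iff dist_real_def
    proof (intro allI impI)
      fix e :: real assume "e > 0"
      then obtain N where "\<forall>P\<ge>N. \<forall>x\<in>{0..b}. \<bar>g x - S P x\<bar> \<le> e / 2" using unif[of "e / 2"] by auto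
      then have "\<forall>n\<ge>N. \<forall>x\<in>{0..b}. \<bar>S n x - g x\<bar> \<le> e / 2" by (simp add: abs_minus_commute)
      moreover have "e / 2 < e" using \<open>e > 0\<close> by simp
      ultimately show "\<exists>N. \<forall>n\<ge>N. \<forall>x\<in>{0..b}. \<bar>S n x - g x\<bar> < e" by (meson le_less_trans)
    qed
  qed simp
  have gi: "(\<lambda>t. g t * k t) integrable_on {0..pi}" "(\<lambda>N. ip (S N) k) \<longlonglongrightarrow> ip g k" if k: "continuous_on {0..pi} k" for k
  proof -
    have "bounded (k ` {0..pi})" using k by (intro compact_imp_bounded compact_continuous_image) auto
    then obtain Kb where "\<forall>t\<in>{0..pi}. \<bar>k t\<bar> \<le> Kb" by (auto simp: bounded_iff)
    then have Kb: "\<bar>k t\<bar> \<le> Kb" if "t \<in> {0..pi}" for t using that by blast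
    have 1: "(\<lambda>t. S N t * k t) integrable_on {0..pi}" for N by (rule ip_integrable_continuous[OF Sc k])
    have 2: "(\<lambda>t::real. M * Kb) integrable_on {0..pi}" by (rule integrable_const_ivl)
    have 3: "norm (S N t * k t) \<le> M * Kb" if "t \<in> {0..pi}" for N t
    proof -
      have "0 \<le> M" using M[OF that, of 0] by linarith
      then show ?thesis unfolding real_norm_def abs_mult using M[OF that, of N] Kb[OF that] by (intro mult_mono) auto
    qed
    have 4: "(\<lambda>N. S N t * k t) \<longlonglongrightarrow> g t * k t" if "t \<in> {0..pi}" for t using lim[OF that] by (intro tendsto_intros)
    show "(\<lambda>t. g t * k t) integrable_on {0..pi}" "(\<lambda>N. ip (S N) k) \<longlonglongrightarrow> ip g k"
      unfolding ip_def using dominated_convergence[of "\<lambda>N t. S N t * k t" "{0..pi}" "\<lambda>_. M * Kb" "\<lambda>t. g t * k t", OF 1 2 3 4] by blast+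
  qed
  have ga: "g absolutely_integrable_on {0..pi}"
    using gi(1)[of "\<lambda>_. 1"] gM by (intro absolutely_integrable_integrable_bound[of "{0..pi}" g "\<lambda>_. M"]) auto
  define h where "h t = f t - g t" for t
  have ha: "h absolutely_integrable_on {0..pi}"
    unfolding h_def using ga continuous_absolutely_integrable[OF fc] by (intro set_integral_diff)
  have "ip h (Phi \<mu>) = 0" if "\<mu> \<in> ev" for \<mu>
  proof -
    obtain m where m: "\<mu> = lam m" using lam_range \<open>\<mu> \<in> ev\<close> by blast
    have "ip (S N) (Phi (lam m)) = ip f (Phi (lam m))" if N: "N > m" for N
    proof -
      have i: "(\<lambda>t. C * (Phi (lam n) t * Phi (lam m) t)) integrable_on {0..pi}" for n C
        by (rule integrable_on_mult_right[OF ip_integrable_continuous[OF Phi_continuous Phi_continuous]])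
      have "ip (S N) (Phi (lam m)) = integral {0..pi} (\<lambda>t. \<Sum>n<N. coef f n * (Phi (lam n) t * Phi (lam m) t))"
        unfolding ip_def S_def sum_distrib_right by (simp add: mult_ac)
      also have "\<dots> = (\<Sum>n<N. coef f n * ip (Phi (lam n)) (Phi (lam m)))"
        unfolding ip_def integral_sum[OF finite_lessThan i] by simp
      also have "\<dots> = (\<Sum>n<N. if n = m then coef f m * ip (Phi (lam m)) (Phi (lam m)) else 0)"
        using Phi_orthogonal[OF lam_ev lam_ev] lam_inj by (intro sum.cong) auto
      also have "\<dots> = coef f m * ip (Phi (lam m)) (Phi (lam m))" using N by simp
      finally show ?thesis using Phi_norm_nonzero by (simp add: coef_def)
    qed
    \<comment> \<open>The inner product with a fixed eigenfunction is constant from N > m on, so the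
      limit g inherits the coefficient of f.\<close>
    then have "\<forall>\<^sub>F N in sequentially. ip (S N) (Phi (lam m)) = ip f (Phi (lam m))"
      by (rule eventually_mono[OF eventually_gt_at_top])
    then have "(\<lambda>N. ip (S N) (Phi (lam m))) \<longlonglongrightarrow> ip f (Phi (lam m))" by (rule tendsto_eventually)
    then have "ip g (Phi (lam m)) = ip f (Phi (lam m))" using gi(2)[OF Phi_continuous] LIMSEQ_unique by blast
    moreover have "ip h (Phi (lam m)) = ip f (Phi (lam m)) - ip g (Phi (lam m))"
      unfolding ip_def h_def left_diff_distrib
      by (rule integral_diff[OF ip_integrable_continuous[OF fc Phi_continuous] gi(1)[OF Phi_continuous]])
    ultimately show ?thesis by (simp add: m)
  qed
  then have hz: "integral {0..x} h = 0" if "x \<in> {0..pi}" for x by (intro eigenfunctions_complete[OF ha _ that])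
  have hc: "continuous_on {0..b} h"
    unfolding h_def using gc continuous_on_subset[OF fc, of "{0..b}"] b by (intro continuous_intros) auto
  have "f x = g x" if x: "x \<in> {0..b}" for x
  proof -
    have "((\<lambda>t. integral {0..t} h) has_vector_derivative h x) (at x within cbox 0 b)"
      using integral_has_vector_derivative[OF hc x] by simp
    moreover have "((\<lambda>t. integral {0..t} h) has_vector_derivative 0) (at x within cbox 0 b)"
      using x b by (intro has_vector_derivative_transform[OF _ _ has_vector_derivative_const[of 0]]) (simp_all add: hz)
    ultimately have "h x = 0" using vector_derivative_unique_within_closed_interval[of 0 b x] x b by auto
    then show ?thesis by (simp add: h_def)
  qed
  then show ?thesis using unif[OF e] by (simp add: S_def)
qed

end

theorem theorem2p4:
  fixes q f :: "real \<Rightarrow> real" and \<alpha> b :: real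
  assumes "q absolutely_integrable_on {0..pi}"
    and "0 < \<alpha>" and "\<alpha> < pi"
    and "abs_cont_on {0..pi} f"
    and "0 < b" and "b < pi"
  defines "\<phi> \<equiv> (\<lambda>n x. sl_phi q \<alpha> (sl_eigenvalue q \<alpha> 0 n) x)"
  defines "a \<equiv> (\<lambda>n. integral {0..pi} (\<lambda>x. (\<phi> n x)\<^sup>2))"
  defines "c \<equiv> (\<lambda>n. (1 / a n) * integral {0..pi} (\<lambda>t. f t * \<phi> n t))"
  shows "(\<lambda>N. Sup ((\<lambda>x. \<bar>f x - (\<Sum>n\<le>N. c n * \<phi> n x)\<bar>) ` {0..b})) \<longlonglongrightarrow> 0"
proof -
  interpret sturm_liouville q \<alpha> using assms by unfold_locales
  have \<phi>: "\<phi> n x = Phi (lam n) x" if "x \<in> {0..pi}" for n x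
    unfolding \<phi>_def lam_def using that by (rule sl_phi_eq)
  have a: "a n = ip (Phi (lam n)) (Phi (lam n))" for n
    unfolding a_def ip_def by (rule integral_cong) (simp add: \<phi> power2_eq_square)
  have "integral {0..pi} (\<lambda>t. f t * \<phi> n t) = ip f (Phi (lam n))" for n
    unfolding ip_def by (rule integral_cong) (simp add: \<phi>)
  then have c: "c n = coef f n" for n by (simp add: c_def coef_def a)
  have sum: "(\<Sum>n\<le>N. c n * \<phi> n x) = (\<Sum>n<Suc N. coef f n * Phi (lam n) x)" if "x \<in> {0..b}" for N x
    unfolding lessThan_Suc_atMost using that \<open>b < pi\<close> by (intro sum.cong) (simp_all add: c \<phi>)
  show ?thesis
  proof (rule LIMSEQ_I)
    fix e :: real assume "e > 0"
    then have "e / 2 > 0" by simp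
    then obtain N where N: "\<And>P x. P \<ge> N \<Longrightarrow> x \<in> {0..b} \<Longrightarrow> \<bar>f x - (\<Sum>n<P. coef f n * Phi (lam n) x)\<bar> \<le> e / 2"
      using expansion_uniform[OF \<open>abs_cont_on {0..pi} f\<close> \<open>0 < b\<close> \<open>b < pi\<close>] by blast
    have "norm (Sup ((\<lambda>x. \<bar>f x - (\<Sum>n\<le>P. c n * \<phi> n x)\<bar>) ` {0..b}) - 0) < e" if P: "P \<ge> N" for P
    proof -
      let ?A = "(\<lambda>x. \<bar>f x - (\<Sum>n\<le>P. c n * \<phi> n x)\<bar>) ` {0..b}"
      have le: "y \<le> e / 2" if "y \<in> ?A" for y using that N[of "Suc P"] P by (auto simp: sum)
      \<comment> \<open>The value at x = 0 makes the set non-empty and, being non-negative, bounds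
        its supremum below by 0.\<close>
      have ne: "\<bar>f 0 - (\<Sum>n\<le>P. c n * \<phi> n 0)\<bar> \<in> ?A" using \<open>0 < b\<close> by (intro imageI) simp
      have "Sup ?A \<le> e / 2" using ne le by (intro cSup_least) auto
      moreover have "\<bar>f 0 - (\<Sum>n\<le>P. c n * \<phi> n 0)\<bar> \<le> Sup ?A" by (rule cSup_upper[OF ne bdd_aboveI[OF le]])
      then have "0 \<le> Sup ?A" by (rule order_trans[OF abs_ge_zero])
      ultimately show ?thesis using \<open>e > 0\<close> by simp
    qed
    then show "\<exists>N. \<forall>P\<ge>N. norm (Sup ((\<lambda>x. \<bar>f x - (\<Sum>n\<le>P. c n * \<phi> n x)\<bar>) ` {0..b}) - 0) < e" by blast
  qed
qed

end
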